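(* Let $G$ be a topological group, let $K$ be a closed subgroup of $G$ and let $\theta: \mathrm{Comm}_G(K) \rightarrow \hat{G}_K$ be the localised profinite completion of $G$ at $K$. Given a subgroup $H$ of $\mathrm{Comm}_G(K)$, write $\tilde{H} = \overline{\theta(H)}$ (closure in $\hat{G}_K$). The following hold. (i) Suppose $G$ is discrete. Then, taken collectively, the localised profinite completions of $G$ at its commensurated subgroups account for every homomorphism from $G$ to a totally disconnected, locally compact (t.d.l.c.) group. Specifically, let $\phi: G \rightarrow R$ be a homomorphism to a t.d.l.c. group $R$, let $U$ be an open compact subgroup of $R$, and set (in this part) $K = \phi^{-1}(U)$, with $\theta: G \rightarrow \hat{G}_K$ the localised profinite completion of $G$ at this $K$. Then $G$ commensurates $K$ (since $\phi(G)$ commensurates $U$), that is, $\mathrm{Comm}_G(K) = G$; moreover, there is a unique continuous homomorphism $\psi: \hat{G}_K \rightarrow R$ such that $\phi = \psi\theta$. (ii) Let $H$ be a subgroup of $\mathrm{Comm}_G(K)$ that contains $K$. Then the map from $H$ to $\tilde{H}$ induced by $\theta$ is the localised profinite completion of $H$ at $K$. (iii) The induced map from $K$ to $\tilde{K}$ is the profinite completion of $K$. In particular $\hat{K}_K = \hat{K}$. (iv) The kernel of $\theta$ is the intersection of all closed subgroups of $K$ of finite index. Indeed $\theta^{-1}(\tilde{N}) = N$ for every closed subgroup $N$ of $K$ of finite index in $K$. (v) Let $K$ and $L$ be closed subgroups of $G$ such that $K$ is commensurate to $L$. Then $\hat{G}_K = \hat{G}_L$; indeed the localised profinite completion maps of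 $G$ at $K$ and at $L$ are identical (in the sense that $\mathrm{Comm}_G(K) = \mathrm{Comm}_G(L)$ and the localised profinite completion of $G$ at $K$ is also a localised profinite completion of $G$ at $L$). (vi) The homomorphism $\theta$ is continuous if and only if $K$ is open in $G$. (vii) Suppose that $G$ is discrete and $K$ is a commensurated subgroup of $G$ (that is, $\mathrm{Comm}_G(K) = G$); let $R$ be the core of $\tilde{K}$ in $\hat{G}_K$, that is, $R = \bigcap_{x \in \hat{G}_K} x\tilde{K}x^{-1}$. Then there is a topological quotient homomorphism (a continuous, open, surjective homomorphism) $\eta: \hat{G}_K \rightarrow G/\!/K$ with kernel $R$ such that $\tau_{G,K} = \eta\theta$. (viii) Suppose that $G$ is a t.d.l.c. group and $K$ is a profinite subgroup of $G$. Then $\theta(K)$ is closed in $\hat{G}_K$, and $\theta: \mathrm{Comm}_G(K) \rightarrow \hat{G}_K$ is an isomorphism of abstract groups such that $\theta^{-1}$ is continuous. In this case $\hat{G}_K \cong G_{(K)}$. In particular, if $K$ is open in $G$ then the localised profinite completion of $G$ at $K$ is an isomorphism of topological groups.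
   Context: $\overline{H}$ denotes topological closure. A profinite group is a compact, Hausdorff, totally disconnected topological group. Commensuration: two subgroups $H$ and $K$ of a group $G$ are commensurate if $H \cap K$ has finite index in both $H$ and $K$. The commensurator $\mathrm{Comm}_G(K)$ is the set of $g \in G$ such that $gKg^{-1}$ is commensurate with $K$; it is a subgroup of $G$. $G$ commensurates $K$ (or $K$ is commensurated) if $\mathrm{Comm}_G(K) = G$. Localised profinite completion, commensurated case: let $G$ be a topological group and $K$ a closed subgroup commensurated by $G$. The localised profinite completion of $G$ at $K$ is the group homomorphism $\theta: G \rightarrow \hat{G}_K$ to a topological group $\hat{G}_K$ characterised by the following two properties (such a $\theta$ exists, and is unique up to an isomorphism of topological groups compatible with the maps from $G$): (a) the image of $\theta$ is dense, $\theta|_K$ is continuous, and $\overline{\theta(K)}$ is an open profinite subgroup of $\hat{G}_K$; (b) for every topological group $R$ and every group homomorphism $\phi: G \rightarrow R$ such that $\phi|_K$ is continuous and $\overline{\phi(K)}$ is profinite, there is a unique continuous homomorphism $\psi: \hat{G}_K \rightarrow R$ with $\phi = \psi\theta$. Equalities such as $\hat{K}_K = \hat{K}$ are understood up to this canonical identification. General case: if $K$ is a closed subgroup of a topological group $G$, not necessarily commensurated by $G$, the localised profinite completion of $G$ at $K$ is defined to be that of $H$ at $K$, where $H = \mathrm{Comm}_G(K)$ with the subspace topology, and $\hat{G}_K := \hat{H}_K$; thus $\theta$ has domain $\mathrm{Comm}_G(K)$. Profinite completion: for a topological group $G$, the (topological) profinite completion $G \rightarrow \hat{G}$ is the inverse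 limit of the quotients $G/N$ as $N$ ranges over the closed normal subgroups of $G$ of finite index, together with the natural map. $G/\!/K$: for a discrete group $G$ with commensurated subgroup $K$, let $\tau_{G,K}: G \rightarrow \mathrm{Sym}(G/K)$ be the action of $G$ by left translation on the set $G/K$ of left cosets, where $\mathrm{Sym}(G/K)$ has the topology of pointwise convergence ($G/K$ discrete). Then $G/\!/K$ is the closure of $\tau_{G,K}(G)$ in $\mathrm{Sym}(G/K)$, and $\tau_{G,K}$ is regarded as a map $G \rightarrow G/\!/K$. $G_{(K)}$: for a t.d.l.c. group $G$ and a profinite subgroup $K$, the localisation $G_{(K)}$ of $G$ at $K$ is the group $\mathrm{Comm}_G(K)$ equipped with the unique group topology in which $K$, with its given profinite topology, is embedded as an open subgroup.
   Formalization: In (vi) "K is open in G" is replaced by "K is open in Comm_G(K)", with the original wording kept when Comm_G(K) is open in G; as written (vi) fails for G = ℝ ⋊ ℝ_{>0}, K = ℝ_{>0}, where Comm_G(K) = K and θ is trivial, hence continuous. *)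

theory Defs
  imports "HOL-Analysis.Analysis" "HOL-Algebra.Coset" "HOL-Algebra.Left_Coset"
    "HOL-Algebra.Bij" "HOL-Algebra.Product_Groups"
begin

text \<open>
  A topological group is a group \<open>G\<close> of HOL-Algebra together with an abstract topology \<open>T\<close> whose
  underlying set is \<open>carrier G\<close>; no separation axiom is assumed.  A subgroup \<open>H\<close> is regarded as the
  topological group \<open>G\<lparr>carrier := H\<rparr>\<close> with topology \<open>subtopology T H\<close>.
\<close>

locale topological_group = group G for G :: "('a, 'm) monoid_scheme" (structure) +
  fixes T :: "'a topology"
  assumes topspace_eq_carrier: "topspace T = carrier G"
    and continuous_mult: "continuous_map (prod_topology T T) T (\<lambda>(x, y). x \<otimes> y)"
    and continuous_inv: "continuous_map T T (\<lambda>x. inv x)"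

definition totally_disconnected_space :: "'a topology \<Rightarrow> bool" where
  "totally_disconnected_space X \<longleftrightarrow>
     (\<forall>x \<in> topspace X. connected_component_of_set X x = {x})"

definition profinite_group :: "('a, 'm) monoid_scheme \<Rightarrow> 'a topology \<Rightarrow> bool" where
  "profinite_group G T \<longleftrightarrow> topological_group G T \<and>
     compact_space T \<and> Hausdorff_space T \<and> totally_disconnected_space T"

definition tdlc_group :: "('a, 'm) monoid_scheme \<Rightarrow> 'a topology \<Rightarrow> bool" where
  "tdlc_group G T \<longleftrightarrow> topological_group G T \<and>
     totally_disconnected_space T \<and> locally_compact_space T"

definition topological_group_iso ::
  "('a, 'm) monoid_scheme \<Rightarrow> 'a topology \<Rightarrow> ('b, 'n) monoid_scheme \<Rightarrow> 'b topology
    \<Rightarrow> ('a \<Rightarrow> 'b) \<Rightarrow> bool" where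
  "topological_group_iso G T H S f \<longleftrightarrow> f \<in> iso G H \<and> homeomorphic_map T S f"


subsection \<open>Commensuration\<close>

definition finite_index :: "('a, 'm) monoid_scheme \<Rightarrow> 'a set \<Rightarrow> 'a set \<Rightarrow> bool" where
  "finite_index G N H \<longleftrightarrow>
     subgroup N (G\<lparr>carrier := H\<rparr>) \<and> finite (rcosets\<^bsub>G\<lparr>carrier := H\<rparr>\<^esub> N)"

definition commensurate :: "('a, 'm) monoid_scheme \<Rightarrow> 'a set \<Rightarrow> 'a set \<Rightarrow> bool" where
  "commensurate G H K \<longleftrightarrow> finite_index G (H \<inter> K) H \<and> finite_index G (H \<inter> K) K"

definition conjugate :: "('a, 'm) monoid_scheme \<Rightarrow> 'a \<Rightarrow> 'a set \<Rightarrow> 'a set" where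
  "conjugate G g K = (g <#\<^bsub>G\<^esub> K) #>\<^bsub>G\<^esub> inv\<^bsub>G\<^esub> g"

definition commensurator :: "('a, 'm) monoid_scheme \<Rightarrow> 'a set \<Rightarrow> 'a set" where
  "commensurator G K = {g \<in> carrier G. commensurate G (conjugate G g K) K}"


subsection \<open>The localised profinite completion\<close>

text \<open>
  The universal property quantifies over all topological groups \<open>R\<close>.  As HOL cannot quantify over
  types inside a formula, the type in which the carrier of \<open>R\<close> lives is made an explicit parameter.
  A property \<^emph>\<open>asserted\<close> for an arbitrary type variable \<open>'r\<close> is the unrestricted universal property.
  When a localised completion of a group on \<open>'a\<close> is \<^emph>\<open>assumed\<close> given, it suffices to take
  \<open>'r = 'a set \<Rightarrow> 'a set\<close>: this type accommodates a model of the completion, namely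
  the closure of the image of \<open>G\<close> in the group of permutations of
  the set of all left cosets of closed finite-index subgroups of \<open>K\<close>.

  The first definition is for \<open>K\<close> commensurated by \<open>G\<close>.  Functions are total, so \<open>\<psi>\<close> is required to
  be \<open>extensional\<close> in order for its uniqueness to be uniqueness on the carrier.
\<close>

definition localised_completion_commensurated ::
  "'r itself \<Rightarrow> 'a monoid \<Rightarrow> 'a topology \<Rightarrow> 'a set
    \<Rightarrow> 'h monoid \<Rightarrow> 'h topology \<Rightarrow> ('a \<Rightarrow> 'h) \<Rightarrow> bool" where
  "localised_completion_commensurated (_ :: 'r itself) G T K Gh Th \<theta> \<longleftrightarrow>
     topological_group G T \<and> subgroup K G \<and> closedin T K \<and> commensurator G K = carrier G \<and>
     topological_group Gh Th \<and> \<theta> \<in> hom G Gh \<and>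
     Th closure_of (\<theta> ` carrier G) = carrier Gh \<and>
     continuous_map (subtopology T K) Th \<theta> \<and>
     openin Th (Th closure_of (\<theta> ` K)) \<and>
     profinite_group (Gh\<lparr>carrier := Th closure_of (\<theta> ` K)\<rparr>)
       (subtopology Th (Th closure_of (\<theta> ` K))) \<and>
     (\<forall>(R :: 'r monoid) S \<phi>.
        topological_group R S \<and> \<phi> \<in> hom G R \<and>
        continuous_map (subtopology T K) S \<phi> \<and>
        profinite_group (R\<lparr>carrier := S closure_of (\<phi> ` K)\<rparr>)
          (subtopology S (S closure_of (\<phi> ` K)))
        \<longrightarrow> (\<exists>!\<psi>. \<psi> \<in> extensional (carrier Gh) \<and> \<psi> \<in> hom Gh R \<and> continuous_map Th S \<psi> \<and>
               (\<forall>g \<in> carrier G. \<phi> g = \<psi> (\<theta> g))))"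

definition localised_completion ::
  "'r itself \<Rightarrow> 'a monoid \<Rightarrow> 'a topology \<Rightarrow> 'a set
    \<Rightarrow> 'h monoid \<Rightarrow> 'h topology \<Rightarrow> ('a \<Rightarrow> 'h) \<Rightarrow> bool" where
  "localised_completion r G T K Gh Th \<theta> \<longleftrightarrow>
     topological_group G T \<and> subgroup K G \<and> closedin T K \<and>
     localised_completion_commensurated r
       (G\<lparr>carrier := commensurator G K\<rparr>) (subtopology T (commensurator G K)) K Gh Th \<theta>"


subsection \<open>The profinite completion\<close>

definition closed_finite_index_normals ::
  "('a, 'm) monoid_scheme \<Rightarrow> 'a topology \<Rightarrow> 'a set set" where
  "closed_finite_index_normals G T =
     {N. N \<lhd> G \<and> closedin T N \<and> finite_index G N (carrier G)}"

text \<open>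
  The transition map \<open>G/M \<rightarrow> G/N\<close>, for \<open>M \<subseteq> N\<close>, sends a coset of \<open>M\<close> to the unique coset of \<open>N\<close>
  containing it.  Each \<open>N\<close> is closed of finite index, hence open, so the quotient topology on \<open>G/N\<close>
  is discrete.
\<close>

definition profinite_completion ::
  "('a, 'm) monoid_scheme \<Rightarrow> 'a topology \<Rightarrow> ('a set \<Rightarrow> 'a set) monoid" where
  "profinite_completion G T =
     (let \<N> = closed_finite_index_normals G T; P = product_group \<N> (\<lambda>N. G Mod N)
      in P\<lparr>carrier := {x \<in> carrier P. \<forall>M \<in> \<N>. \<forall>N \<in> \<N>. M \<subseteq> N \<longrightarrow> x M \<subseteq> x N}\<rparr>)"

definition profinite_completion_topology ::
  "('a, 'm) monoid_scheme \<Rightarrow> 'a topology \<Rightarrow> ('a set \<Rightarrow> 'a set) topology" where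
  "profinite_completion_topology G T =
     subtopology
       (product_topology (\<lambda>N. discrete_topology (carrier (G Mod N)))
         (closed_finite_index_normals G T))
       (carrier (profinite_completion G T))"

definition profinite_completion_map ::
  "('a, 'm) monoid_scheme \<Rightarrow> 'a topology \<Rightarrow> 'a \<Rightarrow> 'a set \<Rightarrow> 'a set" where
  "profinite_completion_map G T g = (\<lambda>N \<in> closed_finite_index_normals G T. N #>\<^bsub>G\<^esub> g)"


subsection \<open>The closure of a group acting on a coset space\<close>

definition pointwise_topology :: "'b set \<Rightarrow> ('b \<Rightarrow> 'b) topology" where
  "pointwise_topology X =
     subtopology (product_topology (\<lambda>_. discrete_topology X) X) (carrier (BijGroup X))"

definition coset_action ::
  "('a, 'm) monoid_scheme \<Rightarrow> 'a set \<Rightarrow> 'a \<Rightarrow> 'a set \<Rightarrow> 'a set" where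
  "coset_action G K g = (\<lambda>C \<in> lcosets\<^bsub>G\<^esub> K. g <#\<^bsub>G\<^esub> C)"

text \<open>The group \<open>G//K\<close> and its topology; \<^term>\<open>coset_action G K\<close> is \<open>\<tau>\<^bsub>G,K\<^esub>\<close>.\<close>

definition coset_closure ::
  "('a, 'm) monoid_scheme \<Rightarrow> 'a set \<Rightarrow> ('a set \<Rightarrow> 'a set) monoid" where
  "coset_closure G K =
     (BijGroup (lcosets\<^bsub>G\<^esub> K))
       \<lparr>carrier := pointwise_topology (lcosets\<^bsub>G\<^esub> K) closure_of (coset_action G K ` carrier G)\<rparr>"

definition coset_closure_topology ::
  "('a, 'm) monoid_scheme \<Rightarrow> 'a set \<Rightarrow> ('a set \<Rightarrow> 'a set) topology" where
  "coset_closure_topology G K =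
     subtopology (pointwise_topology (lcosets\<^bsub>G\<^esub> K)) (carrier (coset_closure G K))"


subsection \<open>The localisation at a profinite subgroup\<close>

text \<open>
  \<open>G\<^bsub>(K)\<^esub>\<close> is the group \<open>G\<lparr>carrier := commensurator G K\<rparr>\<close> with the following topology.
\<close>

definition localisation_topology ::
  "('a, 'm) monoid_scheme \<Rightarrow> 'a topology \<Rightarrow> 'a set \<Rightarrow> 'a topology" where
  "localisation_topology G T K =
     (THE S. topological_group (G\<lparr>carrier := commensurator G K\<rparr>) S \<and>
        openin S K \<and> subtopology S K = subtopology T K)"

end

theory Submission
  imports Defs
begin

text \<open>The universal property of the localised completion \<open>\<theta> : G \<rightarrow> Gh\<close> at a commensurated closed subgroup
\<open>K\<close> is equivalent to an intrinsic condition, and every part of the theorem is read off from that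
condition.  Besides the requirements on the image of \<open>K\<close>, the condition asks that for each closed
subgroup \<open>N\<close> of finite index in \<open>K\<close> an element \<open>g\<close> whose image lies in the closure of \<open>\<theta>(N)\<close> already
lies in \<open>N\<close>.  It is the locale \<open>separating_completion\<close>.

That the universal property implies it is seen by letting \<open>G\<close> act on \<open>G/N\<close>.  As \<open>K\<close> is commensurated,
its orbits on \<open>G/N\<close> are finite, so the closure of the image of \<open>K\<close> in the permutation group of \<open>G/N\<close> is
profinite and the action extends to \<open>Gh\<close>; elements of the closure of \<open>\<theta>(N)\<close> must fix the coset \<open>N\<close>
(\<open>localised_completion_commensuratedD\<close>).  Conversely, a homomorphism \<open>\<phi>\<close> for which the closure of
\<open>\<phi>(K)\<close> is profinite extends to \<open>Gh\<close> along the closure of its graph (\<open>extension_exists\<close>): the condition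
makes that closure single-valued, because an open subgroup of a profinite group has finite index and
the open subgroups form a base at the identity (\<open>profinite_open_subgroup_base\<close>).  This argument
works for targets of any type.

The condition is inherited by intermediate subgroups, which is (ii), and by commensurate subgroups,
which is (v).  The inverse limit of the finite quotients of \<open>K\<close> satisfies it, and two completions of
the same pair are isomorphic (\<open>separating_completion_unique\<close>), which is (iii).  Parts (iv) and (vi)
say which elements map into \<open>tld N\<close>, the closure of \<open>\<theta>(N)\<close>, or to the identity.  Part (i) is the
extension property applied to a target in which a compact open subgroup \<open>U\<close> receives \<open>K\<close>, and \<open>U\<close> is
commensurated because it is compact and open.  In (vii) the action on \<open>G/K\<close> is extended to \<open>Gh\<close>; the
extension is onto and open because the image of the compact group \<open>tld K\<close> is the open stabiliser of the
coset \<open>K\<close>.  In (viii) the group \<open>K\<close> is compact and \<open>\<theta>\<close> is injective, so \<open>\<theta>\<close> identifies \<open>K\<close> with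
\<open>tld K\<close> and hence the commensurator with \<open>Gh\<close>.\<close>

section \<open>Subgroups of finite index and commensuration\<close>

context group
begin

lemma inv_mult_cancel_left: "\<lbrakk>g \<in> carrier G; z \<in> carrier G\<rbrakk> \<Longrightarrow> inv g \<otimes> (g \<otimes> z) = z"
  and mult_inv_cancel_left: "\<lbrakk>g \<in> carrier G; z \<in> carrier G\<rbrakk> \<Longrightarrow> g \<otimes> (inv g \<otimes> z) = z"
  by (simp_all flip: m_assoc)

lemmas group_normalise = m_assoc inv_mult_group inv_mult_cancel_left mult_inv_cancel_left

lemma subgroup_of_subgroup_iff:
  assumes "subgroup H G"
  shows "subgroup N (G\<lparr>carrier := H\<rparr>) \<longleftrightarrow> subgroup N G \<and> N \<subseteq> H"
proof
  assume N: "subgroup N (G\<lparr>carrier := H\<rparr>)"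
  then show "subgroup N G \<and> N \<subseteq> H"
    using incl_subgroup[OF assms N] subgroup.subset[OF N] by simp
next
  assume "subgroup N G \<and> N \<subseteq> H"
  then show "subgroup N (G\<lparr>carrier := H\<rparr>)"
    using subgroup_incl assms by blast
qed

text \<open>Right cosets define the index, but left coset representatives are what the topology needs: the
left coset \<open>f N\<close> is a translate of \<open>N\<close>.  Inverting the representatives passes from one to the other.\<close>

lemma finite_index_iff:
  assumes H: "subgroup H G"
  shows "finite_index G N H \<longleftrightarrow> subgroup N G \<and> N \<subseteq> H \<and>
    (\<exists>F. finite F \<and> F \<subseteq> H \<and> (\<forall>h\<in>H. \<exists>f\<in>F. inv f \<otimes> h \<in> N))"
proof (cases "subgroup N G \<and> N \<subseteq> H")
  case True
  then have N: "subgroup N G" and NH: "N \<subseteq> H" by auto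
  have HG: "h \<in> carrier G" if "h \<in> H" for h using that subgroup.subset[OF H] by auto
  have NG: "h \<in> carrier G" if "h \<in> N" for h using that subgroup.subset[OF N] by auto
  have rc: "rcosets\<^bsub>G\<lparr>carrier := H\<rparr>\<^esub> N = (\<lambda>h. N #> h) ` H"
    by (auto simp: RCOSETS_def r_coset_def)
  have mem: "N #> a = N #> b \<longleftrightarrow> a \<otimes> inv b \<in> N" if "a \<in> H" "b \<in> H" for a b
  proof
    assume "N #> a = N #> b"
    then have "a \<in> N #> b" using rcos_self[OF HG[OF that(1)] N] by simp
    then show "a \<otimes> inv b \<in> N"
      using subgroup.rcos_module_imp[OF N is_group HG[OF that(2)]] by blast
  next
    assume "a \<otimes> inv b \<in> N"
    then have "a \<in> N #> b"
      using subgroup.rcos_module_rev[OF N is_group HG[OF that(2)] HG[OF that(1)]] by blast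
    then show "N #> a = N #> b"
      using repr_independence[OF _ HG[OF that(2)] N] by metis
  qed
  have "finite ((\<lambda>h. N #> h) ` H) \<longleftrightarrow> (\<exists>F. finite F \<and> F \<subseteq> H \<and> (\<forall>h\<in>H. \<exists>f\<in>F. inv f \<otimes> h \<in> N))"
  proof
    assume "finite ((\<lambda>h. N #> h) ` H)"
    then obtain F where F: "F \<subseteq> H" "finite F" "(\<lambda>h. N #> h) ` H = (\<lambda>h. N #> h) ` F"
      using finite_subset_image[of "(\<lambda>h. N #> h) ` H" "\<lambda>h. N #> h" H] by blast
    have "\<exists>f\<in>F. f \<otimes> h \<in> N" if "h \<in> H" for h
    proof -
      have ih: "inv h \<in> H" using that H by (simp add: subgroup.m_inv_closed)
      then obtain f where f: "f \<in> F" "N #> inv h = N #> f" using F(3) by blast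
      then have "f \<otimes> inv (inv h) \<in> N" using mem[of f "inv h"] ih F(1) by auto
      then show ?thesis using f HG[OF that] by auto
    qed
    then have "\<forall>h\<in>H. \<exists>f\<in>m_inv G ` F. inv f \<otimes> h \<in> N"
      using F(1) HG by force
    moreover have "m_inv G ` F \<subseteq> H" using F(1) H by (auto simp: subgroup.m_inv_closed)
    ultimately show "\<exists>F. finite F \<and> F \<subseteq> H \<and> (\<forall>h\<in>H. \<exists>f\<in>F. inv f \<otimes> h \<in> N)"
      using F(2) by blast
  next
    assume "\<exists>F. finite F \<and> F \<subseteq> H \<and> (\<forall>h\<in>H. \<exists>f\<in>F. inv f \<otimes> h \<in> N)"
    then obtain F where F: "finite F" "F \<subseteq> H" "\<And>h. h \<in> H \<Longrightarrow> \<exists>f\<in>F. inv f \<otimes> h \<in> N" by blast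
    have "(\<lambda>h. N #> h) ` H \<subseteq> (\<lambda>f. N #> inv f) ` F"
    proof safe
      fix h assume h: "h \<in> H"
      have ih: "inv h \<in> H" using h H by (simp add: subgroup.m_inv_closed)
      obtain f where f: "f \<in> F" "inv f \<otimes> inv h \<in> N" using F(3)[OF ih] by blast
      have fH: "f \<in> H" using f F by auto
      have "inv f \<in> H" using fH H by (simp add: subgroup.m_inv_closed)
      then have "N #> inv f = N #> h" using mem[of "inv f" h] f h by auto
      then show "N #> h \<in> (\<lambda>f. N #> inv f) ` F" using f by auto
    qed
    then show "finite ((\<lambda>h. N #> h) ` H)" using F(1) finite_subset by blast
  qed
  then show ?thesis using True rc subgroup_of_subgroup_iff[OF H] unfolding finite_index_def by simp
next
  case False
  then show ?thesis using subgroup_of_subgroup_iff[OF H, of N] unfolding finite_index_def by metis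
qed

lemma finite_indexI:
  assumes "subgroup H G" "subgroup N G" "N \<subseteq> H"
    and "finite F" "F \<subseteq> H" "\<And>h. h \<in> H \<Longrightarrow> \<exists>f\<in>F. inv f \<otimes> h \<in> N"
  shows "finite_index G N H"
  using assms by (auto simp: finite_index_iff)

lemma finite_index_refl:
  assumes "subgroup H G" shows "finite_index G H H"
proof (rule finite_indexI[OF assms assms, of "{\<one>}"])
  show "{\<one>} \<subseteq> H" using subgroup.one_closed[OF assms] by simp
  show "\<exists>f\<in>{\<one>}. inv f \<otimes> h \<in> H" if "h \<in> H" for h
    using subgroup.mem_carrier[OF assms that] that by simp
qed auto

lemma finite_index_subset: "subgroup H G \<Longrightarrow> finite_index G N H \<Longrightarrow> N \<subseteq> H"
  and finite_index_subgroup: "subgroup H G \<Longrightarrow> finite_index G N H \<Longrightarrow> subgroup N G"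
  by (simp_all add: finite_index_iff)

lemma finite_index_coset_reps:
  assumes "subgroup H G" "finite_index G N H"
  obtains F where "finite F" "F \<subseteq> H" "\<And>h. h \<in> H \<Longrightarrow> \<exists>f\<in>F. \<exists>n\<in>N. h = f \<otimes> n"
proof -
  obtain F where F: "finite F" "F \<subseteq> H" "\<forall>h\<in>H. \<exists>f\<in>F. inv f \<otimes> h \<in> N"
    using assms by (auto simp: finite_index_iff)
  have "\<exists>f\<in>F. \<exists>n\<in>N. h = f \<otimes> n" if h: "h \<in> H" for h
  proof -
    obtain f where f: "f \<in> F" "inv f \<otimes> h \<in> N" using F(3) h by blast
    have "h \<in> carrier G" "f \<in> carrier G"
      using f h F(2) subgroup.mem_carrier[OF assms(1)] by auto
    then have "h = f \<otimes> (inv f \<otimes> h)" by (simp add: group_normalise)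
    then show ?thesis using f by blast
  qed
  then show ?thesis using that F by blast
qed

lemma finite_index_trans:
  assumes C: "subgroup C G" and AB: "finite_index G A B" and BC: "finite_index G B C"
  shows "finite_index G A C"
proof -
  have B: "subgroup B G" and BsC: "B \<subseteq> C"
    using C BC by (simp_all add: finite_index_iff)
  have A: "subgroup A G" and AsB: "A \<subseteq> B"
    using B AB by (simp_all add: finite_index_iff)
  obtain E where E: "finite E" "E \<subseteq> C" "\<And>h. h \<in> C \<Longrightarrow> \<exists>f\<in>E. \<exists>n\<in>B. h = f \<otimes> n"
    using finite_index_coset_reps[OF C BC] by metis
  obtain F where F: "finite F" "F \<subseteq> B" "\<And>h. h \<in> B \<Longrightarrow> \<exists>f\<in>F. \<exists>n\<in>A. h = f \<otimes> n"
    using finite_index_coset_reps[OF B AB] by metis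
  show ?thesis
  proof (rule finite_indexI[OF C A])
    show "A \<subseteq> C" using AsB BsC by auto
    show "finite ((\<lambda>(e,f). e \<otimes> f) ` (E \<times> F))" using E F by auto
    show "(\<lambda>(e,f). e \<otimes> f) ` (E \<times> F) \<subseteq> C"
      using E(2) F(2) BsC subgroup.m_closed[OF C] by force
    fix h assume "h \<in> C"
    then obtain e b where eb: "e \<in> E" "b \<in> B" "h = e \<otimes> b" using E(3) by blast
    obtain f a where fa: "f \<in> F" "a \<in> A" "b = f \<otimes> a" using F(3)[OF eb(2)] by blast
    have c: "e \<in> carrier G" "f \<in> carrier G" "a \<in> carrier G"
      using eb fa E(2) F(2) subgroup.subset[OF A] subgroup.subset[OF B] subgroup.subset[OF C] by auto
    have "inv (e \<otimes> f) \<otimes> h = a"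
      using c eb fa by (simp add: group_normalise)
    then show "\<exists>g\<in>(\<lambda>(e,f). e \<otimes> f) ` (E \<times> F). inv g \<otimes> h \<in> A"
      using eb fa by force
  qed
qed

text \<open>Among representatives of \<open>B\<close> modulo \<open>A\<close>, keep those whose coset meets \<open>B \<inter> C\<close> and move each
  into \<open>B \<inter> C\<close> within its coset.\<close>

lemma finite_index_Int:
  assumes B: "subgroup B G" and AB: "finite_index G A B" and C: "subgroup C G"
  shows "finite_index G (A \<inter> C) (B \<inter> C)"
proof -
  have A: "subgroup A G" and AsB: "A \<subseteq> B"
    using B AB by (simp_all add: finite_index_iff)
  obtain F where F: "finite F" "F \<subseteq> B" "\<And>h. h \<in> B \<Longrightarrow> \<exists>f\<in>F. \<exists>n\<in>A. h = f \<otimes> n"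
    using finite_index_coset_reps[OF B AB] by metis
  define P where "P f g \<longleftrightarrow> g \<in> B \<inter> C \<and> inv f \<otimes> g \<in> A" for f g
  define r where "r f = (SOME g. P f g)" for f
  let ?F = "{f \<in> F. \<exists>g. P f g}"
  have r: "P f (r f)" if "f \<in> ?F" for f using that someI_ex[of "P f"] by (auto simp: r_def)
  show ?thesis
  proof (rule finite_indexI)
    show "subgroup (B \<inter> C) G" "subgroup (A \<inter> C) G"
      using A B C by (simp_all add: subgroups_Inter_pair)
    show "A \<inter> C \<subseteq> B \<inter> C" using AsB by auto
    show "finite (r ` ?F)" using F by auto
    show "r ` ?F \<subseteq> B \<inter> C" using r unfolding P_def by blast
    fix h assume h: "h \<in> B \<inter> C"
    then obtain f a where fa: "f \<in> F" "a \<in> A" "h = f \<otimes> a" using F(3) by blast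
    have c: "f \<in> carrier G" "a \<in> carrier G" using fa F(2) subgroup.subset[OF A] subgroup.subset[OF B] by auto
    have a: "a = inv f \<otimes> h" using c fa by (simp add: group_normalise)
    then have "P f h" using h fa by (simp add: P_def)
    then have fF: "f \<in> ?F" using fa by auto
    have rp: "r f \<in> B \<inter> C" "inv f \<otimes> r f \<in> A" using r[OF fF] by (auto simp: P_def)
    have rc: "r f \<in> carrier G" "h \<in> carrier G" using rp h subgroup.subset[OF B] by auto
    have "inv (r f) \<otimes> h = inv (inv f \<otimes> r f) \<otimes> (inv f \<otimes> h)"
      using c rc by (simp add: group_normalise)
    also have "\<dots> \<in> A"
      using rp a fa A by (metis subgroup.m_closed subgroup.m_inv_closed)
    finally have "inv (r f) \<otimes> h \<in> A" .
    moreover have "inv (r f) \<otimes> h \<in> C"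
      using rp h C by (auto intro: subgroup.m_closed subgroup.m_inv_closed)
    ultimately show "\<exists>g\<in>r ` ?F. inv g \<otimes> h \<in> A \<inter> C" using fF by blast
  qed
qed

lemma finite_index_between:
  assumes C: "subgroup C G" and AC: "finite_index G A C"
    and B: "subgroup B G" "A \<subseteq> B" "B \<subseteq> C"
  shows "finite_index G B C" "finite_index G A B"
proof -
  show "finite_index G B C"
  proof -
    obtain F where "finite F" "F \<subseteq> C" "\<forall>h\<in>C. \<exists>f\<in>F. inv f \<otimes> h \<in> A"
      using AC by (auto simp: finite_index_iff[OF C])
    then show ?thesis using B by (intro finite_indexI[OF C, of B F]) blast+
  qed
  have "A \<inter> B = A" "C \<inter> B = B" using B by auto
  then show "finite_index G A B" using finite_index_Int[OF C AC B(1)] by simp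
qed

lemma finite_index_Int2:
  assumes C: "subgroup C G" and "finite_index G A C" "finite_index G B C"
  shows "finite_index G (A \<inter> B) C"
proof -
  have B: "subgroup B G" "B \<subseteq> C" using assms by (auto simp: finite_index_iff)
  have "finite_index G (A \<inter> B) (C \<inter> B)" using finite_index_Int[OF C assms(2) B(1)] .
  moreover have "C \<inter> B = B" using B by auto
  ultimately show ?thesis using finite_index_trans[OF C] assms(3) by metis
qed

end

text \<open>The index of \<open>A \<inter> \<phi>(H)\<close> in \<open>\<phi>(H)\<close> is finite because \<open>\<phi>(H) \<subseteq> B\<close>; representatives of these cosets
lift to \<open>H\<close>.\<close>

lemma finite_index_vimage:
  assumes "group G" "group R" "\<phi> \<in> hom G R" and B: "subgroup B R" and AB: "finite_index R A B"
    and H: "subgroup H G" "\<phi> ` H \<subseteq> B"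
  shows "finite_index G {g \<in> H. \<phi> g \<in> A} H"
proof -
  interpret G: group G by fact
  interpret R: group R by fact
  interpret \<phi>: group_hom G R \<phi> using assms by (simp add: group_hom_def group_hom_axioms_def)
  have A: "subgroup A R" and AsB: "A \<subseteq> B"
    using B AB by (simp_all add: R.finite_index_iff)
  have HG: "h \<in> carrier G" if "h \<in> H" for h using that subgroup.subset[OF H(1)] by auto
  have sub: "subgroup {g \<in> H. \<phi> g \<in> A} G"
    by (rule G.subgroupI)
      (use A H HG in \<open>auto simp: subgroup.m_closed subgroup.m_inv_closed subgroup.one_closed
        intro!: exI[of _ "\<one>\<^bsub>G\<^esub>"]\<close>)
  have im: "subgroup (\<phi> ` H) R" using \<phi>.subgroup_img_is_subgroup[OF H(1)] .
  have "finite_index R (A \<inter> \<phi> ` H) (B \<inter> \<phi> ` H)" using R.finite_index_Int[OF B AB im] .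
  moreover have "B \<inter> \<phi> ` H = \<phi> ` H" using H by auto
  ultimately have "finite_index R (A \<inter> \<phi> ` H) (\<phi> ` H)" by simp
  then obtain F where F: "finite F" "F \<subseteq> \<phi> ` H" "\<forall>h\<in>\<phi> ` H. \<exists>f\<in>F. inv\<^bsub>R\<^esub> f \<otimes>\<^bsub>R\<^esub> h \<in> A \<inter> \<phi> ` H"
    using R.finite_index_iff[OF im] by metis
  obtain E where E: "E \<subseteq> H" "finite E" "F = \<phi> ` E" using F finite_subset_image by metis
  show ?thesis
  proof (rule G.finite_indexI[OF H(1) sub _ E(2) E(1)])
    fix h assume h: "h \<in> H"
    then obtain e where e: "e \<in> E" "inv\<^bsub>R\<^esub> \<phi> e \<otimes>\<^bsub>R\<^esub> \<phi> h \<in> A" using F E by blast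
    then have eH: "e \<in> H" using E by auto
    then have "\<phi> (inv\<^bsub>G\<^esub> e \<otimes>\<^bsub>G\<^esub> h) \<in> A" using e h HG by simp
    moreover have "inv\<^bsub>G\<^esub> e \<otimes>\<^bsub>G\<^esub> h \<in> H"
      using eH h H by (auto simp: subgroup.m_closed subgroup.m_inv_closed)
    ultimately show "\<exists>f\<in>E. inv\<^bsub>G\<^esub> f \<otimes>\<^bsub>G\<^esub> h \<in> {g \<in> H. \<phi> g \<in> A}" using e by blast
  qed auto
qed

context group
begin

lemma conjugate_eq_image: "conjugate G g K = (\<lambda>k. g \<otimes> k \<otimes> inv g) ` K"
  by (auto simp: conjugate_def l_coset_def r_coset_def)

lemma mem_conjugate_iff:
  assumes "g \<in> carrier G" "K \<subseteq> carrier G"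
  shows "x \<in> conjugate G g K \<longleftrightarrow> x \<in> carrier G \<and> inv g \<otimes> x \<otimes> g \<in> K"
proof
  assume "x \<in> conjugate G g K"
  then obtain k where k: "k \<in> K" "x = g \<otimes> k \<otimes> inv g" by (auto simp: conjugate_eq_image)
  have kc: "k \<in> carrier G" using k assms by auto
  have "inv g \<otimes> x \<otimes> g = k"
    using k kc assms by (simp add: group_normalise)
  then show "x \<in> carrier G \<and> inv g \<otimes> x \<otimes> g \<in> K" using k kc assms by simp
next
  assume x: "x \<in> carrier G \<and> inv g \<otimes> x \<otimes> g \<in> K"
  have "x = g \<otimes> (inv g \<otimes> x \<otimes> g) \<otimes> inv g"
    using x assms by (simp add: group_normalise)
  then show "x \<in> conjugate G g K" using x by (auto simp: conjugate_eq_image)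
qed

lemma conjugation_hom: "g \<in> carrier G \<Longrightarrow> (\<lambda>x. g \<otimes> x \<otimes> inv g) \<in> hom G G"
  by (rule homI) (simp_all add: group_normalise)

lemma conjugate_subgroup:
  assumes "g \<in> carrier G" "subgroup K G"
  shows "subgroup (conjugate G g K) G"
proof -
  interpret group_hom G G "\<lambda>x. g \<otimes> x \<otimes> inv g"
    using conjugation_hom[OF assms(1)] by unfold_locales
  show ?thesis using subgroup_img_is_subgroup[OF assms(2)] by (simp add: conjugate_eq_image)
qed

lemma conjugate_conjugate:
  assumes "g \<in> carrier G" "h \<in> carrier G" "K \<subseteq> carrier G"
  shows "conjugate G (g \<otimes> h) K = conjugate G g (conjugate G h K)"
  using assms unfolding conjugate_eq_image image_image
  by (intro image_cong) (auto simp: group_normalise subset_iff)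

lemma conjugate_one: "K \<subseteq> carrier G \<Longrightarrow> conjugate G \<one> K = K"
  by (auto simp: mem_conjugate_iff subset_iff)

lemma conjugate_by_member:
  assumes K: "subgroup K G" and k: "k \<in> K"
  shows "conjugate G k K = K"
proof -
  have kc: "k \<in> carrier G" and KG: "K \<subseteq> carrier G"
    using k subgroup.subset[OF K] by auto
  have "x \<in> conjugate G k K \<longleftrightarrow> x \<in> K" for x
  proof
    assume "x \<in> conjugate G k K"
    then show "x \<in> K" using K k
      by (auto simp: conjugate_eq_image subgroup.m_closed subgroup.m_inv_closed)
  next
    assume x: "x \<in> K"
    then have "inv k \<otimes> x \<otimes> k \<in> K" using K k
      by (auto simp: subgroup.m_closed subgroup.m_inv_closed)
    then show "x \<in> conjugate G k K" using x kc KG mem_conjugate_iff by auto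
  qed
  then show ?thesis by blast
qed

lemma finite_index_conjugate:
  assumes g: "g \<in> carrier G" and B: "subgroup B G" and AB: "finite_index G A B"
  shows "finite_index G (conjugate G g A) (conjugate G g B)"
proof -
  have A: "subgroup A G" and AsB: "A \<subseteq> B" using B AB by (simp_all add: finite_index_iff)
  have AG: "A \<subseteq> carrier G" and BG: "B \<subseteq> carrier G" using subgroup.subset[OF A] subgroup.subset[OF B] by auto
  have h: "(\<lambda>x. inv g \<otimes> x \<otimes> g) \<in> hom G G"
    using conjugation_hom[of "inv g"] g by simp
  have "finite_index G {x \<in> conjugate G g B. inv g \<otimes> x \<otimes> g \<in> A} (conjugate G g B)"
    by (rule finite_index_vimage[OF is_group is_group h B AB conjugate_subgroup[OF g B]])
      (use g BG in \<open>auto simp: mem_conjugate_iff\<close>)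
  moreover have "{x \<in> conjugate G g B. inv g \<otimes> x \<otimes> g \<in> A} = conjugate G g A"
    using AsB g AG BG by (auto simp: mem_conjugate_iff)
  ultimately show ?thesis by simp
qed

lemma conjugate_Int:
  assumes "g \<in> carrier G" "A \<subseteq> carrier G" "B \<subseteq> carrier G"
  shows "conjugate G g (A \<inter> B) = conjugate G g A \<inter> conjugate G g B"
proof -
  have "A \<inter> B \<subseteq> carrier G" using assms by auto
  then show ?thesis using assms by (auto simp: mem_conjugate_iff)
qed

lemma commensurate_refl: "subgroup H G \<Longrightarrow> commensurate G H H"
  by (simp add: commensurate_def finite_index_refl)

lemma commensurate_sym: "commensurate G H K \<Longrightarrow> commensurate G K H"
  by (simp add: commensurate_def Int_commute)

text \<open>The triple intersection \<open>H \<inter> K \<inter> L\<close> already has finite index in \<open>H\<close>: it has finite index in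
\<open>H \<inter> K\<close>, by intersecting \<open>K \<inter> L \<subseteq> K\<close> with \<open>H\<close>.\<close>

lemma commensurate_trans:
  assumes H: "subgroup H G" and K: "subgroup K G" and L: "subgroup L G"
    and HK: "commensurate G H K" and KL: "commensurate G K L"
  shows "commensurate G H L"
proof -
  have one_side: "finite_index G (A \<inter> C) A"
    if A: "subgroup A G" and B: "subgroup B G" and C: "subgroup C G"
      and AB: "commensurate G A B" and BC: "commensurate G B C" for A B C
  proof -
    have "finite_index G ((B \<inter> C) \<inter> A) (B \<inter> A)"
      using finite_index_Int[OF B _ A] BC by (simp add: commensurate_def)
    moreover have "finite_index G (B \<inter> A) A" using AB by (simp add: commensurate_def Int_commute)
    ultimately have "finite_index G ((B \<inter> C) \<inter> A) A" using finite_index_trans[OF A] by blast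
    then show ?thesis
      by (rule finite_index_between(1)[OF A]) (use A C in \<open>auto simp: subgroups_Inter_pair\<close>)
  qed
  show ?thesis
    using one_side[OF H K L HK KL]
      one_side[OF L K H commensurate_sym[OF KL] commensurate_sym[OF HK]]
    by (simp add: commensurate_def Int_commute)
qed

lemma commensurate_conjugate:
  assumes "g \<in> carrier G" "subgroup H G" "subgroup K G" "commensurate G H K"
  shows "commensurate G (conjugate G g H) (conjugate G g K)"
  using assms subgroup.subset[OF assms(2)] subgroup.subset[OF assms(3)]
  by (simp add: commensurate_def conjugate_Int[symmetric] finite_index_conjugate)

lemma commensurator_subset: "commensurator G K \<subseteq> carrier G"
  by (auto simp: commensurator_def)

lemma subset_commensurator: "subgroup K G \<Longrightarrow> K \<subseteq> commensurator G K"
  by (auto simp: commensurator_def conjugate_by_member commensurate_refl dest: subgroup.mem_carrier)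

lemma subgroup_commensurator:
  assumes K: "subgroup K G"
  shows "subgroup (commensurator G K) G"
proof (rule subgroupI)
  have KG: "K \<subseteq> carrier G" using subgroup.subset[OF K] by auto
  show "commensurator G K \<subseteq> carrier G" by (rule commensurator_subset)
  show "commensurator G K \<noteq> {}"
    using subset_commensurator[OF K] subgroup.one_closed[OF K] by auto
  fix g assume g: "g \<in> commensurator G K"
  then have gc: "g \<in> carrier G" and gK: "commensurate G (conjugate G g K) K"
    by (auto simp: commensurator_def)
  have "commensurate G (conjugate G (inv g) (conjugate G g K)) (conjugate G (inv g) K)"
    using commensurate_conjugate[OF _ conjugate_subgroup[OF gc K] K gK] gc by simp
  then have "commensurate G K (conjugate G (inv g) K)"
    using gc KG conjugate_conjugate[of "inv g" g K] by (simp add: conjugate_one)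
  then show "inv g \<in> commensurator G K"
    using gc commensurate_sym by (simp add: commensurator_def)
  fix h assume h: "h \<in> commensurator G K"
  then have hc: "h \<in> carrier G" and hK: "commensurate G (conjugate G h K) K"
    by (auto simp: commensurator_def)
  have "commensurate G (conjugate G g (conjugate G h K)) (conjugate G g K)"
    using commensurate_conjugate[OF gc conjugate_subgroup[OF hc K] K hK] .
  then have "commensurate G (conjugate G (g \<otimes> h) K) K"
    using commensurate_trans[OF _ conjugate_subgroup[OF gc K] K _ gK]
      conjugate_subgroup gc hc K conjugate_conjugate[OF gc hc KG] by simp
  then show "g \<otimes> h \<in> commensurator G K" using gc hc by (simp add: commensurator_def)
qed

lemma commensurator_mono_commensurate:
  assumes K: "subgroup K G" and L: "subgroup L G" and KL: "commensurate G K L"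
  shows "commensurator G K \<subseteq> commensurator G L"
proof
  fix g assume "g \<in> commensurator G K"
  then have gc: "g \<in> carrier G" and gK: "commensurate G (conjugate G g K) K"
    by (auto simp: commensurator_def)
  have "commensurate G (conjugate G g L) (conjugate G g K)"
    using commensurate_conjugate[OF gc L K commensurate_sym[OF KL]] .
  then have "commensurate G (conjugate G g L) K"
    using commensurate_trans conjugate_subgroup gc K L gK by blast
  then have "commensurate G (conjugate G g L) L"
    using commensurate_trans conjugate_subgroup gc K L KL by blast
  then show "g \<in> commensurator G L" using gc by (simp add: commensurator_def)
qed

lemma commensurator_commensurate_eq:
  assumes "subgroup K G" "subgroup L G" "commensurate G K L"
  shows "commensurator G K = commensurator G L"
  using assms commensurator_mono_commensurate commensurate_sym by blast

lemma conjugate_consistent: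
  assumes "subgroup H G" "h \<in> H"
  shows "conjugate (G\<lparr>carrier := H\<rparr>) h K = conjugate G h K"
  using assms by (simp add: conjugate_def)

lemma finite_index_consistent [simp]:
  "finite_index (G\<lparr>carrier := H\<rparr>) A B = finite_index G A B"
  by (simp add: finite_index_def)

lemma commensurate_consistent [simp]:
  "commensurate (G\<lparr>carrier := H\<rparr>) A B = commensurate G A B"
  by (simp add: commensurate_def)

lemma commensurator_consistent:
  assumes "subgroup H G"
  shows "commensurator (G\<lparr>carrier := H\<rparr>) K = commensurator G K \<inter> H"
  using assms subgroup.subset[OF assms]
  by (auto simp: commensurator_def conjugate_consistent)

end

section \<open>Totally disconnected spaces and topological groups\<close>

lemma totally_disconnected_space_iff:
  "totally_disconnected_space X \<longleftrightarrow> (\<forall>C x y. connectedin X C \<and> x \<in> C \<and> y \<in> C \<longrightarrow> x = y)"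
proof
  assume L: "totally_disconnected_space X"
  show "\<forall>C x y. connectedin X C \<and> x \<in> C \<and> y \<in> C \<longrightarrow> x = y"
  proof (intro allI impI)
    fix C x y assume C: "connectedin X C \<and> x \<in> C \<and> y \<in> C"
    then have "x \<in> topspace X" using connectedin_subset_topspace by blast
    then have "connected_component_of_set X x = {x}"
      using L by (simp add: totally_disconnected_space_def)
    moreover have "C \<subseteq> connected_component_of_set X x"
      using C by (simp add: connected_component_of_maximal)
    ultimately show "x = y" using C by auto
  qed
next
  assume R: "\<forall>C x y. connectedin X C \<and> x \<in> C \<and> y \<in> C \<longrightarrow> x = y"
  show "totally_disconnected_space X"
    unfolding totally_disconnected_space_def
  proof
    fix x assume "x \<in> topspace X"
    then have "x \<in> connected_component_of_set X x"
      by (simp add: connected_component_of_refl)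
    moreover have "y = x" if "y \<in> connected_component_of_set X x" for y
      using R connectedin_connected_component_of[of X x] that calculation by blast
    ultimately show "connected_component_of_set X x = {x}" by blast
  qed
qed

lemma totally_disconnected_space_subtopology:
  "totally_disconnected_space X \<Longrightarrow> totally_disconnected_space (subtopology X S)"
  unfolding totally_disconnected_space_iff connectedin_subtopology by blast

lemma totally_disconnected_space_discrete: "totally_disconnected_space (discrete_topology U)"
  by (auto simp: totally_disconnected_space_iff connectedin_discrete_topology)

lemma totally_disconnected_space_product:
  assumes "\<And>i. i \<in> I \<Longrightarrow> totally_disconnected_space (X i)"
  shows "totally_disconnected_space (product_topology X I)"
  unfolding totally_disconnected_space_iff
proof (intro allI impI)
  fix C x y assume C: "connectedin (product_topology X I) C \<and> x \<in> C \<and> y \<in> C"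
  then have top: "x \<in> topspace (product_topology X I)" "y \<in> topspace (product_topology X I)"
    using connectedin_subset_topspace by blast+
  have "x i = y i" if i: "i \<in> I" for i
  proof -
    have "connectedin (X i) ((\<lambda>z. z i) ` C)"
      using connectedin_continuous_map_image[OF continuous_map_product_projection[OF i]] C by blast
    then show ?thesis
      using assms[OF i] C unfolding totally_disconnected_space_iff by blast
  qed
  then show "x = y" using top by (auto simp: intro: PiE_ext)
qed

lemma (in group) mem_l_coset_iff:
  assumes "g \<in> carrier G" "U \<subseteq> carrier G"
  shows "x \<in> g <# U \<longleftrightarrow> x \<in> carrier G \<and> inv g \<otimes> x \<in> U"
proof
  assume "x \<in> g <# U"
  then obtain u where "u \<in> U" "x = g \<otimes> u" by (auto simp: l_coset_def)
  then show "x \<in> carrier G \<and> inv g \<otimes> x \<in> U" using assms by (auto simp: group_normalise subset_iff)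
next
  assume x: "x \<in> carrier G \<and> inv g \<otimes> x \<in> U"
  then have "x = g \<otimes> (inv g \<otimes> x)" using assms by (simp add: group_normalise)
  then show "x \<in> g <# U" using x unfolding l_coset_def by blast
qed

context topological_group
begin

lemma topspace [simp]: "topspace T = carrier G"
  by (rule topspace_eq_carrier)

lemma continuous_map_mult:
  assumes "continuous_map X T f" "continuous_map X T g"
  shows "continuous_map X T (\<lambda>x. f x \<otimes> g x)"
proof -
  have "continuous_map X (prod_topology T T) (\<lambda>x. (f x, g x))"
    using assms by (simp add: continuous_map_paired)
  from continuous_map_compose[OF this continuous_mult] show ?thesis by (simp add: o_def)
qed

lemma continuous_map_inverse:
  assumes "continuous_map X T f"
  shows "continuous_map X T (\<lambda>x. inv f x)"
  using continuous_map_compose[OF assms continuous_inv] by (simp add: o_def)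

lemma continuous_left_translation: "g \<in> carrier G \<Longrightarrow> continuous_map T T (\<lambda>x. g \<otimes> x)"
  by (intro continuous_map_mult) (auto simp: continuous_map_id[unfolded id_def])

lemma continuous_conjugation: "g \<in> carrier G \<Longrightarrow> continuous_map T T (\<lambda>x. g \<otimes> x \<otimes> h)"
  if "h \<in> carrier G"
  using that by (intro continuous_map_mult) (auto simp: continuous_map_id[unfolded id_def])

lemma openin_carrier_subset: "openin T U \<Longrightarrow> U \<subseteq> carrier G"
  and closedin_carrier_subset: "closedin T U \<Longrightarrow> U \<subseteq> carrier G"
  using openin_subset closedin_subset by force+

lemma l_coset_eq_vimage:
  assumes "g \<in> carrier G" "U \<subseteq> carrier G"
  shows "g <# U = {x \<in> topspace T. inv g \<otimes> x \<in> U}"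
  using mem_l_coset_iff[OF assms] by auto

lemma openin_l_coset:
  assumes "g \<in> carrier G" "openin T U"
  shows "openin T (g <# U)"
  using l_coset_eq_vimage[OF assms(1) openin_carrier_subset[OF assms(2)]]
    openin_continuous_map_preimage[OF continuous_left_translation assms(2), of "inv g"] assms
  by simp

lemma closedin_l_coset:
  assumes "g \<in> carrier G" "closedin T U"
  shows "closedin T (g <# U)"
  using l_coset_eq_vimage[OF assms(1) closedin_carrier_subset[OF assms(2)]]
    closedin_continuous_map_preimage[OF continuous_left_translation assms(2), of "inv g"] assms
  by simp

lemma closedin_conjugate:
  assumes "g \<in> carrier G" "closedin T U"
  shows "closedin T (conjugate G g U)"
proof -
  have "conjugate G g U = {x \<in> topspace T. inv g \<otimes> x \<otimes> g \<in> U}"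
    using mem_conjugate_iff[OF assms(1) closedin_carrier_subset[OF assms(2)]] by auto
  then show ?thesis
    using closedin_continuous_map_preimage[OF continuous_conjugation assms(2), of g "inv g"] assms
    by simp
qed

lemma topological_group_subgroup:
  assumes H: "subgroup H G"
  shows "topological_group (G\<lparr>carrier := H\<rparr>) (subtopology T H)"
proof -
  interpret H: group "G\<lparr>carrier := H\<rparr>" using subgroup_imp_group[OF H] .
  have HG: "H \<subseteq> carrier G" using subgroup.subset[OF H] .
  show ?thesis
  proof
    show "topspace (subtopology T H) = carrier (G\<lparr>carrier := H\<rparr>)" using HG by auto
    have "continuous_map (prod_topology (subtopology T H) (subtopology T H)) T (\<lambda>(x,y). x \<otimes> y)"
      unfolding prod_topology_subtopology
      by (intro continuous_map_from_subtopology continuous_mult)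
    then show "continuous_map (prod_topology (subtopology T H) (subtopology T H)) (subtopology T H)
        (\<lambda>(x, y). x \<otimes>\<^bsub>G\<lparr>carrier := H\<rparr>\<^esub> y)"
      using H by (auto simp: continuous_map_in_subtopology subgroup.m_closed)
    have "continuous_map (subtopology T H) T (\<lambda>x. inv x)"
      by (intro continuous_map_from_subtopology continuous_inv)
    then have "continuous_map (subtopology T H) (subtopology T H) (\<lambda>x. inv x)"
      using H by (auto simp: continuous_map_in_subtopology subgroup.m_inv_closed)
    then show "continuous_map (subtopology T H) (subtopology T H) (\<lambda>x. inv\<^bsub>G\<lparr>carrier := H\<rparr>\<^esub> x)"
      by (rule continuous_map_eq) (use H in auto)
  qed
qed

lemma subgroup_closure_of:
  assumes H: "subgroup H G"
  shows "subgroup (T closure_of H) G"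
proof (rule subgroupI)
  have HG: "H \<subseteq> carrier G" using subgroup.subset[OF H] .
  show "T closure_of H \<subseteq> carrier G" using closure_of_subset_topspace[of T H] by simp
  have "H \<subseteq> T closure_of H" using closure_of_subset[of H T] HG by simp
  then show "T closure_of H \<noteq> {}" using subgroup.one_closed[OF H] by auto
  fix a assume a: "a \<in> T closure_of H"
  have "(\<lambda>x. inv x) ` (T closure_of H) \<subseteq> T closure_of ((\<lambda>x. inv x) ` H)"
    by (rule continuous_map_image_closure_subset[OF continuous_inv])
  also have "\<dots> \<subseteq> T closure_of H"
    by (rule closure_of_mono) (use H in \<open>auto simp: subgroup.m_inv_closed\<close>)
  finally show "inv a \<in> T closure_of H" using a by auto
  fix b assume b: "b \<in> T closure_of H"
  have "(\<lambda>(x,y). x \<otimes> y) ` (prod_topology T T closure_of (H \<times> H))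
      \<subseteq> T closure_of ((\<lambda>(x,y). x \<otimes> y) ` (H \<times> H))"
    by (rule continuous_map_image_closure_subset[OF continuous_mult])
  also have "\<dots> \<subseteq> T closure_of H"
    by (rule closure_of_mono) (use H in \<open>auto simp: subgroup.m_closed\<close>)
  finally show "a \<otimes> b \<in> T closure_of H" using a b by (force simp: closure_of_Times)
qed

lemma open_subgroup_closed:
  assumes H: "subgroup H G" and op: "openin T H"
  shows "closedin T H"
proof -
  have HG: "H \<subseteq> carrier G" using subgroup.subset[OF H] .
  have "carrier G - H = (\<Union>g\<in>carrier G - H. g <# H)"
  proof safe
    fix g assume g: "g \<in> carrier G" "g \<notin> H"
    have "g \<in> g <# H" by (rule lcos_self[OF g(1) H])
    then show "g \<in> (\<Union>g\<in>carrier G - H. g <# H)" using g by auto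
  next
    fix g x assume g: "g \<in> carrier G" "g \<notin> H" "x \<in> g <# H"
    show "x \<in> carrier G" using g HG by (simp add: mem_l_coset_iff)
    assume "x \<in> H"
    moreover have "inv g \<otimes> x \<in> H" using g HG by (simp add: mem_l_coset_iff)
    ultimately have "x \<otimes> inv (inv g \<otimes> x) \<in> H"
      using H by (simp add: subgroup.m_closed subgroup.m_inv_closed)
    then show False using g \<open>x \<in> H\<close> HG by (auto simp: group_normalise subset_iff)
  qed
  moreover have "openin T (\<Union>g\<in>carrier G - H. g <# H)"
    using openin_l_coset op by auto
  ultimately show ?thesis using HG by (simp add: closedin_def)
qed

text \<open>The complement of \<open>N\<close> is a finite union of cosets of \<open>N\<close>.\<close>

lemma closed_finite_index_open:
  assumes N: "finite_index G N (carrier G)" and cl: "closedin T N"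
  shows "openin T N"
proof -
  have C: "subgroup (carrier G) G" by (rule subgroup_self)
  have Ns: "subgroup N G" and NG: "N \<subseteq> carrier G" using N C by (auto simp: finite_index_iff)
  obtain F where F: "finite F" "F \<subseteq> carrier G" "\<And>h. h \<in> carrier G \<Longrightarrow> \<exists>f\<in>F. \<exists>n\<in>N. h = f \<otimes> n"
    using finite_index_coset_reps[OF C N] by metis
  have "carrier G - N = (\<Union>f\<in>F - N. f <# N)"
  proof safe
    fix g assume g: "g \<in> carrier G" "g \<notin> N"
    then obtain f n where fn: "f \<in> F" "n \<in> N" "g = f \<otimes> n" using F(3) by blast
    then have "f \<notin> N" using g Ns by (auto simp: subgroup.m_closed)
    then show "g \<in> (\<Union>f\<in>F - N. f <# N)" using fn by (auto simp: l_coset_def)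
  next
    fix f x assume f: "f \<in> F" "f \<notin> N" "x \<in> f <# N"
    have fc: "f \<in> carrier G" using f F by auto
    then show "x \<in> carrier G" using f NG by (simp add: mem_l_coset_iff)
    assume "x \<in> N"
    moreover have "inv f \<otimes> x \<in> N" using f fc NG by (simp add: mem_l_coset_iff)
    ultimately have "x \<otimes> inv (inv f \<otimes> x) \<in> N"
      using Ns by (simp add: subgroup.m_closed subgroup.m_inv_closed)
    then show False using f fc \<open>x \<in> N\<close> NG by (auto simp: group_normalise subset_iff)
  qed
  moreover have "closedin T (\<Union>f\<in>F - N. f <# N)"
    using F closedin_l_coset cl by (intro closedin_Union) auto
  ultimately show ?thesis using NG by (simp add: openin_closedin)
qed

lemma open_subgroup_finite_index:
  assumes V: "subgroup V G" "openin T V" and comp: "compact_space T"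
  shows "finite_index G V (carrier G)"
proof -
  have "\<exists>\<F>. finite \<F> \<and> \<F> \<subseteq> (\<lambda>g. g <# V) ` carrier G \<and> carrier G \<subseteq> \<Union>\<F>"
  proof (rule compactinD[of T])
    show "compactin T (carrier G)" using comp by (simp add: compact_space_def)
    show "openin T U" if "U \<in> (\<lambda>g. g <# V) ` carrier G" for U using that openin_l_coset V by auto
    show "carrier G \<subseteq> \<Union> ((\<lambda>g. g <# V) ` carrier G)" using lcos_self V by auto
  qed
  then obtain F where F: "finite F" "F \<subseteq> carrier G" "carrier G \<subseteq> \<Union> ((\<lambda>g. g <# V) ` F)"
    using finite_subset_image by metis
  show ?thesis
  proof (rule finite_indexI[OF subgroup_self V(1) subgroup.subset[OF V(1)] F(1,2)])
    fix h assume "h \<in> carrier G"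
    then obtain f where "f \<in> F" "h \<in> f <# V" using F(3) by auto
    then show "\<exists>f\<in>F. inv f \<otimes> h \<in> V"
      using F(2) mem_l_coset_iff[of f V h] subgroup.subset[OF V(1)] by blast
  qed
qed

text \<open>The diagonal is the preimage of the identity under \<open>(x, y) \<mapsto> x\<^sup>-\<^sup>1 y\<close>.\<close>

lemma Hausdorff_if_closed_one:
  assumes "closedin T {\<one>}"
  shows "Hausdorff_space T"
proof -
  have "continuous_map (prod_topology T T) T (\<lambda>z. inv (fst z) \<otimes> snd z)"
    by (intro continuous_map_mult continuous_map_inverse continuous_map_fst continuous_map_snd)
  then have "closedin (prod_topology T T)
      {z \<in> topspace (prod_topology T T). inv (fst z) \<otimes> snd z \<in> {\<one>}}"
    using closedin_continuous_map_preimage assms by blast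
  moreover have "{z \<in> topspace (prod_topology T T). inv (fst z) \<otimes> snd z \<in> {\<one>}}
      = (\<lambda>x. (x, x)) ` topspace T"
    by (auto simp: image_iff) (metis inv_closed inv_inv inv_equality inv_solve_left' r_one l_inv)
  ultimately show ?thesis by (simp add: Hausdorff_space_closedin_diagonal)
qed

text \<open>Translate a connected set so that it contains the identity; the subgroup is clopen, hence contains it.\<close>

lemma totally_disconnected_if_open_subgroup:
  assumes H: "subgroup H G" "openin T H" and td: "totally_disconnected_space (subtopology T H)"
  shows "totally_disconnected_space T"
  unfolding totally_disconnected_space_iff
proof (intro allI impI)
  fix C x y assume C: "connectedin T C \<and> x \<in> C \<and> y \<in> C"
  then have CG: "C \<subseteq> carrier G" using connectedin_subset_topspace by force
  then have xy: "x \<in> carrier G" "y \<in> carrier G" using C by auto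
  let ?D = "(\<lambda>z. inv x \<otimes> z) ` C"
  have D: "connectedin T ?D"
    using connectedin_continuous_map_image[OF continuous_left_translation] C xy by blast
  have 1: "\<one> \<in> ?D" "inv x \<otimes> y \<in> ?D" using C xy l_inv[of x] by (force simp del: l_inv)+
  have "\<one> \<in> H" using H by (simp add: subgroup.one_closed)
  then have "?D \<subseteq> H"
    using connectedin_clopen_cases[OF D open_subgroup_closed[OF H] H(2)] 1 by (auto simp: disjnt_iff)
  then have "connectedin (subtopology T H) ?D" using D by (simp add: connectedin_subtopology)
  then have "\<one> = inv x \<otimes> y" using td 1 unfolding totally_disconnected_space_iff by blast
  then show "x = y" using xy by (metis inv_closed inv_equality inv_inv inv_solve_left' r_one)
qed

lemma profinite_compact_subgroup:
  assumes "Hausdorff_space T" "totally_disconnected_space T" "subgroup H G" "compactin T H"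
  shows "profinite_group (G\<lparr>carrier := H\<rparr>) (subtopology T H)"
  using assms by (simp add: profinite_group_def topological_group_subgroup compact_space_subtopology
      Hausdorff_space_subtopology totally_disconnected_space_subtopology)

text \<open>In a compact Hausdorff space connected components are quasi-components, so a totally
  disconnected one has a base of clopen sets.  A clopen neighbourhood \<open>C\<close> of the identity contains
  the open subgroup of all \<open>x\<close> with \<open>x C = C\<close>; compactness of \<open>C\<close> is what makes it open.\<close>

lemma profinite_open_subgroup_base:
  assumes comp: "compact_space T" and haus: "Hausdorff_space T" and td: "totally_disconnected_space T"
    and W: "openin T W" "\<one> \<in> W"
  obtains V where "subgroup V G" "openin T V" "V \<subseteq> W"
proof -
  have WG: "W \<subseteq> carrier G" using openin_carrier_subset W by blast
  have "quasi_component_of_set T \<one> = connected_component_of_set T \<one>"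
    using quasi_eq_connected_component_of[of T \<one>] comp haus by simp
  also have "\<dots> = {\<one>}" using td by (simp add: totally_disconnected_space_def)
  finally have "{\<one>} \<in> quasi_components_of T"
    using one_closed by (metis image_eqI quasi_components_of_def topspace)
  moreover have "compactin T (carrier G - W)"
    using closedin_compact_space[OF comp] W openin_closedin_eq[of T W] by auto
  ultimately have "separated_between T {\<one>} (carrier G - W)"
    using separated_between_quasi_component_compact W by fastforce
  then obtain C where C': "closedin T C" "openin T C" "{\<one>} \<subseteq> C" "carrier G - W \<subseteq> topspace T - C"
    unfolding separated_between by blast
  have C: "closedin T C" "openin T C" "\<one> \<in> C" "C \<subseteq> W"
    using C' openin_carrier_subset[OF C'(2)] by auto
  have CG: "C \<subseteq> carrier G" using C WG by auto
  define S where "S = {x \<in> carrier G. \<forall>c\<in>C. x \<otimes> c \<in> C}"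
  have Cc: "compact_space (subtopology T C)"
    using C closedin_compact_space[OF comp] compact_space_subtopology by blast
  (* The complement of S is the projection of a closed set along the compact space C. *)
  have Sop: "openin T S"
  proof -
    let ?P = "prod_topology T (subtopology T C)"
    have "continuous_map ?P T (\<lambda>z. fst z \<otimes> snd z)"
      by (intro continuous_map_mult continuous_map_fst continuous_map_into_fulltopology[OF continuous_map_snd])
    then have "closedin ?P {z \<in> topspace ?P. fst z \<otimes> snd z \<in> carrier G - C}"
      using closedin_continuous_map_preimage[of ?P T] C(2) openin_closedin_eq[of T C] by force
    then have "closedin T (fst ` {z \<in> topspace ?P. fst z \<otimes> snd z \<in> carrier G - C})"
      using closed_map_fst[OF Cc, of T] by (simp add: closed_map_def)
    moreover have "fst ` {z \<in> topspace ?P. fst z \<otimes> snd z \<in> carrier G - C} = carrier G - S"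
      using CG by (force simp: S_def image_iff)
    ultimately have "closedin T (carrier G - S)" by simp
    moreover have "S \<subseteq> carrier G" by (auto simp: S_def)
    ultimately show ?thesis by (simp add: openin_closedin)
  qed
  define V where "V = {x \<in> topspace T. x \<in> S} \<inter> {x \<in> topspace T. inv x \<in> S}"
  have "openin T V"
    unfolding V_def using Sop
    by (intro openin_Int openin_continuous_map_preimage[OF continuous_inv])
      (auto simp: openin_carrier_subset Collect_conj_eq Int_absorb1)
  moreover have "subgroup V G"
  proof (rule subgroupI)
    show "V \<subseteq> carrier G" by (auto simp: V_def)
    have "\<one> \<in> V" using CG by (auto simp: V_def S_def)
    then show "V \<noteq> {}" by auto
    fix a assume a: "a \<in> V"
    then show "inv a \<in> V" by (auto simp: V_def)
    fix b assume b: "b \<in> V"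
    show "a \<otimes> b \<in> V" using a b CG by (auto simp: V_def S_def m_assoc inv_mult_group subset_iff)
  qed
  moreover have "V \<subseteq> W"
  proof
    fix x assume "x \<in> V"
    then have "x \<in> carrier G" "x \<otimes> \<one> \<in> C" using C by (auto simp: V_def S_def)
    then show "x \<in> W" using C by auto
  qed
  ultimately show ?thesis using that by blast
qed

end

text \<open>Near any point \<open>g\<close> the homomorphism is its restriction to \<open>H\<close>, translated.\<close>

lemma hom_continuous_if_continuous_on_open_subgroup:
  assumes "topological_group G T" "topological_group R S" "\<phi> \<in> hom G R"
    and H: "subgroup H G" "openin T H" and cont: "continuous_map (subtopology T H) S \<phi>"
  shows "continuous_map T S \<phi>"
proof -
  interpret G: topological_group G T by fact
  interpret R: topological_group R S by fact
  interpret \<phi>: group_hom G R \<phi> using assms by unfold_locales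
  have HG: "H \<subseteq> carrier G" using subgroup.subset[OF H(1)] .
  show ?thesis
    unfolding continuous_map_alt
  proof (intro conjI allI impI)
    show "\<phi> \<in> topspace T \<rightarrow> topspace S" by auto
    fix U assume U: "openin S U"
    show "openin T (\<phi> -` U \<inter> topspace T)"
    proof (subst openin_subopen, intro ballI)
      fix g assume g: "g \<in> \<phi> -` U \<inter> topspace T"
      then have gc: "g \<in> carrier G" by simp
      let ?U = "inv\<^bsub>R\<^esub> \<phi> g <#\<^bsub>R\<^esub> U"
      have "openin S ?U" using R.openin_l_coset gc U by simp
      then have op: "openin (subtopology T H) {h \<in> topspace (subtopology T H). \<phi> h \<in> ?U}"
        using openin_continuous_map_preimage[OF cont] by blast
      let ?V = "{h \<in> H. \<phi> h \<in> ?U}"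
      have "openin T ?V"
        using op openin_trans_full[OF _ H(2)] HG by (simp add: Int_absorb1)
      then have "openin T (g <#\<^bsub>G\<^esub> ?V)" using G.openin_l_coset gc by blast
      moreover have "g \<in> g <#\<^bsub>G\<^esub> ?V"
      proof -
        have "\<one>\<^bsub>R\<^esub> \<in> ?U" using g gc by (auto simp: l_coset_def) (metis R.l_inv \<phi>.hom_closed)
        then have "\<one>\<^bsub>G\<^esub> \<in> ?V" using H by (simp add: subgroup.one_closed)
        then show ?thesis unfolding l_coset_def using gc by force
      qed
      moreover have "g <#\<^bsub>G\<^esub> ?V \<subseteq> \<phi> -` U \<inter> topspace T"
      proof
        fix x assume "x \<in> g <#\<^bsub>G\<^esub> ?V"
        then obtain h where h: "h \<in> H" "\<phi> h \<in> ?U" "x = g \<otimes>\<^bsub>G\<^esub> h" by (auto simp: l_coset_def)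
        then obtain u where u: "u \<in> U" "\<phi> h = inv\<^bsub>R\<^esub> \<phi> g \<otimes>\<^bsub>R\<^esub> u" by (auto simp: l_coset_def)
        have "h \<in> carrier G" "u \<in> carrier R" using h u HG R.openin_carrier_subset[OF U] by auto
        then show "x \<in> \<phi> -` U \<inter> topspace T" using h u gc by (simp add: R.group_normalise)
      qed
      ultimately show "\<exists>W. openin T W \<and> g \<in> W \<and> W \<subseteq> \<phi> -` U \<inter> topspace T" by blast
    qed
  qed
qed

section \<open>Permutation groups with the topology of pointwise convergence\<close>

lemma continuous_map_into_discreteI:
  assumes "\<And>a. a \<in> topspace Y \<Longrightarrow> f a \<in> D"
    and "\<And>a. a \<in> topspace Y \<Longrightarrow> \<exists>W. openin Y W \<and> a \<in> W \<and> (\<forall>b\<in>W. f b = f a)"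
  shows "continuous_map Y (discrete_topology D) f"
  unfolding continuous_map_alt
proof (intro conjI allI impI)
  show "f \<in> topspace Y \<rightarrow> topspace (discrete_topology D)" using assms(1) by auto
  fix U assume "openin (discrete_topology D) U"
  show "openin Y (f -` U \<inter> topspace Y)"
  proof (subst openin_subopen, intro ballI)
    fix a assume a: "a \<in> f -` U \<inter> topspace Y"
    then obtain W where W: "openin Y W" "a \<in> W" "\<forall>b\<in>W. f b = f a" using assms(2) by blast
    have "W \<subseteq> f -` U \<inter> topspace Y"
    proof
      fix b assume b: "b \<in> W"
      then have "f b = f a" using W(3) by blast
      then show "b \<in> f -` U \<inter> topspace Y" using a b openin_subset[OF W(1)] by auto
    qed
    then show "\<exists>W. openin Y W \<and> a \<in> W \<and> W \<subseteq> f -` U \<inter> topspace Y" using W by blast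
  qed
qed

lemma carrier_BijGroup [simp]: "carrier (BijGroup X) = Bij X"
  and one_BijGroup: "\<one>\<^bsub>BijGroup X\<^esub> = (\<lambda>x\<in>X. x)"
  and mult_BijGroup: "f \<in> Bij X \<Longrightarrow> g \<in> Bij X \<Longrightarrow> f \<otimes>\<^bsub>BijGroup X\<^esub> g = compose X f g"
  by (simp_all add: BijGroup_def)

lemma Bij_maps_to: "f \<in> Bij X \<Longrightarrow> x \<in> X \<Longrightarrow> f x \<in> X"
  using Bij_imp_funcset by blast

lemma Bij_subset_PiE: "Bij X \<subseteq> (\<Pi>\<^sub>E x\<in>X. X)"
  by (simp add: subset_iff Bij_imp_extensional Bij_maps_to PiE_iff)

lemma topspace_pointwise_topology [simp]: "topspace (pointwise_topology X) = Bij X"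
  using Bij_subset_PiE by (auto simp: pointwise_topology_def)

lemma openin_discrete_product_cylinder:
  assumes "finite E" "E \<subseteq> I"
  shows "openin (product_topology (\<lambda>i. discrete_topology (X i)) I)
    {h \<in> \<Pi>\<^sub>E i\<in>I. X i. \<forall>i\<in>E. h i = c i}"
  using assms
proof (induction E)
  case empty
  have "{h \<in> \<Pi>\<^sub>E i\<in>I. X i. \<forall>i\<in>{}. h i = c i}
      = topspace (product_topology (\<lambda>i. discrete_topology (X i)) I)" by simp
  then show ?case using openin_topspace by metis
next
  case (insert e E)
  let ?P = "product_topology (\<lambda>i. discrete_topology (X i)) I"
  have "openin ?P {h \<in> topspace ?P. h e \<in> {c e} \<inter> X e}"
    using insert by (intro openin_continuous_map_preimage[OF continuous_map_product_projection]) auto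
  then have "openin ?P ({h \<in> topspace ?P. h e \<in> {c e} \<inter> X e} \<inter> {h \<in> \<Pi>\<^sub>E i\<in>I. X i. \<forall>i\<in>E. h i = c i})"
    using insert by (intro openin_Int) auto
  moreover have "{h \<in> topspace ?P. h e \<in> {c e} \<inter> X e} \<inter> {h \<in> \<Pi>\<^sub>E i\<in>I. X i. \<forall>i\<in>E. h i = c i}
     = {h \<in> \<Pi>\<^sub>E i\<in>I. X i. \<forall>i\<in>insert e E. h i = c i}"
    using insert.prems by auto
  ultimately show ?case by simp
qed

lemma openin_pointwise_eval:
  assumes "x \<in> X"
  shows "openin (pointwise_topology X) {f \<in> Bij X. f x = y}"
proof -
  have "openin (pointwise_topology X)
      (Bij X \<inter> {h \<in> \<Pi>\<^sub>E i\<in>X. X. \<forall>i\<in>{x}. h i = (\<lambda>_. y) i})"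
    unfolding pointwise_topology_def carrier_BijGroup
    by (intro openin_subtopology_Int2 openin_discrete_product_cylinder) (use assms in auto)
  moreover have "Bij X \<inter> {h \<in> \<Pi>\<^sub>E i\<in>X. X. \<forall>i\<in>{x}. h i = (\<lambda>_. y) i} = {f \<in> Bij X. f x = y}"
    using Bij_subset_PiE by auto
  ultimately show ?thesis by simp
qed

lemma closedin_pointwise_eval:
  assumes "x \<in> X"
  shows "closedin (pointwise_topology X) {f \<in> Bij X. f x = y}"
proof -
  have "continuous_map (pointwise_topology X) (discrete_topology X) (\<lambda>f. f x)"
    unfolding pointwise_topology_def
    by (intro continuous_map_from_subtopology continuous_map_product_projection[OF assms])
  then have "closedin (pointwise_topology X) {f \<in> topspace (pointwise_topology X). f x \<in> {y} \<inter> X}"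
    by (rule closedin_continuous_map_preimage) auto
  moreover have "{f \<in> topspace (pointwise_topology X). f x \<in> {y} \<inter> X} = {f \<in> Bij X. f x = y}"
    using assms by (auto simp: Bij_maps_to)
  ultimately show ?thesis by simp
qed

lemma continuous_map_into_pointwise:
  assumes "\<And>a. a \<in> topspace Y \<Longrightarrow> f a \<in> Bij X"
    and "\<And>a x. a \<in> topspace Y \<Longrightarrow> x \<in> X \<Longrightarrow> \<exists>W. openin Y W \<and> a \<in> W \<and> (\<forall>b\<in>W. f b x = f a x)"
  shows "continuous_map Y (pointwise_topology X) f"
proof -
  have "continuous_map Y (discrete_topology X) (\<lambda>a. f a x)" if "x \<in> X" for x
    using assms that by (intro continuous_map_into_discreteI) (auto simp: Bij_maps_to)
  moreover have "f ` topspace Y \<subseteq> extensional X" using assms(1) Bij_imp_extensional by blast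
  ultimately show ?thesis
    unfolding pointwise_topology_def using assms(1)
    by (auto simp: continuous_map_in_subtopology continuous_map_componentwise)
qed

lemma topological_group_BijGroup: "topological_group (BijGroup X) (pointwise_topology X)"
proof -
  interpret group "BijGroup X" by (rule group_BijGroup)
  let ?S = "pointwise_topology X"
  show ?thesis
  proof
    show "topspace ?S = carrier (BijGroup X)" by simp
    show "continuous_map (prod_topology ?S ?S) ?S (\<lambda>(f, g). f \<otimes>\<^bsub>BijGroup X\<^esub> g)"
    proof (rule continuous_map_into_pointwise)
      fix a assume a: "a \<in> topspace (prod_topology ?S ?S)"
      then obtain f g where fg: "a = (f,g)" "f \<in> Bij X" "g \<in> Bij X" by auto
      then show "(case a of (f, g) \<Rightarrow> f \<otimes>\<^bsub>BijGroup X\<^esub> g) \<in> Bij X"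
        by (simp add: mult_BijGroup compose_Bij)
      fix x assume x: "x \<in> X"
      let ?W = "{f' \<in> Bij X. f' (g x) = f (g x)} \<times> {g' \<in> Bij X. g' x = g x}"
      have "openin (prod_topology ?S ?S) ?W"
        using x fg by (simp add: openin_prod_Times_iff openin_pointwise_eval Bij_maps_to)
      moreover have "a \<in> ?W" using fg by simp
      moreover have "(case b of (f, g) \<Rightarrow> f \<otimes>\<^bsub>BijGroup X\<^esub> g) x = (case a of (f, g) \<Rightarrow> f \<otimes>\<^bsub>BijGroup X\<^esub> g) x"
        if "b \<in> ?W" for b
        using that fg x by (auto simp: mult_BijGroup compose_eq)
      ultimately show "\<exists>W. openin (prod_topology ?S ?S) W \<and> a \<in> W \<and>
          (\<forall>b\<in>W. (case b of (f, g) \<Rightarrow> f \<otimes>\<^bsub>BijGroup X\<^esub> g) x = (case a of (f, g) \<Rightarrow> f \<otimes>\<^bsub>BijGroup X\<^esub> g) x)"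
        by blast
    qed
    show "continuous_map ?S ?S (\<lambda>f. inv\<^bsub>BijGroup X\<^esub> f)"
    proof (rule continuous_map_into_pointwise)
      fix f assume f: "f \<in> topspace ?S"
      then show "inv\<^bsub>BijGroup X\<^esub> f \<in> Bij X" using inv_closed[of f] by simp
      fix x assume x: "x \<in> X"
      let ?y = "(inv\<^bsub>BijGroup X\<^esub> f) x"
      have inv: "(inv\<^bsub>BijGroup X\<^esub> h) x = y" if "h \<in> Bij X" "y \<in> X" "h y = x" for h y
        using that x by (auto simp: inv_BijGroup Bij_def bij_betw_def inv_into_f_f)
      have y: "?y \<in> X" "f ?y = x"
        using f x by (auto simp: inv_BijGroup Bij_def bij_betw_def inv_into_into f_inv_into_f)
      have "openin ?S {h \<in> Bij X. h ?y = x}" using y by (simp add: openin_pointwise_eval)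
      moreover have "f \<in> {h \<in> Bij X. h ?y = x}" using y f by simp
      moreover have "(inv\<^bsub>BijGroup X\<^esub> h) x = ?y" if "h \<in> {h \<in> Bij X. h ?y = x}" for h
        using that inv y by simp
      ultimately show "\<exists>W. openin ?S W \<and> f \<in> W \<and> (\<forall>h\<in>W. (inv\<^bsub>BijGroup X\<^esub> h) x = ?y)" by blast
    qed
  qed
qed

lemma Hausdorff_pointwise_topology: "Hausdorff_space (pointwise_topology X)"
  unfolding pointwise_topology_def
  by (intro Hausdorff_space_subtopology) (simp add: Hausdorff_space_product_topology)

lemma totally_disconnected_pointwise_topology: "totally_disconnected_space (pointwise_topology X)"
  unfolding pointwise_topology_def
  by (intro totally_disconnected_space_subtopology totally_disconnected_space_product
      totally_disconnected_space_discrete)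

text \<open>A pointwise limit \<open>c\<close> of \<open>A\<close> agrees with some member of \<open>A\<close> on any finite set.  Hence it is
  injective, and it permutes each finite \<open>A\<close>-orbit, so it is again a permutation; the closure of \<open>A\<close>
  therefore agrees with its closure in the compact product of the orbits.\<close>

lemma compactin_closure_finite_orbits:
  assumes A: "subgroup A (BijGroup X)" and fin: "\<And>x. x \<in> X \<Longrightarrow> finite ((\<lambda>f. f x) ` A)"
  shows "compactin (pointwise_topology X) (pointwise_topology X closure_of A)"
proof -
  interpret A: subgroup A "BijGroup X" by fact
  interpret B: group "BijGroup X" by (rule group_BijGroup)
  let ?P = "product_topology (\<lambda>_. discrete_topology X) X"
  define orb where "orb x = (\<lambda>f. f x) ` A" for x
  define C where "C = ?P closure_of A"
  have AB: "A \<subseteq> Bij X" using A.subset by simp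
  have orb: "orb x \<subseteq> X" if "x \<in> X" for x using that AB Bij_maps_to[of _ X x] unfolding orb_def by blast
  have self: "x \<in> orb x" if "x \<in> X" for x
    using imageI[OF A.one_closed, of "\<lambda>f. f x"] that by (simp add: orb_def one_BijGroup)
  have near: "\<exists>f\<in>A. \<forall>x\<in>E. f x = c x" if "c \<in> C" "finite E" "E \<subseteq> X" for c E
  proof -
    let ?U = "{h \<in> \<Pi>\<^sub>E i\<in>X. X. \<forall>i\<in>E. h i = c i}"
    have "openin ?P ?U" by (rule openin_discrete_product_cylinder) (use that in auto)
    moreover have "c \<in> ?U" using that closure_of_subset_topspace[of ?P A] by (auto simp: C_def)
    ultimately obtain f where "f \<in> A" "f \<in> ?U"
      using \<open>c \<in> C\<close> unfolding C_def in_closure_of by meson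
    then show ?thesis by auto
  qed
  have Ccl: "closedin ?P C" by (simp add: C_def)
  have CO: "C \<subseteq> (\<Pi>\<^sub>E x\<in>X. orb x)"
  proof -
    have "closedin ?P (\<Pi>\<^sub>E x\<in>X. orb x)" using orb by (simp add: closedin_product_topology)
    moreover have "A \<subseteq> (\<Pi>\<^sub>E x\<in>X. orb x)" 
    proof
      fix f assume f: "f \<in> A"
      then have "f \<in> extensional X" using AB Bij_imp_extensional[of f X] by blast
      then show "f \<in> (\<Pi>\<^sub>E x\<in>X. orb x)" using f by (simp add: PiE_iff orb_def)
    qed
    ultimately show ?thesis unfolding C_def by (simp add: closure_of_minimal)
  qed
  have "compactin ?P (\<Pi>\<^sub>E x\<in>X. orb x)"
    using orb fin by (auto simp: compactin_PiE orb_def compactin_discrete_topology)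
  then have Ccomp: "compactin ?P C" using closed_compactin CO Ccl by blast
  have CB: "C \<subseteq> Bij X"
  proof
    fix c assume c: "c \<in> C"
    have "c \<in> (\<Pi>\<^sub>E x\<in>X. orb x)" using CO c by blast
    then have ext: "c \<in> extensional X" and cX: "\<And>x. x \<in> X \<Longrightarrow> c x \<in> orb x" by (simp_all add: PiE_iff)
    have inj: "inj_on c X"
    proof (rule inj_onI)
      fix x y assume xy: "x \<in> X" "y \<in> X" "c x = c y"
      then obtain f where "f \<in> A" "f x = c x" "f y = c y" using near[OF c, of "{x,y}"] by auto
      then show "x = y" using AB xy by (auto simp: Bij_def bij_betw_def inj_on_def)
    qed
    have "y \<in> c ` X" if y: "y \<in> X" for y
    proof -
      have "c ` orb y \<subseteq> orb y"
      proof
        fix z assume "z \<in> c ` orb y"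
        then obtain f where f: "f \<in> A" "z = c (f y)" by (auto simp: orb_def)
        have "f y \<in> X" using f y AB Bij_maps_to[of f X y] by blast
        then obtain g where g: "g \<in> A" "g (f y) = c (f y)" using near[OF c, of "{f y}"] by auto
        have "g \<otimes>\<^bsub>BijGroup X\<^esub> f \<in> A" using f g by simp
        moreover have "(g \<otimes>\<^bsub>BijGroup X\<^esub> f) y = z"
          using f g AB y by (auto simp: mult_BijGroup compose_eq subset_iff)
        ultimately show "z \<in> orb y" unfolding orb_def by blast
      qed
      moreover have "inj_on c (orb y)" using inj orb[OF y] inj_on_subset by blast
      ultimately have "c ` orb y = orb y" using endo_inj_surj[of "orb y" c] fin[OF y] orb_def by auto
      then show ?thesis using self[OF y] orb[OF y] by blast
    qed
    moreover have "c ` X \<subseteq> X" using cX orb by blast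
    ultimately have "c ` X = X" by blast
    then show "c \<in> Bij X" using inj ext by (simp add: Bij_def bij_betw_def)
  qed
  have "pointwise_topology X closure_of A = C"
    unfolding pointwise_topology_def closure_of_subtopology carrier_BijGroup C_def[symmetric]
    using AB CB by (simp add: Int_absorb1 Int_absorb2 C_def)
  then show ?thesis
    using Ccomp CB by (simp add: pointwise_topology_def compactin_subtopology)
qed

section \<open>The action on a coset space\<close>

context group
begin

lemma lcosetsE:
  assumes "C \<in> lcosets N"
  obtains a where "a \<in> carrier G" "C = a <# N"
  using assms by (auto simp: LCOSETS_def)

lemma l_coset_in_lcosets: "a \<in> carrier G \<Longrightarrow> a <# N \<in> lcosets N"
  by (auto simp: LCOSETS_def)

lemma coset_action_apply:
  assumes "N \<subseteq> carrier G" "g \<in> carrier G" "a \<in> carrier G"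
  shows "coset_action G N g (a <# N) = (g \<otimes> a) <# N"
  using assms by (simp add: coset_action_def l_coset_in_lcosets lcos_m_assoc)

lemma coset_action_hom:
  assumes N: "N \<subseteq> carrier G"
  shows "coset_action G N \<in> hom G (BijGroup (lcosets N))"
proof (rule homI)
  have ext: "coset_action G N g \<in> extensional (lcosets N)" for g by (simp add: coset_action_def)
  show B: "coset_action G N g \<in> carrier (BijGroup (lcosets N))" if g: "g \<in> carrier G" for g
  proof -
    have "bij_betw (coset_action G N g) (lcosets N) (lcosets N)"
      by (rule bij_betw_byWitness[where f' = "coset_action G N (inv g)"])
        (use g N in \<open>auto simp: coset_action_apply l_coset_in_lcosets group_normalise elim!: lcosetsE\<close>)
    then show ?thesis using ext by (simp add: Bij_def)
  qed
  fix g h assume gh: "g \<in> carrier G" "h \<in> carrier G"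
  show "coset_action G N (g \<otimes> h) = coset_action G N g \<otimes>\<^bsub>BijGroup (lcosets N)\<^esub> coset_action G N h"
  proof (rule extensionalityI[OF ext])
    show "coset_action G N g \<otimes>\<^bsub>BijGroup (lcosets N)\<^esub> coset_action G N h \<in> extensional (lcosets N)"
      using B gh by (simp add: mult_BijGroup compose_def)
    fix C assume "C \<in> lcosets N"
    then obtain a where "a \<in> carrier G" "C = a <# N" by (rule lcosetsE)
    then show "coset_action G N (g \<otimes> h) C = (coset_action G N g \<otimes>\<^bsub>BijGroup (lcosets N)\<^esub> coset_action G N h) C"
      using B gh N by (simp add: mult_BijGroup compose_eq coset_action_apply l_coset_in_lcosets m_assoc)
  qed
qed

lemma l_coset_eq_iff:
  assumes N: "subgroup N G" and "a \<in> carrier G" "b \<in> carrier G"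
  shows "a <# N = b <# N \<longleftrightarrow> inv b \<otimes> a \<in> N"
proof
  assume "a <# N = b <# N"
  then have "a \<in> b <# N" using lcos_self[OF assms(2) N] by simp
  then show "inv b \<otimes> a \<in> N" using mem_l_coset_iff assms subgroup.subset[OF N] by blast
next
  assume "inv b \<otimes> a \<in> N"
  then have "a \<in> b <# N" using mem_l_coset_iff assms subgroup.subset[OF N] by blast
  then show "a <# N = b <# N" using l_repr_independence[OF _ assms(3) N] by metis
qed

lemma coset_action_fixes_iff:
  assumes N: "subgroup N G" and "g \<in> carrier G" "a \<in> carrier G"
  shows "coset_action G N g (a <# N) = a <# N \<longleftrightarrow> g \<in> conjugate G a N"
  using assms subgroup.subset[OF N]
  by (simp add: coset_action_apply l_coset_eq_iff mem_conjugate_iff m_assoc)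

text \<open>Right multiplication by an element of the stabiliser \<open>a N a\<^sup>-\<^sup>1\<close> of the coset \<open>a N\<close> does not
  change the effect on that coset; both the finiteness of orbits and continuity come from this.\<close>

lemma coset_action_stabiliser:
  assumes N: "subgroup N G" and "g \<in> carrier G" "a \<in> carrier G" and s: "s \<in> conjugate G a N"
  shows "coset_action G N (g \<otimes> s) (a <# N) = coset_action G N g (a <# N)"
proof -
  note NG = subgroup.subset[OF N]
  have sc: "s \<in> carrier G" using s mem_conjugate_iff[OF assms(3) NG] by blast
  have "(s \<otimes> a) <# N = a <# N"
    using coset_action_fixes_iff[OF N sc assms(3)] coset_action_apply[OF NG sc assms(3)] s by simp
  then have "g <# ((s \<otimes> a) <# N) = g <# (a <# N)" by simp
  then show ?thesis using assms sc NG by (simp add: coset_action_apply lcos_m_assoc m_assoc)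
qed

text \<open>The stabiliser in \<open>K\<close> of the coset \<open>a N\<close> is \<open>K \<inter> a N a\<^sup>-\<^sup>1\<close>.\<close>

lemma coset_stabiliser_finite_index:
  assumes K: "subgroup K G" and comm: "commensurator G K = carrier G"
    and N: "finite_index G N K" and a: "a \<in> carrier G"
  shows "finite_index G (conjugate G a N \<inter> K) K"
proof -
  have aK: "subgroup (conjugate G a K) G" by (rule conjugate_subgroup[OF a K])
  have "commensurate G (conjugate G a K) K" using comm a by (auto simp: commensurator_def)
  then have fi: "finite_index G (conjugate G a K \<inter> K) K" by (simp add: commensurate_def)
  have "finite_index G (conjugate G a N) (conjugate G a K)"
    by (rule finite_index_conjugate[OF a K N])
  then have "finite_index G (conjugate G a N \<inter> K) (conjugate G a K \<inter> K)"
    by (rule finite_index_Int[OF aK _ K])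
  then show ?thesis by (rule finite_index_trans[OF K _ fi])
qed

lemma coset_orbit_finite:
  assumes K: "subgroup K G" and comm: "commensurator G K = carrier G"
    and N: "finite_index G N K" and C: "C \<in> lcosets N"
  shows "finite ((\<lambda>k. coset_action G N k C) ` K)"
proof -
  obtain a where a: "a \<in> carrier G" "C = a <# N" using C by (rule lcosetsE)
  have Ns: "subgroup N G" by (rule finite_index_subgroup[OF K N])
  note NG = subgroup.subset[OF Ns] and KG = subgroup.subset[OF K]
  obtain F where F: "finite F" "F \<subseteq> K"
      "\<And>h. h \<in> K \<Longrightarrow> \<exists>f\<in>F. \<exists>n\<in>conjugate G a N \<inter> K. h = f \<otimes> n"
    using finite_index_coset_reps[OF K coset_stabiliser_finite_index[OF K comm N a(1)]] by metis
  have "(\<lambda>k. coset_action G N k C) ` K \<subseteq> (\<lambda>k. coset_action G N k C) ` F"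
  proof
    fix D assume "D \<in> (\<lambda>k. coset_action G N k C) ` K"
    then obtain k where k: "k \<in> K" "D = coset_action G N k C" by blast
    obtain f n where fn: "f \<in> F" "n \<in> conjugate G a N" "n \<in> K" "k = f \<otimes> n" using F(3)[OF k(1)] by blast
    then have "D = coset_action G N f C"
      using k a F(2) KG coset_action_stabiliser[OF Ns _ a(1) fn(2), of f] by auto
    then show "D \<in> (\<lambda>k. coset_action G N k C) ` F" using fn by blast
  qed
  then show ?thesis using F(1) finite_subset by blast
qed

end

context topological_group
begin

lemma finite_index_closed_imp_open:
  assumes K: "subgroup K G" and N: "finite_index G N K" "closedin T N"
  shows "openin (subtopology T K) N"
proof -
  interpret K: topological_group "G\<lparr>carrier := K\<rparr>" "subtopology T K"
    by (rule topological_group_subgroup[OF K])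
  have "N \<subseteq> K" by (rule finite_index_subset[OF K N(1)])
  then show ?thesis using K.closed_finite_index_open[of N] N by (simp add: closedin_subset_topspace)
qed

lemma coset_action_continuous:
  assumes K: "subgroup K G" "closedin T K" and comm: "commensurator G K = carrier G"
    and N: "finite_index G N K" "closedin T N"
  shows "continuous_map (subtopology T K) (pointwise_topology (lcosets N)) (coset_action G N)"
proof (rule continuous_map_into_pointwise)
  have Ns: "subgroup N G" by (rule finite_index_subgroup[OF K(1) N(1)])
  note NG = subgroup.subset[OF Ns] and KG = subgroup.subset[OF K(1)]
  interpret K: topological_group "G\<lparr>carrier := K\<rparr>" "subtopology T K"
    by (rule topological_group_subgroup[OF K(1)])
  fix k assume "k \<in> topspace (subtopology T K)"
  then have k: "k \<in> K" "k \<in> carrier G" using KG by auto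
  then show "coset_action G N k \<in> Bij (lcosets N)"
    using hom_in_carrier[OF coset_action_hom[OF NG]] by simp
  fix C assume "C \<in> lcosets N"
  then obtain a where a: "a \<in> carrier G" "C = a <# N" by (rule lcosetsE)
  let ?S = "conjugate G a N \<inter> K"
  have "closedin T ?S" using closedin_conjugate[OF a(1) N(2)] K(2) by blast
  then have "openin (subtopology T K) ?S"
    using finite_index_closed_imp_open[OF K(1)] coset_stabiliser_finite_index[OF K(1) comm N(1) a(1)]
    by blast
  then have op: "openin (subtopology T K) (k <# ?S)"
    using K.openin_l_coset[of k ?S] k by simp
  have one: "\<one> \<in> ?S"
    using K(1) conjugate_subgroup[OF a(1) Ns] by (simp add: subgroup.one_closed)
  have "k \<in> k <# ?S" unfolding l_coset_def using one k by force
  moreover have "coset_action G N b C = coset_action G N k C" if b: "b \<in> k <# ?S" for b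
  proof -
    obtain s where s: "s \<in> ?S" "b = k \<otimes> s" using b by (auto simp: l_coset_def)
    then show ?thesis using coset_action_stabiliser[OF Ns k(2) a(1)] a(2) by simp
  qed
  ultimately show "\<exists>W. openin (subtopology T K) W \<and> k \<in> W \<and>
      (\<forall>b\<in>W. coset_action G N b C = coset_action G N k C)"
    using op by blast
qed

lemma coset_action_closure_compact:
  assumes K: "subgroup K G" and comm: "commensurator G K = carrier G" and N: "finite_index G N K"
  shows "compactin (pointwise_topology (lcosets N))
    (pointwise_topology (lcosets N) closure_of (coset_action G N ` K))"
proof (rule compactin_closure_finite_orbits)
  have Ns: "subgroup N G" by (rule finite_index_subgroup[OF K N])
  interpret \<phi>: group_hom G "BijGroup (lcosets N)" "coset_action G N"
    using coset_action_hom[OF subgroup.subset[OF Ns]] group_BijGroup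
    by (simp add: group_hom_def group_hom_axioms_def)
  show "subgroup (coset_action G N ` K) (BijGroup (lcosets N))"
    by (rule \<phi>.subgroup_img_is_subgroup[OF K])
  show "finite ((\<lambda>f. f C) ` coset_action G N ` K)" if "C \<in> lcosets N" for C
    using coset_orbit_finite[OF K comm N that] by (simp add: image_image)
qed

lemma coset_action_closure_profinite:
  assumes K: "subgroup K G" and comm: "commensurator G K = carrier G" and N: "finite_index G N K"
  defines "P \<equiv> pointwise_topology (lcosets N) closure_of (coset_action G N ` K)"
  shows "profinite_group (BijGroup (lcosets N)\<lparr>carrier := P\<rparr>) (subtopology (pointwise_topology (lcosets N)) P)"
proof -
  interpret S: topological_group "BijGroup (lcosets N)" "pointwise_topology (lcosets N)"
    by (rule topological_group_BijGroup)
  have Ns: "subgroup N G" by (rule finite_index_subgroup[OF K N])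
  interpret \<phi>: group_hom G "BijGroup (lcosets N)" "coset_action G N"
    using coset_action_hom[OF subgroup.subset[OF Ns]] by unfold_locales
  show ?thesis
    unfolding P_def
    by (intro S.profinite_compact_subgroup Hausdorff_pointwise_topology
        totally_disconnected_pointwise_topology S.subgroup_closure_of \<phi>.subgroup_img_is_subgroup[OF K]
        coset_action_closure_compact[OF K comm N])
qed

end

section \<open>Completions that separate subgroups of finite index\<close>

lemma finite_index_image:
  assumes "group G" "group R" "\<phi> \<in> hom G R" and B: "subgroup B G" and AB: "finite_index G A B"
  shows "finite_index R (\<phi> ` A) (\<phi> ` B)"
proof -
  interpret G: group G by fact
  interpret R: group R by fact
  interpret \<phi>: group_hom G R \<phi> using assms by (simp add: group_hom_def group_hom_axioms_def)
  have A: "subgroup A G" "A \<subseteq> B" using AB by (simp_all add: G.finite_index_iff[OF B])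
  obtain F where F: "finite F" "F \<subseteq> B" "\<forall>h\<in>B. \<exists>f\<in>F. inv\<^bsub>G\<^esub> f \<otimes>\<^bsub>G\<^esub> h \<in> A"
    using AB G.finite_index_iff[OF B] by metis
  show ?thesis
  proof (rule R.finite_indexI)
    show "subgroup (\<phi> ` B) R" "subgroup (\<phi> ` A) R"
      using \<phi>.subgroup_img_is_subgroup A B by auto
    show "finite (\<phi> ` F)" "\<phi> ` F \<subseteq> \<phi> ` B" "\<phi> ` A \<subseteq> \<phi> ` B" using F A by auto
    fix y assume "y \<in> \<phi> ` B"
    then obtain h where h: "h \<in> B" "y = \<phi> h" by blast
    obtain f where f: "f \<in> F" "inv\<^bsub>G\<^esub> f \<otimes>\<^bsub>G\<^esub> h \<in> A" using F(3) h by blast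
    have c: "f \<in> carrier G" "h \<in> carrier G" using f h F(2) subgroup.subset[OF B] by auto
    have "\<phi> (inv\<^bsub>G\<^esub> f \<otimes>\<^bsub>G\<^esub> h) = inv\<^bsub>R\<^esub> \<phi> f \<otimes>\<^bsub>R\<^esub> y" using c h by simp
    then have "inv\<^bsub>R\<^esub> \<phi> f \<otimes>\<^bsub>R\<^esub> y \<in> \<phi> ` A" using f by (metis imageI)
    then show "\<exists>z\<in>\<phi> ` F. inv\<^bsub>R\<^esub> z \<otimes>\<^bsub>R\<^esub> y \<in> \<phi> ` A" using f by blast
  qed
qed

lemma topological_group_DirProd:
  assumes "topological_group G T" "topological_group R S"
  shows "topological_group (G \<times>\<times> R) (prod_topology T S)"
proof -
  interpret G: topological_group G T by fact
  interpret R: topological_group R S by fact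
  interpret GR: group "G \<times>\<times> R" by (rule DirProd_group[OF G.is_group R.is_group])
  let ?P = "prod_topology T S"
  show ?thesis
  proof
    show "topspace ?P = carrier (G \<times>\<times> R)" by (simp add: DirProd_def)
    have "continuous_map (prod_topology ?P ?P) T (\<lambda>z. fst (fst z) \<otimes>\<^bsub>G\<^esub> fst (snd z))"
      by (intro G.continuous_map_mult
          continuous_map_compose[OF continuous_map_fst, unfolded o_def]
          continuous_map_compose[OF continuous_map_snd, unfolded o_def] continuous_map_fst continuous_map_snd)
    moreover have "continuous_map (prod_topology ?P ?P) S (\<lambda>z. snd (fst z) \<otimes>\<^bsub>R\<^esub> snd (snd z))"
      by (intro R.continuous_map_mult
          continuous_map_compose[OF continuous_map_fst, unfolded o_def]
          continuous_map_compose[OF continuous_map_snd, unfolded o_def] continuous_map_fst continuous_map_snd)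
    ultimately have "continuous_map (prod_topology ?P ?P) ?P
        (\<lambda>z. (fst (fst z) \<otimes>\<^bsub>G\<^esub> fst (snd z), snd (fst z) \<otimes>\<^bsub>R\<^esub> snd (snd z)))"
      by (simp add: continuous_map_paired)
    then show "continuous_map (prod_topology ?P ?P) ?P (\<lambda>(x, y). x \<otimes>\<^bsub>G \<times>\<times> R\<^esub> y)"
      by (simp add: DirProd_def case_prod_unfold)
    have "continuous_map ?P ?P (\<lambda>z. (inv\<^bsub>G\<^esub> fst z, inv\<^bsub>R\<^esub> snd z))"
      by (simp add: continuous_map_paired G.continuous_map_inverse R.continuous_map_inverse
          continuous_map_fst continuous_map_snd)
    then show "continuous_map ?P ?P (\<lambda>x. inv\<^bsub>G \<times>\<times> R\<^esub> x)"
      by (rule continuous_map_eq) (auto simp: inv_DirProd[OF G.is_group R.is_group])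
  qed
qed

lemma (in topological_group) finite_index_closure:
  assumes B: "subgroup B G" and AB: "finite_index G A B"
  shows "finite_index G (T closure_of A) (T closure_of B)"
proof -
  have A: "subgroup A G" and AsB: "A \<subseteq> B" using AB by (simp_all add: finite_index_iff[OF B])
  note AG = subgroup.subset[OF A] and BG = subgroup.subset[OF B]
  have cA: "A \<subseteq> T closure_of A" "T closure_of A \<subseteq> carrier G"
    using closure_of_subset[of A T] AG closure_of_subset_topspace[of T A] by auto
  have cB: "B \<subseteq> T closure_of B" using closure_of_subset[of B T] BG by auto
  obtain F where F: "finite F" "F \<subseteq> B" "\<And>h. h \<in> B \<Longrightarrow> \<exists>f\<in>F. \<exists>n\<in>A. h = f \<otimes> n"
    using finite_index_coset_reps[OF B AB] by metis
  have "closedin T (\<Union>f\<in>F. f <# (T closure_of A))"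
    using F BG by (intro closedin_Union) (auto intro!: closedin_l_coset)
  moreover have "B \<subseteq> (\<Union>f\<in>F. f <# (T closure_of A))"
    using F(3) cA unfolding l_coset_def by fast
  ultimately have sub: "T closure_of B \<subseteq> (\<Union>f\<in>F. f <# (T closure_of A))"
    by (simp add: closure_of_minimal)
  show ?thesis
  proof (rule finite_indexI)
    show "subgroup (T closure_of B) G" "subgroup (T closure_of A) G"
      using subgroup_closure_of A B by auto
    show "T closure_of A \<subseteq> T closure_of B" using AsB by (rule closure_of_mono)
    show "finite F" "F \<subseteq> T closure_of B" using F cB by auto
    fix h assume "h \<in> T closure_of B"
    then obtain f where f: "f \<in> F" "h \<in> f <# (T closure_of A)" using sub by auto
    then have "inv f \<otimes> h \<in> T closure_of A" using mem_l_coset_iff[OF _ cA(2), of f h] F BG by auto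
    then show "\<exists>f\<in>F. inv f \<otimes> h \<in> T closure_of A" using f by blast
  qed
qed

text \<open>This is the description of the localised completion through which everything else is proved.
The universal property, which quantifies over all targets, is replaced by \<open>separating\<close>: the closure of
the image of a closed subgroup \<open>N\<close> of finite index in \<open>K\<close> picks up no new elements of \<open>G\<close>.  It makes the
topology that \<open>\<theta>\<close> induces on \<open>K\<close> as fine as a profinite closure allows, and it passes to
intermediate and to commensurate subgroups by elementary arguments.\<close>

locale separating_completion =
  dom: topological_group G T + cod: topological_group Gh Th
  for G :: "('a, 'm) monoid_scheme" and T and K and Gh :: "('h, 'n) monoid_scheme" and Th and \<theta> +
  assumes K: "subgroup K G" and K_closed: "closedin T K"
    and commensurated: "commensurator G K = carrier G"
    and hom: "\<theta> \<in> hom G Gh"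
    and dense: "Th closure_of (\<theta> ` carrier G) = carrier Gh"
    and cont: "continuous_map (subtopology T K) Th \<theta>"
    and open_closure: "openin Th (Th closure_of (\<theta> ` K))"
    and profinite_closure: "profinite_group (Gh\<lparr>carrier := Th closure_of (\<theta> ` K)\<rparr>)
       (subtopology Th (Th closure_of (\<theta> ` K)))"
    and separating: "\<lbrakk>finite_index G N K; closedin T N; g \<in> carrier G; \<theta> g \<in> Th closure_of (\<theta> ` N)\<rbrakk>
       \<Longrightarrow> g \<in> N"
begin

sublocale group_hom G Gh \<theta>
  using hom by unfold_locales

text \<open>Written as \<open>H\<close> with a tilde in the informal statement.\<close>

abbreviation tld :: "'a set \<Rightarrow> 'h set" where "tld H \<equiv> Th closure_of (\<theta> ` H)"

lemma K_subset: "K \<subseteq> carrier G"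
  using subgroup.subset[OF K] .

lemma tld_subset: "tld H \<subseteq> carrier Gh"
  using closure_of_subset_topspace[of Th] by simp

lemma image_subset_tld: "H \<subseteq> carrier G \<Longrightarrow> \<theta> ` H \<subseteq> tld H"
  by (rule closure_of_subset) auto

lemma subgroup_tld: "subgroup H G \<Longrightarrow> subgroup (tld H) Gh"
  by (intro cod.subgroup_closure_of subgroup_img_is_subgroup)

lemma compactin_tld_K: "compactin Th (tld K)"
  using profinite_closure tld_subset by (simp add: profinite_group_def compactin_subspace)

lemma one_closed_cod: "closedin Th {\<one>\<^bsub>Gh\<^esub>}"
proof -
  have "closedin (subtopology Th (tld K)) {\<one>\<^bsub>Gh\<^esub>}"
    using profinite_closure subgroup.one_closed[OF subgroup_tld[OF K]]
    by (intro closedin_Hausdorff_singleton) (auto simp: profinite_group_def)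
  then show ?thesis by (rule closedin_trans_full) simp
qed

lemma Hausdorff_cod: "Hausdorff_space Th"
  by (rule cod.Hausdorff_if_closed_one[OF one_closed_cod])

lemma totally_disconnected_cod: "totally_disconnected_space Th"
  using cod.totally_disconnected_if_open_subgroup[OF subgroup_tld[OF K] open_closure] profinite_closure
  by (simp add: profinite_group_def)

lemma finite_index_tld:
  assumes "subgroup H G" "finite_index G N H"
  shows "finite_index Gh (tld N) (tld H)"
  by (rule cod.finite_index_closure[OF subgroup_img_is_subgroup[OF assms(1)]
        finite_index_image[OF dom.is_group cod.is_group hom assms]])

text \<open>\<open>tld N\<close> is closed and of finite index in the open subgroup \<open>tld K\<close>.\<close>

lemma openin_tld:
  assumes "finite_index G N K"
  shows "openin Th (tld N)"
proof -
  have "openin (subtopology Th (tld K)) (tld N)"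
    by (rule cod.finite_index_closed_imp_open[OF subgroup_tld[OF K] finite_index_tld[OF K assms]]) simp
  then show ?thesis using open_closure openin_trans_full by blast
qed

lemma closedin_vimage_K:
  assumes "closedin Th V"
  shows "closedin T {k \<in> K. \<theta> k \<in> V}"
proof -
  have "closedin (subtopology T K) {k \<in> topspace (subtopology T K). \<theta> k \<in> V}"
    by (rule closedin_continuous_map_preimage[OF cont assms])
  then show ?thesis using closedin_trans_full[OF _ K_closed] K_subset by (simp add: Int_absorb1)
qed

lemma open_subgroup_base:
  assumes "openin Th W" "\<one>\<^bsub>Gh\<^esub> \<in> W"
  obtains V where "subgroup V Gh" "openin Th V" "V \<subseteq> W" "V \<subseteq> tld K" "finite_index Gh V (tld K)"
proof -
  interpret C: topological_group "Gh\<lparr>carrier := tld K\<rparr>" "subtopology Th (tld K)"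
    using profinite_closure by (simp add: profinite_group_def)
  have pf: "compact_space (subtopology Th (tld K))" "Hausdorff_space (subtopology Th (tld K))"
      "totally_disconnected_space (subtopology Th (tld K))"
    using profinite_closure by (simp_all add: profinite_group_def)
  have "openin (subtopology Th (tld K)) (W \<inter> tld K)" by (rule openin_subtopology_Int[OF assms(1)])
  moreover have "\<one>\<^bsub>Gh\<lparr>carrier := tld K\<rparr>\<^esub> \<in> W \<inter> tld K"
    using assms subgroup.one_closed[OF subgroup_tld[OF K]] by simp
  ultimately obtain V where V: "subgroup V (Gh\<lparr>carrier := tld K\<rparr>)"
      "openin (subtopology Th (tld K)) V" "V \<subseteq> W \<inter> tld K"
    using C.profinite_open_subgroup_base[OF pf] by metis
  have "finite_index (Gh\<lparr>carrier := tld K\<rparr>) V (tld K)"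
    using C.open_subgroup_finite_index[OF V(1,2) pf(1)] by simp
  then have "finite_index Gh V (tld K)" by simp
  moreover have "subgroup V Gh" using V(1) cod.subgroup_of_subgroup_iff[OF subgroup_tld[OF K]] by simp
  moreover have "openin Th V" using V(2) open_closure openin_trans_full by blast
  ultimately show ?thesis using that V(3) by blast
qed

lemma dense_decomposition:
  assumes V: "subgroup V Gh" "openin Th V" and x: "x \<in> carrier Gh"
  obtains g v where "g \<in> carrier G" "v \<in> V" "x = \<theta> g \<otimes>\<^bsub>Gh\<^esub> v"
proof -
  note VG = subgroup.subset[OF V(1)]
  have "x \<in> Th closure_of (\<theta> ` carrier G)" using dense x by simp
  moreover have "openin Th (x <#\<^bsub>Gh\<^esub> V)" using cod.openin_l_coset[OF x V(2)] .
  moreover have "x \<in> x <#\<^bsub>Gh\<^esub> V" using cod.lcos_self[OF x V(1)] .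
  ultimately obtain g where g: "g \<in> carrier G" "\<theta> g \<in> x <#\<^bsub>Gh\<^esub> V"
    unfolding in_closure_of by blast
  then obtain w where w: "w \<in> V" "\<theta> g = x \<otimes>\<^bsub>Gh\<^esub> w" by (auto simp: l_coset_def)
  have wc: "w \<in> carrier Gh" using w VG by auto
  have "x = \<theta> g \<otimes>\<^bsub>Gh\<^esub> inv\<^bsub>Gh\<^esub> w" using w wc x by (simp add: cod.m_assoc)
  then show ?thesis using that g(1) subgroup.m_inv_closed[OF V(1) w(1)] by blast
qed

lemma vimage_tld:
  assumes "finite_index G N K" "closedin T N"
  shows "{g \<in> carrier G. \<theta> g \<in> tld N} = N"
  using separating[OF assms] image_subset_tld[of N] dom.finite_index_subset[OF K assms(1)] K_subset
  by blast

lemma continuous_homs_eq: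
  assumes "Hausdorff_space S" "continuous_map Th S \<psi>" "continuous_map Th S \<psi>'"
    and "\<And>g. g \<in> carrier G \<Longrightarrow> \<psi> (\<theta> g) = \<psi>' (\<theta> g)" and x: "x \<in> carrier Gh"
  shows "\<psi> x = \<psi>' x"
  by (rule forall_in_closure_of_eq[of x Th "\<theta> ` carrier G" S]) (use assms dense in auto)

section \<open>Extending homomorphisms to the completion\<close>

abbreviation extends :: "('r, 'k) monoid_scheme \<Rightarrow> 'r topology \<Rightarrow> ('a \<Rightarrow> 'r) \<Rightarrow> ('h \<Rightarrow> 'r) \<Rightarrow> bool" where
  "extends R S \<phi> \<psi> \<equiv> \<psi> \<in> extensional (carrier Gh) \<and> \<psi> \<in> hom Gh R \<and> continuous_map Th S \<psi> \<and>
      (\<forall>g \<in> carrier G. \<phi> g = \<psi> (\<theta> g))"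

text \<open>The closure \<open>\<Gamma>\<close> of the graph \<open>{(\<theta> g, \<phi> g)}\<close> in \<open>Gh \<times> R\<close> is a closed subgroup, and it is the graph of
the extension.  It is single-valued because \<open>\<theta>\<close> separates: if \<open>\<theta> g\<close> is close to the identity then \<open>g\<close>
lies in \<open>\<phi>\<^sup>-\<^sup>1(W)\<close> for a prescribed open subgroup \<open>W\<close> of the closure \<open>P\<close> of \<open>\<phi>(K)\<close>.  It is total because
\<open>P\<close> is compact, so that projecting along \<open>P\<close> preserves closed sets; the same projection gives
continuity on the open subgroup \<open>tld K\<close>, and this suffices.

The group \<open>R\<close> is not assumed to be Hausdorff, but it is: the identity is closed in \<open>P\<close>, and \<open>P\<close> is
closed.\<close>

theorem extension_exists:
  assumes R: "topological_group R S" and \<phi>: "\<phi> \<in> hom G R"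
    and \<phi>_cont: "continuous_map (subtopology T K) S \<phi>"
    and P: "profinite_group (R\<lparr>carrier := S closure_of (\<phi> ` K)\<rparr>) (subtopology S (S closure_of (\<phi> ` K)))"
  shows "Hausdorff_space S"
    and "\<exists>\<psi>. extends R S \<phi> \<psi>"
proof -
  interpret R: topological_group R S by fact
  interpret \<phi>: group_hom G R \<phi> using \<phi> by unfold_locales
  define P where "P = S closure_of (\<phi> ` K)"
  have Ps: "subgroup P R" unfolding P_def by (intro R.subgroup_closure_of \<phi>.subgroup_img_is_subgroup[OF K])
  have Pcl: "closedin S P" by (simp add: P_def)
  note PR = subgroup.subset[OF Ps]
  have KP: "\<phi> ` K \<subseteq> P" unfolding P_def using K_subset by (intro closure_of_subset) auto
  interpret P: topological_group "R\<lparr>carrier := P\<rparr>" "subtopology S P"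
    by (rule R.topological_group_subgroup[OF Ps])
  have pf: "compact_space (subtopology S P)" "Hausdorff_space (subtopology S P)"
      "totally_disconnected_space (subtopology S P)"
    using P by (simp_all add: profinite_group_def P_def)
  have "closedin (subtopology S P) {\<one>\<^bsub>R\<^esub>}"
    using pf subgroup.one_closed[OF Ps] by (intro closedin_Hausdorff_singleton) auto
  then have "closedin S {\<one>\<^bsub>R\<^esub>}" using Pcl by (rule closedin_trans_full)
  then show haus: "Hausdorff_space S" by (rule R.Hausdorff_if_closed_one)

  define Q where "Q = prod_topology Th S"
  interpret D: topological_group "Gh \<times>\<times> R" Q
    unfolding Q_def by (rule topological_group_DirProd[OF cod.topological_group_axioms R])
  have pair_hom: "(\<lambda>g. (\<theta> g, \<phi> g)) \<in> hom G (Gh \<times>\<times> R)"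
    by (rule homI) (simp_all add: DirProd_def)
  interpret p: group_hom G "Gh \<times>\<times> R" "\<lambda>g. (\<theta> g, \<phi> g)"
    using pair_hom by unfold_locales
  define \<Gamma>0 where "\<Gamma>0 = (\<lambda>g. (\<theta> g, \<phi> g)) ` carrier G"
  define \<Gamma> where "\<Gamma> = Q closure_of \<Gamma>0"
  have \<Gamma>_sub: "subgroup \<Gamma> (Gh \<times>\<times> R)"
    unfolding \<Gamma>_def \<Gamma>0_def by (intro D.subgroup_closure_of p.img_is_subgroup)
  have \<Gamma>_cl: "closedin Q \<Gamma>" by (simp add: \<Gamma>_def)
  have \<Gamma>_carrier: "x \<in> carrier Gh" "y \<in> carrier R" if "(x, y) \<in> \<Gamma>" for x y
    using subgroup.subset[OF \<Gamma>_sub] that by (auto simp: DirProd_def)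
  have \<Gamma>_graph: "(\<theta> g, \<phi> g) \<in> \<Gamma>" if "g \<in> carrier G" for g
  proof -
    have "\<Gamma>0 \<subseteq> topspace Q" by (auto simp: \<Gamma>0_def Q_def)
    then show ?thesis using closure_of_subset[of \<Gamma>0 Q] that by (auto simp: \<Gamma>_def \<Gamma>0_def)
  qed
  have \<Gamma>_mult: "(x \<otimes>\<^bsub>Gh\<^esub> x', y \<otimes>\<^bsub>R\<^esub> y') \<in> \<Gamma>" if "(x, y) \<in> \<Gamma>" "(x', y') \<in> \<Gamma>" for x x' y y'
    using subgroup.m_closed[OF \<Gamma>_sub that] by (simp add: DirProd_def)
  have \<Gamma>_inv: "(inv\<^bsub>Gh\<^esub> x, inv\<^bsub>R\<^esub> y) \<in> \<Gamma>" if "(x, y) \<in> \<Gamma>" for x y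
    using subgroup.m_inv_closed[OF \<Gamma>_sub that] \<Gamma>_carrier[OF that]
    by (simp add: inv_DirProd[OF cod.is_group R.is_group])

  (* The open set tld N times the complement of W misses the graph of phi on G. *)
  have in_open: "y \<in> W"
    if 1: "(\<one>\<^bsub>Gh\<^esub>, y) \<in> \<Gamma>" and W: "subgroup W (R\<lparr>carrier := P\<rparr>)" "openin (subtopology S P) W" for y W
  proof (rule ccontr)
    assume "y \<notin> W"
    have "closedin (subtopology S P) W" by (rule P.open_subgroup_closed[OF W])
    then have Wcl: "closedin S W" using Pcl closedin_trans_full by blast
    have Wfi: "finite_index R W P" using P.open_subgroup_finite_index[OF W pf(1)] by simp
    define N where "N = {k \<in> K. \<phi> k \<in> W}"
    have Nfi: "finite_index G N K"
      unfolding N_def by (rule finite_index_vimage[OF dom.is_group R.is_group \<phi> Ps Wfi K KP])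
    have "closedin (subtopology T K) {k \<in> topspace (subtopology T K). \<phi> k \<in> W}"
      by (rule closedin_continuous_map_preimage[OF \<phi>_cont Wcl])
    then have Ncl: "closedin T N"
      using closedin_trans_full[OF _ K_closed] K_subset by (simp add: N_def Int_absorb1)
    have "subgroup N G" by (rule dom.finite_index_subgroup[OF K Nfi])
    then have oneN: "\<one>\<^bsub>Gh\<^esub> \<in> tld N" using subgroup.one_closed[OF subgroup_tld] by blast
    have "openin Q (tld N \<times> (carrier R - W))"
      using openin_tld[OF Nfi] Wcl by (simp add: Q_def openin_prod_Times_iff closedin_def)
    moreover have "(\<one>\<^bsub>Gh\<^esub>, y) \<in> tld N \<times> (carrier R - W)"
      using oneN \<open>y \<notin> W\<close> \<Gamma>_carrier[OF 1] by simp
    moreover have "\<forall>U. (\<one>\<^bsub>Gh\<^esub>, y) \<in> U \<and> openin Q U \<longrightarrow> (\<exists>z. z \<in> \<Gamma>0 \<and> z \<in> U)"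
      using 1 by (simp add: \<Gamma>_def in_closure_of)
    ultimately obtain z where "z \<in> \<Gamma>0" "z \<in> tld N \<times> (carrier R - W)"
      by metis
    then obtain g where g: "g \<in> carrier G" "\<theta> g \<in> tld N" "\<phi> g \<notin> W" by (auto simp: \<Gamma>0_def)
    then have "g \<in> N" using separating[OF Nfi Ncl] by blast
    then show False using g by (simp add: N_def)
  qed
  have kernel_trivial: "y = \<one>\<^bsub>R\<^esub>" if 1: "(\<one>\<^bsub>Gh\<^esub>, y) \<in> \<Gamma>" for y
  proof (rule ccontr)
    assume y: "y \<noteq> \<one>\<^bsub>R\<^esub>"
    have yP: "y \<in> P"
    proof (rule in_open[OF 1])
      show "subgroup P (R\<lparr>carrier := P\<rparr>)" using P.subgroup_self by simp
      show "openin (subtopology S P) P"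
        using openin_topspace[of "subtopology S P"] P.topspace by simp
    qed
    have "closedin (subtopology S P) {y}"
      using pf(2) yP PR by (intro closedin_Hausdorff_singleton) auto
    then have "openin (subtopology S P) (P - {y})"
      using openin_diff[OF openin_topspace] P.topspace by fastforce
    moreover have "\<one>\<^bsub>R\<lparr>carrier := P\<rparr>\<^esub> \<in> P - {y}" using y subgroup.one_closed[OF Ps] by simp
    ultimately obtain V where "subgroup V (R\<lparr>carrier := P\<rparr>)" "openin (subtopology S P) V" "V \<subseteq> P - {y}"
      using P.profinite_open_subgroup_base[OF pf] by metis
    then show False using in_open[OF 1] by blast
  qed
  have unique: "y = y'" if "(x, y) \<in> \<Gamma>" "(x, y') \<in> \<Gamma>" for x y y'
  proof -
    have c: "x \<in> carrier Gh" "y \<in> carrier R" "y' \<in> carrier R" using \<Gamma>_carrier that by auto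
    have "(inv\<^bsub>Gh\<^esub> x \<otimes>\<^bsub>Gh\<^esub> x, inv\<^bsub>R\<^esub> y \<otimes>\<^bsub>R\<^esub> y') \<in> \<Gamma>" by (rule \<Gamma>_mult[OF \<Gamma>_inv[OF that(1)] that(2)])
    then have "inv\<^bsub>R\<^esub> y \<otimes>\<^bsub>R\<^esub> y' = \<one>\<^bsub>R\<^esub>" using kernel_trivial c by simp
    then have "y \<otimes>\<^bsub>R\<^esub> (inv\<^bsub>R\<^esub> y \<otimes>\<^bsub>R\<^esub> y') = y" using c by simp
    then show ?thesis using c by (simp add: R.group_normalise)
  qed

  define Q' where "Q' = prod_topology Th (subtopology S P)"
  have Q'_eq: "Q' = subtopology Q (carrier Gh \<times> P)"
    unfolding Q'_def Q_def prod_topology_subtopology by (simp add: subtopology_topspace[of Th, simplified])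
  (* Closed subsets of P have closed preimages; C = P shows that the domain is closed. *)
  have proj_closed: "closedin Th {x. \<exists>y\<in>C. (x, y) \<in> \<Gamma>}" if C: "closedin (subtopology S P) C" for C
  proof -
    have CP: "C \<subseteq> P" using closedin_subset[OF C] by auto
    have "closedin Q' (\<Gamma> \<inter> (carrier Gh \<times> P))"
      unfolding Q'_eq using closedin_subtopology_Int_closed[OF \<Gamma>_cl, of "carrier Gh \<times> P"]
      by (simp add: Int_commute)
    moreover have "closedin Q' (carrier Gh \<times> C)"
      unfolding Q'_def using C closedin_topspace[of Th] by (simp add: closedin_prod_Times_iff)
    ultimately have "closedin Q' (\<Gamma> \<inter> (carrier Gh \<times> P) \<inter> (carrier Gh \<times> C))" by (rule closedin_Int)
    then have "closedin Th (fst ` (\<Gamma> \<inter> (carrier Gh \<times> P) \<inter> (carrier Gh \<times> C)))"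
      using closed_map_fst[OF pf(1), of Th] by (simp add: Q'_def closed_map_def)
    moreover have "fst ` (\<Gamma> \<inter> (carrier Gh \<times> P) \<inter> (carrier Gh \<times> C)) = {x. \<exists>y\<in>C. (x, y) \<in> \<Gamma>}"
      using CP \<Gamma>_carrier by force
    ultimately show ?thesis by simp
  qed
  have total_K: "\<exists>y\<in>P. (x, y) \<in> \<Gamma>" if x: "x \<in> tld K" for x
  proof -
    have "closedin (subtopology S P) P"
      using closedin_topspace[of "subtopology S P"] P.topspace by simp
    then have "closedin Th {x. \<exists>y\<in>P. (x, y) \<in> \<Gamma>}" by (rule proj_closed)
    moreover have "\<theta> ` K \<subseteq> {x. \<exists>y\<in>P. (x, y) \<in> \<Gamma>}" using KP \<Gamma>_graph K_subset by blast
    ultimately have "tld K \<subseteq> {x. \<exists>y\<in>P. (x, y) \<in> \<Gamma>}" by (simp add: closure_of_minimal)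
    then show ?thesis using x by blast
  qed
  have total: "\<exists>y. (x, y) \<in> \<Gamma>" if x: "x \<in> carrier Gh" for x
  proof -
    obtain g v where gv: "g \<in> carrier G" "v \<in> tld K" "x = \<theta> g \<otimes>\<^bsub>Gh\<^esub> v"
      using dense_decomposition[OF subgroup_tld[OF K] open_closure x] by metis
    obtain y where "(v, y) \<in> \<Gamma>" using total_K[OF gv(2)] by blast
    then show ?thesis using \<Gamma>_mult[OF \<Gamma>_graph[OF gv(1)]] gv(3) by blast
  qed

  define \<psi> where "\<psi> = (\<lambda>x\<in>carrier Gh. THE y. (x, y) \<in> \<Gamma>)"
  have \<psi>_eq: "\<psi> x = y" if "(x, y) \<in> \<Gamma>" for x y
    using that unique \<Gamma>_carrier by (auto simp: \<psi>_def)
  have \<psi>_graph: "(x, \<psi> x) \<in> \<Gamma>" if "x \<in> carrier Gh" for x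
    using total[OF that] \<psi>_eq by metis
  have \<psi>_hom: "\<psi> \<in> hom Gh R"
    by (rule homI) (simp_all add: \<Gamma>_carrier(2)[OF \<psi>_graph] \<psi>_eq[OF \<Gamma>_mult[OF \<psi>_graph \<psi>_graph]])
  have \<psi>_P: "\<psi> x \<in> P" if "x \<in> tld K" for x
    using total_K[OF that] \<psi>_eq by metis
  have "continuous_map (subtopology Th (tld K)) (subtopology S P) \<psi>"
    unfolding continuous_map_closedin
  proof (intro conjI allI impI)
    show "\<psi> \<in> topspace (subtopology Th (tld K)) \<rightarrow> topspace (subtopology S P)"
      using \<psi>_P PR by auto
    fix C assume C: "closedin (subtopology S P) C"
    have "{x \<in> topspace (subtopology Th (tld K)). \<psi> x \<in> C} = {x. \<exists>y\<in>C. (x, y) \<in> \<Gamma>} \<inter> tld K"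
      using \<psi>_graph \<psi>_eq \<Gamma>_carrier tld_subset by auto
    then show "closedin (subtopology Th (tld K)) {x \<in> topspace (subtopology Th (tld K)). \<psi> x \<in> C}"
      using closedin_subtopology_Int_closed[OF proj_closed[OF C], of "tld K"] by (simp add: Int_commute)
  qed
  then have "continuous_map (subtopology Th (tld K)) S \<psi>" by (rule continuous_map_into_fulltopology)
  then have "continuous_map Th S \<psi>"
    by (rule hom_continuous_if_continuous_on_open_subgroup[OF cod.topological_group_axioms R \<psi>_hom
          subgroup_tld[OF K] open_closure])
  moreover have "\<phi> g = \<psi> (\<theta> g)" if "g \<in> carrier G" for g using \<psi>_eq[OF \<Gamma>_graph[OF that]] by simp
  moreover have "\<psi> \<in> extensional (carrier Gh)" by (simp add: \<psi>_def)
  ultimately show "\<exists>\<psi>. extends R S \<phi> \<psi>"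
    using \<psi>_hom by blast
qed

corollary extension_unique_exists:
  assumes R: "topological_group R S" and \<phi>: "\<phi> \<in> hom G R"
    and \<phi>_cont: "continuous_map (subtopology T K) S \<phi>"
    and P: "profinite_group (R\<lparr>carrier := S closure_of (\<phi> ` K)\<rparr>) (subtopology S (S closure_of (\<phi> ` K)))"
  shows "\<exists>!\<psi>. extends R S \<phi> \<psi>"
proof (rule ex_ex1I)
  show "\<exists>\<psi>. extends R S \<phi> \<psi>"
    by (rule extension_exists(2)[OF assms])
  fix \<psi> \<psi>'
  assume 1: "extends R S \<phi> \<psi>"
    and 2: "extends R S \<phi> \<psi>'"
  show "\<psi> = \<psi>'"
  proof (rule extensionalityI)
    show "\<psi> x = \<psi>' x" if "x \<in> carrier Gh" for x
      by (rule continuous_homs_eq[OF extension_exists(1)[OF assms]]) (use 1 2 that in auto)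
  qed (use 1 2 in auto)
qed

end

section \<open>The universal property\<close>

lemma localised_completion_commensuratedI:
  fixes G :: "'a monoid" and Gh :: "'h monoid"
  assumes "separating_completion G T K Gh Th \<theta>"
  shows "localised_completion_commensurated TYPE('r) G T K Gh Th \<theta>"
proof -
  interpret separating_completion G T K Gh Th \<theta> by fact
  show ?thesis
    unfolding localised_completion_commensurated_def
  proof (intro conjI allI impI)
    fix R :: "'r monoid" and S \<phi>
    assume "topological_group R S \<and> \<phi> \<in> hom G R \<and> continuous_map (subtopology T K) S \<phi> \<and>
      profinite_group (R\<lparr>carrier := S closure_of (\<phi> ` K)\<rparr>) (subtopology S (S closure_of (\<phi> ` K)))"
    then show "\<exists>!\<psi>. \<psi> \<in> extensional (carrier Gh) \<and> \<psi> \<in> hom Gh R \<and> continuous_map Th S \<psi> \<and>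
      (\<forall>g \<in> carrier G. \<phi> g = \<psi> (\<theta> g))"
      by (elim conjE) (rule extension_unique_exists)
  qed (rule dom.topological_group_axioms K K_closed commensurated cod.topological_group_axioms hom dense
      cont open_closure profinite_closure)+
qed

text \<open>To separate \<open>g\<close> from \<open>N\<close> extend the action of \<open>G\<close> on \<open>G/N\<close> to the completion: the closure of the
  image of \<open>N\<close> then still fixes the coset \<open>N\<close>, which \<open>g\<close> moves unless \<open>g \<in> N\<close>.  Permutations of
  \<open>G/N\<close> have type \<open>'a set \<Rightarrow> 'a set\<close>, so the universal property is used for this type only; the
  converse lemma above then yields it for all types.\<close>

lemma localised_completion_commensuratedD:
  fixes G :: "'a monoid" and Gh :: "'h monoid"
  assumes "localised_completion_commensurated TYPE('a set \<Rightarrow> 'a set) G T K Gh Th \<theta>"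
  shows "separating_completion G T K Gh Th \<theta>"
proof -
  note L = assms[unfolded localised_completion_commensurated_def]
  interpret G: topological_group G T using L by blast
  interpret Gh: topological_group Gh Th using L by blast
  have K: "subgroup K G" "closedin T K" and comm: "commensurator G K = carrier G"
    and hom: "\<theta> \<in> hom G Gh" and dense: "Th closure_of (\<theta> ` carrier G) = carrier Gh"
    and cont: "continuous_map (subtopology T K) Th \<theta>"
    and opn: "openin Th (Th closure_of (\<theta> ` K))"
    and prof: "profinite_group (Gh\<lparr>carrier := Th closure_of (\<theta> ` K)\<rparr>)
       (subtopology Th (Th closure_of (\<theta> ` K)))"
    using L by blast+
  have up: "\<exists>\<psi>. continuous_map Th S \<psi> \<and> (\<forall>g \<in> carrier G. \<phi> g = \<psi> (\<theta> g))"
    if "topological_group R S" "\<phi> \<in> hom G R" "continuous_map (subtopology T K) S \<phi>"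
      "profinite_group (R\<lparr>carrier := S closure_of (\<phi> ` K)\<rparr>) (subtopology S (S closure_of (\<phi> ` K)))"
    for R :: "('a set \<Rightarrow> 'a set) monoid" and S \<phi>
  proof -
    have "\<exists>!\<psi>. \<psi> \<in> extensional (carrier Gh) \<and> \<psi> \<in> hom Gh R \<and> continuous_map Th S \<psi> \<and>
        (\<forall>g \<in> carrier G. \<phi> g = \<psi> (\<theta> g))"
      using L that by blast
    then show ?thesis by blast
  qed
  show ?thesis
  proof (rule separating_completion.intro[OF G.topological_group_axioms Gh.topological_group_axioms],
      rule separating_completion_axioms.intro)
    fix N g
    assume N: "finite_index G N K" "closedin T N" and g: "g \<in> carrier G" "\<theta> g \<in> Th closure_of (\<theta> ` N)"
    have Ns: "subgroup N G" by (rule G.finite_index_subgroup[OF K(1) N(1)])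
    note NG = subgroup.subset[OF Ns]
    let ?X = "lcosets\<^bsub>G\<^esub> N"
    obtain \<psi> where \<psi>: "continuous_map Th (pointwise_topology ?X) \<psi>"
        "\<And>g. g \<in> carrier G \<Longrightarrow> coset_action G N g = \<psi> (\<theta> g)"
      using up[OF topological_group_BijGroup G.coset_action_hom[OF NG]
          G.coset_action_continuous[OF K comm N] G.coset_action_closure_profinite[OF K(1) comm N(1)]]
      by blast
    have X: "N \<in> ?X"
      using G.l_coset_in_lcosets[OF G.one_closed, of N] G.lcos_mult_one[OF NG] by simp
    have fixes_iff: "coset_action G N a N = N \<longleftrightarrow> a \<in> N" if "a \<in> carrier G" for a
      using G.coset_action_fixes_iff[OF Ns that G.one_closed] G.lcos_mult_one[OF NG] G.conjugate_one[OF NG]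
      by simp
    let ?Fix = "{f \<in> Bij ?X. f N = N}"
    have "\<psi> ` (Th closure_of (\<theta> ` N)) \<subseteq> pointwise_topology ?X closure_of (\<psi> ` \<theta> ` N)"
      by (rule continuous_map_image_closure_subset[OF \<psi>(1)])
    also have "\<dots> \<subseteq> ?Fix"
    proof (rule closure_of_minimal[OF _ closedin_pointwise_eval[OF X]])
      show "\<psi> ` \<theta> ` N \<subseteq> ?Fix"
      proof clarify
        fix n assume n: "n \<in> N"
        then have nG: "n \<in> carrier G" using NG by blast
        have "\<psi> (\<theta> n) = coset_action G N n" using \<psi>(2)[OF nG] by simp
        then show "\<psi> (\<theta> n) \<in> Bij ?X \<and> \<psi> (\<theta> n) N = N"
          using hom_in_carrier[OF G.coset_action_hom[OF NG] nG] fixes_iff[OF nG] n by simp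
      qed
    qed
    finally have "\<psi> (\<theta> g) \<in> ?Fix" using g by blast
    then show "g \<in> N" using \<psi>(2)[OF g(1)] fixes_iff[OF g(1)] by simp
  qed (rule K comm hom dense cont opn prof)+
qed

lemma localised_completion_separating:
  fixes G :: "'a monoid" and Gh :: "'h monoid"
  assumes "localised_completion TYPE('a set \<Rightarrow> 'a set) G T K Gh Th \<theta>"
  shows "separating_completion (G\<lparr>carrier := commensurator G K\<rparr>) (subtopology T (commensurator G K)) K Gh Th \<theta>"
  using assms unfolding localised_completion_def by (intro localised_completion_commensuratedD) simp

lemma localised_completionI:
  fixes G :: "'a monoid" and Gh :: "'h monoid"
  assumes "topological_group G T" "subgroup K G" "closedin T K"
    and "separating_completion (G\<lparr>carrier := commensurator G K\<rparr>) (subtopology T (commensurator G K)) K Gh Th \<theta>"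
  shows "localised_completion TYPE('r) G T K Gh Th \<theta>"
  using assms unfolding localised_completion_def by (intro conjI localised_completion_commensuratedI)

lemma localised_completionI_commensurated:
  fixes G :: "'a monoid" and Gh :: "'h monoid"
  assumes "separating_completion G T K Gh Th \<theta>"
  shows "localised_completion TYPE('r) G T K Gh Th \<theta>"
proof -
  interpret separating_completion G T K Gh Th \<theta> by fact
  have "G\<lparr>carrier := commensurator G K\<rparr> = G" "subtopology T (commensurator G K) = T"
    using commensurated subtopology_topspace[of T] by simp_all
  then show ?thesis
    using assms by (intro localised_completionI dom.topological_group_axioms K K_closed) simp
qed

text \<open>The extensions of each map along the other are mutually inverse, by uniqueness.\<close>

lemma separating_completion_unique:
  assumes "separating_completion G T K Gh Th \<theta>" and "separating_completion G T K Gh' Th' \<theta>'"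
  obtains \<beta> where "topological_group_iso Gh' Th' Gh Th \<beta>" "\<And>g. g \<in> carrier G \<Longrightarrow> \<theta> g = \<beta> (\<theta>' g)"
proof -
  interpret A: separating_completion G T K Gh Th \<theta> by fact
  interpret B: separating_completion G T K Gh' Th' \<theta>' by fact
  obtain \<alpha> where \<alpha>: "\<alpha> \<in> hom Gh Gh'" "continuous_map Th Th' \<alpha>" "\<And>g. g \<in> carrier G \<Longrightarrow> \<theta>' g = \<alpha> (\<theta> g)"
    using A.extension_exists(2)[OF B.cod.topological_group_axioms B.hom B.cont B.profinite_closure] by blast
  obtain \<beta> where \<beta>: "\<beta> \<in> hom Gh' Gh" "continuous_map Th' Th \<beta>" "\<And>g. g \<in> carrier G \<Longrightarrow> \<theta> g = \<beta> (\<theta>' g)"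
    using B.extension_exists(2)[OF A.cod.topological_group_axioms A.hom A.cont A.profinite_closure] by blast
  have \<beta>\<alpha>: "\<beta> (\<alpha> x) = x" if x: "x \<in> carrier Gh" for x
  proof -
    have "(\<beta> \<circ> \<alpha>) x = id x"
      by (rule A.continuous_homs_eq[OF A.Hausdorff_cod continuous_map_compose[OF \<alpha>(2) \<beta>(2)] continuous_map_id])
        (simp_all add: x flip: \<alpha>(3) \<beta>(3))
    then show ?thesis by simp
  qed
  have \<alpha>\<beta>: "\<alpha> (\<beta> x) = x" if x: "x \<in> carrier Gh'" for x
  proof -
    have "(\<alpha> \<circ> \<beta>) x = id x"
      by (rule B.continuous_homs_eq[OF B.Hausdorff_cod continuous_map_compose[OF \<beta>(2) \<alpha>(2)] continuous_map_id])
        (simp_all add: x flip: \<alpha>(3) \<beta>(3))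
    then show ?thesis by simp
  qed
  have "homeomorphic_maps Th' Th \<beta> \<alpha>"
    using \<alpha>(2) \<beta>(2) \<alpha>\<beta> \<beta>\<alpha> by (simp add: homeomorphic_maps_def)
  then have h: "homeomorphic_map Th' Th \<beta>" using homeomorphic_maps_map by blast
  then have "bij_betw \<beta> (carrier Gh') (carrier Gh)"
    using h by (simp add: homeomorphic_eq_everything_map bij_betw_def)
  then have "topological_group_iso Gh' Th' Gh Th \<beta>"
    using \<beta>(1) h by (simp add: topological_group_iso_def iso_def)
  then show ?thesis using that \<beta>(3) by blast
qed

section \<open>Intermediate and commensurate subgroups\<close>

context topological_group
begin

lemma openin_if_contains_open_subgroup:
  assumes H: "subgroup H G" and V: "subgroup V G" "openin T V" "V \<subseteq> H"
  shows "openin T H"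
proof -
  note HG = subgroup.subset[OF H]
  have "H = (\<Union>h\<in>H. h <# V)"
  proof
    show "H \<subseteq> (\<Union>h\<in>H. h <# V)" using lcos_self[OF _ V(1)] HG by blast
    show "(\<Union>h\<in>H. h <# V) \<subseteq> H" using V(3) subgroup.m_closed[OF H] by (auto simp: l_coset_def)
  qed
  moreover have "openin T (\<Union>h\<in>H. h <# V)" using openin_l_coset[OF _ V(2)] HG by auto
  ultimately show ?thesis by simp
qed

lemma compactin_finite_index:
  assumes B: "subgroup B G" and AB: "finite_index G A B" and A: "compactin T A"
  shows "compactin T B"
proof -
  have As: "subgroup A G" "A \<subseteq> B" using AB by (simp_all add: finite_index_iff[OF B])
  obtain F where F: "finite F" "F \<subseteq> B" "\<And>h. h \<in> B \<Longrightarrow> \<exists>f\<in>F. \<exists>n\<in>A. h = f \<otimes> n"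
    using finite_index_coset_reps[OF B AB] by metis
  have "B = (\<Union>f\<in>F. (\<lambda>x. f \<otimes> x) ` A)"
    using F(2,3) As(2) subgroup.m_closed[OF B] by fast
  moreover have "compactin T ((\<lambda>x. f \<otimes> x) ` A)" if "f \<in> F" for f
    using that F(2) subgroup.subset[OF B] by (intro image_compactin[OF A] continuous_left_translation) auto
  ultimately show ?thesis using compactin_Union[of "(\<lambda>f. (\<lambda>x. f \<otimes> x) ` A) ` F" T] F(1) by auto
qed

end

context separating_completion
begin

lemma closure_in_tld:
  assumes "A \<subseteq> H" "H \<subseteq> carrier G"
  shows "subtopology Th (tld H) closure_of (\<theta> ` A) = tld A"
proof -
  have "\<theta> ` A \<subseteq> tld H" using image_subset_tld[OF assms(2)] assms(1) by blast
  moreover have "tld A \<subseteq> tld H" using assms(1) by (intro closure_of_mono image_mono)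
  ultimately show ?thesis by (simp add: closure_of_subtopology Int_absorb1)
qed

text \<open>All data of the completion except density live in \<open>tld K\<close>, which \<open>tld H\<close> contains.\<close>

lemma restrict_to_subgroup:
  assumes H: "subgroup H G" and KH: "K \<subseteq> H"
  shows "separating_completion (G\<lparr>carrier := H\<rparr>) (subtopology T H) K
    (Gh\<lparr>carrier := tld H\<rparr>) (subtopology Th (tld H)) \<theta>"
proof -
  note HG = subgroup.subset[OF H]
  have tH: "subgroup (tld H) Gh" by (rule subgroup_tld[OF H])
  interpret H: topological_group "G\<lparr>carrier := H\<rparr>" "subtopology T H"
    by (rule dom.topological_group_subgroup[OF H])
  interpret tH: topological_group "Gh\<lparr>carrier := tld H\<rparr>" "subtopology Th (tld H)"
    by (rule cod.topological_group_subgroup[OF tH])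
  have KK: "subtopology Th (tld H) closure_of (\<theta> ` K) = tld K" by (rule closure_in_tld[OF KH HG])
  have tKH: "tld K \<subseteq> tld H" using KH by (intro closure_of_mono image_mono)
  have TK: "subtopology (subtopology T H) K = subtopology T K"
    using KH by (simp add: subtopology_subtopology Int_absorb1)
  have TtK: "subtopology (subtopology Th (tld H)) (tld K) = subtopology Th (tld K)"
    using tKH by (simp add: subtopology_subtopology Int_absorb1)
  have im: "\<theta> ` H \<subseteq> tld H" by (rule image_subset_tld[OF HG])
  show ?thesis
  proof (rule separating_completion.intro[OF H.topological_group_axioms tH.topological_group_axioms],
      rule separating_completion_axioms.intro)
    show "subgroup K (G\<lparr>carrier := H\<rparr>)" using dom.subgroup_incl[OF K H KH] .
    show "closedin (subtopology T H) K" using K_closed KH by (simp add: closedin_subset_topspace)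
    show "commensurator (G\<lparr>carrier := H\<rparr>) K = carrier (G\<lparr>carrier := H\<rparr>)"
      using dom.commensurator_consistent[OF H] commensurated HG by auto
    show "\<theta> \<in> hom (G\<lparr>carrier := H\<rparr>) (Gh\<lparr>carrier := tld H\<rparr>)"
      using im by (intro homI) (simp_all add: image_subset_iff subsetD[OF HG])
    show "subtopology Th (tld H) closure_of (\<theta> ` carrier (G\<lparr>carrier := H\<rparr>)) = carrier (Gh\<lparr>carrier := tld H\<rparr>)"
      using closure_in_tld[of H H] HG by simp
    show "continuous_map (subtopology (subtopology T H) K) (subtopology Th (tld H)) \<theta>"
      unfolding TK using cont im KH by (auto simp: continuous_map_in_subtopology)
    show "openin (subtopology Th (tld H)) (subtopology Th (tld H) closure_of (\<theta> ` K))"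
      unfolding KK using openin_subtopology_Int2[OF open_closure, of "tld H"] tKH by (simp add: Int_absorb1)
    show "profinite_group
        (Gh\<lparr>carrier := tld H\<rparr>\<lparr>carrier := subtopology Th (tld H) closure_of (\<theta> ` K)\<rparr>)
        (subtopology (subtopology Th (tld H)) (subtopology Th (tld H) closure_of (\<theta> ` K)))"
      unfolding KK TtK using profinite_closure by simp
    fix N g
    assume N: "finite_index (G\<lparr>carrier := H\<rparr>) N K" "closedin (subtopology T H) N"
      and g: "g \<in> carrier (G\<lparr>carrier := H\<rparr>)" "\<theta> g \<in> subtopology Th (tld H) closure_of (\<theta> ` N)"
    have Nfi: "finite_index G N K" using N(1) by simp
    then have NK: "N \<subseteq> K" by (rule dom.finite_index_subset[OF K])
    have "closedin (subtopology T K) N"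
      using closedin_subset_topspace[OF N(2) NK] unfolding TK .
    then have "closedin T N" using K_closed by (rule closedin_trans_full)
    moreover have "\<theta> g \<in> tld N" using g closure_in_tld[of N H] NK KH HG by auto
    ultimately show "g \<in> N" using separating[OF Nfi] g HG by auto
  qed
qed

text \<open>If the image of \<open>g\<close> is a limit of images of elements of \<open>A\<close>, then some \<open>a \<in> A\<close> has
\<open>\<theta>(g\<^sup>-\<^sup>1 a) \<in> tld N\<close>, so \<open>g\<^sup>-\<^sup>1 a \<in> N \<subseteq> A\<close>.\<close>

lemma mem_if_image_near_image:
  assumes N: "finite_index G N K" "closedin T N" "N \<subseteq> A" and A: "subgroup A G"
    and g: "g \<in> carrier G" "\<theta> g \<in> tld A"
  shows "g \<in> A"
proof -
  have Ns: "subgroup N G" by (rule dom.finite_index_subgroup[OF K N(1)])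
  have "openin Th (\<theta> g <#\<^bsub>Gh\<^esub> tld N)" using cod.openin_l_coset openin_tld[OF N(1)] g by simp
  moreover have "\<theta> g \<in> \<theta> g <#\<^bsub>Gh\<^esub> tld N" using cod.lcos_self[OF _ subgroup_tld[OF Ns]] g by simp
  ultimately obtain a where a: "a \<in> A" "\<theta> a \<in> \<theta> g <#\<^bsub>Gh\<^esub> tld N"
    using g(2) unfolding in_closure_of by blast
  have ac: "a \<in> carrier G" using a subgroup.subset[OF A] by blast
  have "inv\<^bsub>Gh\<^esub> \<theta> g \<otimes>\<^bsub>Gh\<^esub> \<theta> a \<in> tld N" using a(2) cod.mem_l_coset_iff[OF _ tld_subset] g by simp
  then have "\<theta> (inv\<^bsub>G\<^esub> g \<otimes>\<^bsub>G\<^esub> a) \<in> tld N" using g ac by simp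
  then have "inv\<^bsub>G\<^esub> g \<otimes>\<^bsub>G\<^esub> a \<in> N" using separating[OF N(1,2)] g ac by simp
  then have "a \<otimes>\<^bsub>G\<^esub> inv\<^bsub>G\<^esub> (inv\<^bsub>G\<^esub> g \<otimes>\<^bsub>G\<^esub> a) \<in> A"
    using N(3) a subgroup.m_closed[OF A] subgroup.m_inv_closed[OF A] by blast
  then show ?thesis using g ac by (simp add: dom.group_normalise)
qed

text \<open>Everything is compared with \<open>M = K \<inter> L\<close>.  It is open in \<open>L\<close>, which gives continuity on \<open>L\<close>, and
\<open>tld M\<close> is a compact open subgroup of finite index in \<open>tld L\<close>.\<close>

theorem completion_at_commensurate_subgroup:
  assumes L: "subgroup L G" "closedin T L" and KL: "commensurate G K L"
  shows "separating_completion G T L Gh Th \<theta>"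
proof -
  define M where "M = K \<inter> L"
  have M_fi_K: "finite_index G M K" and M_fi_L: "finite_index G M L" using KL by (simp_all add: commensurate_def M_def)
  have Ms: "subgroup M G" by (rule dom.finite_index_subgroup[OF K M_fi_K])
  have Mcl: "closedin T M" unfolding M_def using K_closed L(2) by (rule closedin_Int)
  note LG = subgroup.subset[OF L(1)]
  have tLs: "subgroup (tld L) Gh" by (rule subgroup_tld[OF L(1)])
  interpret L: topological_group "G\<lparr>carrier := L\<rparr>" "subtopology T L"
    by (rule dom.topological_group_subgroup[OF L(1)])
  have M_sub: "M \<subseteq> L" by (simp add: M_def)
  show ?thesis
  proof (rule separating_completion.intro[OF dom.topological_group_axioms cod.topological_group_axioms],
      rule separating_completion_axioms.intro)
    show "commensurator G L = carrier G"
      using dom.commensurator_commensurate_eq[OF K L(1) KL] commensurated by simp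
    have "continuous_map (subtopology T M) Th \<theta>"
      using continuous_map_from_subtopology_mono[OF cont, of M] by (simp add: M_def)
    then have contM: "continuous_map (subtopology (subtopology T L) M) Th \<theta>"
      using M_sub by (simp add: subtopology_subtopology Int_absorb1)
    show "continuous_map (subtopology T L) Th \<theta>"
    proof (rule hom_continuous_if_continuous_on_open_subgroup[OF L.topological_group_axioms
          cod.topological_group_axioms _ _ _ contM])
      show "\<theta> \<in> hom (G\<lparr>carrier := L\<rparr>) Gh" by (intro homI) (simp_all add: subsetD[OF LG])
      show "subgroup M (G\<lparr>carrier := L\<rparr>)" by (rule dom.subgroup_incl[OF Ms L(1) M_sub])
      show "openin (subtopology T L) M" by (rule dom.finite_index_closed_imp_open[OF L(1) M_fi_L Mcl])
    qed
    show "openin Th (tld L)"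
      using cod.openin_if_contains_open_subgroup[OF tLs subgroup_tld[OF Ms] openin_tld[OF M_fi_K]]
        M_sub by (simp add: closure_of_mono image_mono)
    have "tld M \<subseteq> tld K" by (intro closure_of_mono image_mono) (simp add: M_def)
    then have "compactin Th (tld M)" using closed_compactin[OF compactin_tld_K] by simp
    then have "compactin Th (tld L)"
      by (rule cod.compactin_finite_index[OF tLs finite_index_tld[OF L(1) M_fi_L]])
    then show "profinite_group (Gh\<lparr>carrier := tld L\<rparr>) (subtopology Th (tld L))"
      by (rule cod.profinite_compact_subgroup[OF Hausdorff_cod totally_disconnected_cod tLs])
    fix N g
    assume N: "finite_index G N L" "closedin T N" and g: "g \<in> carrier G" "\<theta> g \<in> tld N"
    have "finite_index G (N \<inter> K) (L \<inter> K)" by (rule dom.finite_index_Int[OF L(1) N(1) K])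
    then have "finite_index G (N \<inter> K) K"
      using dom.finite_index_trans[OF K _ M_fi_K] by (simp add: M_def Int_commute)
    moreover have "closedin T (N \<inter> K)" using N(2) K_closed by (rule closedin_Int)
    ultimately show "g \<in> N"
      using mem_if_image_near_image[OF _ _ _ dom.finite_index_subgroup[OF L(1) N(1)] g] by blast
  qed (rule L hom dense)+
qed

text \<open>Since \<open>tld K\<close> is profinite, an element other than the identity is missed by some open subgroup \<open>V\<close> of
\<open>tld K\<close>, and \<open>\<theta>\<^sup>-\<^sup>1(V) \<inter> K\<close> is closed and of finite index in \<open>K\<close>.\<close>

theorem kernel_eq_Inter:
  "kernel G Gh \<theta> = \<Inter> {N. finite_index G N K \<and> closedin T N}"
proof
  show "kernel G Gh \<theta> \<subseteq> \<Inter> {N. finite_index G N K \<and> closedin T N}"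
  proof clarify
    fix g N assume g: "g \<in> kernel G Gh \<theta>" and N: "finite_index G N K" "closedin T N"
    have "subgroup N G" by (rule dom.finite_index_subgroup[OF K N(1)])
    then have "\<theta> g \<in> tld N" using g subgroup.one_closed[OF subgroup_tld] by (simp add: kernel_def)
    then show "g \<in> N" using separating[OF N] g by (simp add: kernel_def)
  qed
  show "\<Inter> {N. finite_index G N K \<and> closedin T N} \<subseteq> kernel G Gh \<theta>"
  proof
    fix g assume g: "g \<in> \<Inter> {N. finite_index G N K \<and> closedin T N}"
    then have gK: "g \<in> K" using dom.finite_index_refl[OF K] K_closed by blast
    then have gc: "g \<in> carrier G" using K_subset by blast
    have "\<theta> g = \<one>\<^bsub>Gh\<^esub>"
    proof (rule ccontr)
      assume ne: "\<theta> g \<noteq> \<one>\<^bsub>Gh\<^esub>"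
      have "closedin Th {\<theta> g}" using Hausdorff_cod gc by (intro closedin_Hausdorff_singleton) auto
      then have "openin Th (carrier Gh - {\<theta> g})"
        using openin_diff[OF openin_topspace, of Th "{\<theta> g}"] by simp
      moreover have "\<one>\<^bsub>Gh\<^esub> \<in> carrier Gh - {\<theta> g}" using ne by simp
      ultimately obtain V where V: "subgroup V Gh" "openin Th V" "V \<subseteq> carrier Gh - {\<theta> g}"
          "V \<subseteq> tld K" "finite_index Gh V (tld K)"
        using open_subgroup_base by metis
      have "finite_index G {k \<in> K. \<theta> k \<in> V} K"
        by (rule finite_index_vimage[OF dom.is_group cod.is_group hom subgroup_tld[OF K] V(5) K
              image_subset_tld[OF K_subset]])
      moreover have "closedin T {k \<in> K. \<theta> k \<in> V}"
        by (rule closedin_vimage_K[OF cod.open_subgroup_closed[OF V(1,2)]])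
      ultimately have "\<theta> g \<in> V" using g by blast
      then show False using V(3) by blast
    qed
    then show "g \<in> kernel G Gh \<theta>" using gc by (simp add: kernel_def)
  qed
qed

text \<open>By separation \<open>K\<close> is the full preimage of the open set \<open>tld K\<close>.\<close>

theorem continuous_iff_open: "continuous_map T Th \<theta> \<longleftrightarrow> openin T K"
proof
  assume "continuous_map T Th \<theta>"
  then have "openin T {g \<in> topspace T. \<theta> g \<in> tld K}"
    using openin_continuous_map_preimage open_closure by blast
  then show "openin T K" using vimage_tld[OF dom.finite_index_refl[OF K] K_closed] by simp
next
  assume "openin T K"
  then show "continuous_map T Th \<theta>"
    by (rule hom_continuous_if_continuous_on_open_subgroup[OF dom.topological_group_axioms
          cod.topological_group_axioms hom K _ cont])
qed

end

section \<open>Homomorphisms to totally disconnected, locally compact groups\<close>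

text \<open>Any two compact open subgroups are commensurate, an open subgroup of a compact group being of
finite index.\<close>

lemma (in topological_group) compact_open_subgroup_commensurated:
  assumes U: "subgroup U G" "openin T U" "compactin T U"
  shows "commensurator G U = carrier G"
proof -
  have fi: "finite_index G (A \<inter> B) A"
    if A: "subgroup A G" "compactin T A" and B: "subgroup B G" "openin T B" for A B
  proof -
    interpret A: topological_group "G\<lparr>carrier := A\<rparr>" "subtopology T A"
      by (rule topological_group_subgroup[OF A(1)])
    have "subgroup (A \<inter> B) (G\<lparr>carrier := A\<rparr>)"
      using subgroup_incl[OF subgroups_Inter_pair[OF A(1) B(1)] A(1)] by simp
    then show ?thesis
      using A.open_subgroup_finite_index openin_subtopology_Int2[OF B(2)] compact_space_subtopology[OF A(2)]
      by simp
  qed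
  have "commensurate G (conjugate G g U) U" if g: "g \<in> carrier G" for g
  proof -
    have c: "compactin T (conjugate G g U)" unfolding conjugate_eq_image
      by (rule image_compactin[OF U(3) continuous_conjugation]) (use g in auto)
    have "conjugate G g U = {x \<in> topspace T. inv g \<otimes> x \<otimes> g \<in> U}"
      using mem_conjugate_iff[OF g openin_carrier_subset[OF U(2)]] by auto
    then have o: "openin T (conjugate G g U)"
      using openin_continuous_map_preimage[OF continuous_conjugation U(2), of g "inv g"] g by simp
    show ?thesis
      unfolding commensurate_def
      using fi[OF conjugate_subgroup[OF g U(1)] c U(1,2)] fi[OF U(1,3) conjugate_subgroup[OF g U(1)] o]
      by (simp add: Int_commute)
  qed
  then show ?thesis by (auto simp: commensurator_def)
qed

lemma commensurator_vimage:
  assumes "group G" "group R" "\<phi> \<in> hom G R" and U: "subgroup U R" and comm: "commensurator R U = carrier R"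
  shows "commensurator G {g \<in> carrier G. \<phi> g \<in> U} = carrier G"
proof -
  interpret G: group G by fact
  interpret R: group R by fact
  interpret \<phi>: group_hom G R \<phi> using assms by (simp add: group_hom_def group_hom_axioms_def)
  define V where "V A = {g \<in> carrier G. \<phi> g \<in> A}" for A
  note UR = subgroup.subset[OF U]
  have V_sub: "subgroup (V A) G" if "subgroup A R" for A
    unfolding V_def using that
    by (intro G.subgroupI) (auto simp: subgroup.m_closed subgroup.m_inv_closed subgroup.one_closed
        intro!: exI[of _ "\<one>\<^bsub>G\<^esub>"])
  have fi: "finite_index G (V A \<inter> V B) (V B)" if B: "subgroup B R" and AB: "finite_index R (A \<inter> B) B" for A B
  proof -
    have "finite_index G {g \<in> V B. \<phi> g \<in> A \<inter> B} (V B)"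
      by (rule finite_index_vimage[OF assms(1-3) B AB V_sub[OF B]]) (auto simp: V_def)
    moreover have "{g \<in> V B. \<phi> g \<in> A \<inter> B} = V A \<inter> V B" by (auto simp: V_def)
    ultimately show ?thesis by simp
  qed
  have "commensurate G (conjugate G g (V U)) (V U)" if g: "g \<in> carrier G" for g
  proof -
    have eq: "conjugate G g (V U) = V (conjugate R (\<phi> g) U)"
    proof (rule Set.set_eqI)
      fix x
      have "V U \<subseteq> carrier G" by (auto simp: V_def)
      then have "x \<in> conjugate G g (V U) \<longleftrightarrow> x \<in> carrier G \<and> inv\<^bsub>G\<^esub> g \<otimes>\<^bsub>G\<^esub> x \<otimes>\<^bsub>G\<^esub> g \<in> V U"
        by (rule G.mem_conjugate_iff[OF g])
      also have "\<dots> \<longleftrightarrow> x \<in> carrier G \<and> inv\<^bsub>R\<^esub> \<phi> g \<otimes>\<^bsub>R\<^esub> \<phi> x \<otimes>\<^bsub>R\<^esub> \<phi> g \<in> U"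
        using g by (auto simp: V_def)
      also have "\<dots> \<longleftrightarrow> x \<in> V (conjugate R (\<phi> g) U)"
        using R.mem_conjugate_iff[OF _ UR, of "\<phi> g" "\<phi> x"] g by (auto simp: V_def)
      finally show "x \<in> conjugate G g (V U) \<longleftrightarrow> x \<in> V (conjugate R (\<phi> g) U)" .
    qed
    have "\<phi> g \<in> commensurator R U" using comm g by simp
    then have "commensurate R (conjugate R (\<phi> g) U) U" by (simp add: commensurator_def)
    then show ?thesis
      unfolding eq commensurate_def
      using fi[OF U, of "conjugate R (\<phi> g) U"] fi[OF R.conjugate_subgroup[OF _ U, of "\<phi> g"], of U] g
      by (simp add: Int_commute)
  qed
  then show ?thesis unfolding V_def by (auto simp: commensurator_def)
qed

text \<open>Connected components are closed, so points are closed.\<close>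

lemma (in topological_group) Hausdorff_if_totally_disconnected:
  assumes "totally_disconnected_space T"
  shows "Hausdorff_space T"
proof (rule Hausdorff_if_closed_one)
  show "closedin T {\<one>}"
    using closedin_connected_component_of[of T \<one>] assms by (simp add: totally_disconnected_space_def)
qed

theorem (in separating_completion) factors_through_completion:
  assumes R: "tdlc_group R S" and \<phi>: "\<phi> \<in> hom G R"
    and U: "subgroup U R" "compactin S U" "\<phi> ` K \<subseteq> U"
    and cont_K: "continuous_map (subtopology T K) S \<phi>"
  shows "\<exists>!\<psi>. extends R S \<phi> \<psi>"
proof -
  interpret R: topological_group R S using R by (simp add: tdlc_group_def)
  interpret \<phi>: group_hom G R \<phi> using \<phi> by unfold_locales
  have td: "totally_disconnected_space S" using R by (simp add: tdlc_group_def)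
  have haus: "Hausdorff_space S" by (rule R.Hausdorff_if_totally_disconnected[OF td])
  have "closedin S U" by (rule compactin_imp_closedin[OF haus U(2)])
  then have "S closure_of (\<phi> ` K) \<subseteq> U" using U(3) by (simp add: closure_of_minimal)
  then have "compactin S (S closure_of (\<phi> ` K))" using closed_compactin[OF U(2)] by simp
  then have "profinite_group (R\<lparr>carrier := S closure_of (\<phi> ` K)\<rparr>) (subtopology S (S closure_of (\<phi> ` K)))"
    by (intro R.profinite_compact_subgroup haus td R.subgroup_closure_of \<phi>.subgroup_img_is_subgroup K)
  then show ?thesis using extension_unique_exists[OF R.topological_group_axioms \<phi> cont_K] by blast
qed

section \<open>Completion at a profinite subgroup\<close>

text \<open>The identity map is a homomorphism that is continuous on the open subgroup \<open>K\<close>, in both directions.\<close>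

lemma group_topology_eq_if_open_subgroup:
  assumes "topological_group G S" "topological_group G S'" "subgroup K G"
    and "openin S K" "openin S' K" "subtopology S K = subtopology S' K"
  shows "S = S'"
proof -
  have id: "continuous_map A B id"
    if "topological_group G A" "topological_group G B" "openin A K" "subtopology A K = subtopology B K" for A B
  proof (rule hom_continuous_if_continuous_on_open_subgroup[OF that(1,2) _ assms(3) that(3)])
    show "id \<in> hom G G" by (simp add: hom_def)
    show "continuous_map (subtopology A K) B id" unfolding that(4) by simp
  qed
  have "homeomorphic_map S S' id"
    using id[OF assms(1,2,4,6)] id[OF assms(2,1,5) assms(6)[symmetric]]
    by (auto simp: homeomorphic_map_maps homeomorphic_maps_def intro!: exI[of _ id])
  then show ?thesis by simp
qed

context separating_completion
begin

context
  assumes profinite_K: "profinite_group (G\<lparr>carrier := K\<rparr>) (subtopology T K)"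
begin

lemma compactin_K: "compactin T K"
  using profinite_K K_subset by (simp add: profinite_group_def compactin_subspace)

lemma tld_K_eq: "tld K = \<theta> ` K"
proof -
  have "compactin (subtopology T K) K" using compactin_K by (simp add: compactin_subtopology)
  then have "compactin Th (\<theta> ` K)" using image_compactin cont by blast
  then have "closedin Th (\<theta> ` K)" by (rule compactin_imp_closedin[OF Hausdorff_cod])
  then show ?thesis by (rule closure_of_closedin)
qed

text \<open>The open subgroups of a profinite group \<open>K\<close> are closed of finite index and intersect trivially.\<close>

lemma kernel_trivial: "kernel G Gh \<theta> = {\<one>\<^bsub>G\<^esub>}"
proof -
  interpret K: topological_group "G\<lparr>carrier := K\<rparr>" "subtopology T K"
    using profinite_K by (simp add: profinite_group_def)
  have pf: "compact_space (subtopology T K)" "Hausdorff_space (subtopology T K)"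
      "totally_disconnected_space (subtopology T K)"
    using profinite_K by (simp_all add: profinite_group_def)
  have "g = \<one>\<^bsub>G\<^esub>" if g: "\<And>N. finite_index G N K \<Longrightarrow> closedin T N \<Longrightarrow> g \<in> N" for g
  proof (rule ccontr)
    assume ne: "g \<noteq> \<one>\<^bsub>G\<^esub>"
    have gK: "g \<in> K" using g dom.finite_index_refl[OF K] K_closed by blast
    have "closedin (subtopology T K) {g}"
      using pf(2) gK K_subset by (intro closedin_Hausdorff_singleton) auto
    then have "openin (subtopology T K) (K - {g})"
      using openin_diff[OF openin_topspace, of "subtopology T K" "{g}"] K_subset by (simp add: Int_absorb1)
    moreover have "\<one>\<^bsub>G\<lparr>carrier := K\<rparr>\<^esub> \<in> K - {g}" using ne subgroup.one_closed[OF K] by simp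
    ultimately obtain V where V: "subgroup V (G\<lparr>carrier := K\<rparr>)" "openin (subtopology T K) V" "V \<subseteq> K - {g}"
      using K.profinite_open_subgroup_base[OF pf] by metis
    have "finite_index G V K" using K.open_subgroup_finite_index[OF V(1,2) pf(1)] by simp
    moreover have "closedin T V"
      using K.open_subgroup_closed[OF V(1,2)] K_closed by (rule closedin_trans_full)
    ultimately show False using g V(3) by blast
  qed
  then have "kernel G Gh \<theta> \<subseteq> {\<one>\<^bsub>G\<^esub>}" unfolding kernel_eq_Inter by blast
  then show ?thesis by (auto simp: kernel_def)
qed

text \<open>Surjectivity: the image of \<open>K\<close> is compact, hence equal to the open subgroup \<open>tld K\<close>, and \<open>\<theta>(G)\<close> meets
every coset of \<open>tld K\<close> by density.\<close>

lemma iso_if_profinite: "\<theta> \<in> iso G Gh"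
proof -
  have "inj_on \<theta> (carrier G)" using kernel_trivial inj_iff_trivial_ker by simp
  moreover have "carrier Gh \<subseteq> \<theta> ` carrier G"
  proof
    fix x assume "x \<in> carrier Gh"
    then obtain g k where "g \<in> carrier G" "k \<in> K" "x = \<theta> g \<otimes>\<^bsub>Gh\<^esub> \<theta> k"
      using dense_decomposition[OF subgroup_tld[OF K] open_closure] tld_K_eq by (metis imageE)
    then have "x = \<theta> (g \<otimes>\<^bsub>G\<^esub> k)" "g \<otimes>\<^bsub>G\<^esub> k \<in> carrier G" using K_subset by auto
    then show "x \<in> \<theta> ` carrier G" by blast
  qed
  ultimately show ?thesis using hom by (auto simp: iso_def bij_betw_def)
qed

text \<open>On \<open>tld K\<close> this is the inverse of a continuous bijection from a compact to a Hausdorff space.\<close>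

lemma continuous_inverse: "continuous_map Th T (inv_into (carrier G) \<theta>)"
proof -
  let ?i = "inv_into (carrier G) \<theta>"
  have bij: "bij_betw \<theta> (carrier G) (carrier Gh)" using iso_if_profinite by (simp add: iso_def)
  have i\<theta>: "?i (\<theta> g) = g" if "g \<in> carrier G" for g
    using bij that by (simp add: bij_betw_def inv_into_f_f)
  have hom_i: "?i \<in> hom Gh G"
    using dom.iso_set_sym[OF iso_if_profinite] by (simp add: iso_def)
  have "continuous_map (subtopology Th (tld K)) T ?i"
    unfolding continuous_map_closedin
  proof (intro conjI allI impI)
    show "?i \<in> topspace (subtopology Th (tld K)) \<rightarrow> topspace T"
      using bij_betw_inv_into[OF bij] by (auto simp: bij_betw_def)
    fix C assume C: "closedin T C"
    have "compactin T (C \<inter> K)" using C compactin_K by (rule closed_Int_compactin)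
    then have "compactin (subtopology T K) (C \<inter> K)" by (simp add: compactin_subtopology)
    then have "compactin Th (\<theta> ` (C \<inter> K))" using image_compactin cont by blast
    then have "closedin Th (\<theta> ` (C \<inter> K))" by (rule compactin_imp_closedin[OF Hausdorff_cod])
    then have "closedin (subtopology Th (tld K)) (\<theta> ` (C \<inter> K))"
      unfolding tld_K_eq by (rule closedin_subset_topspace) auto
    moreover have "{x \<in> topspace (subtopology Th (tld K)). ?i x \<in> C} = \<theta> ` (C \<inter> K)"
      unfolding tld_K_eq using i\<theta> subsetD[OF K_subset] by auto
    ultimately show "closedin (subtopology Th (tld K)) {x \<in> topspace (subtopology Th (tld K)). ?i x \<in> C}"
      by simp
  qed
  then show ?thesis
    by (rule hom_continuous_if_continuous_on_open_subgroup[OF cod.topological_group_axioms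
          dom.topological_group_axioms hom_i subgroup_tld[OF K] open_closure])
qed

text \<open>The topology pulled back along the bijection \<open>\<theta>\<close> has the two properties that characterise the
localisation.\<close>

theorem localised_topology_via_completion:
  defines "S \<equiv> (THE S. topological_group G S \<and> openin S K \<and> subtopology S K = subtopology T K)"
  shows "topological_group_iso G S Gh Th \<theta>"
proof -
  let ?i = "inv_into (carrier G) \<theta>"
  define S0 where "S0 = pullback_topology (carrier G) \<theta> Th"
  have bij: "bij_betw \<theta> (carrier G) (carrier Gh)" using iso_if_profinite by (simp add: iso_def)
  have top: "topspace S0 = carrier G" by (auto simp: S0_def topspace_pullback_topology)
  have c\<theta>: "continuous_map S0 Th \<theta>"
    using continuous_map_pullback[of Th Th id "carrier G" \<theta>] by (simp add: S0_def)
  have into: "continuous_map X S0 f"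
    if "continuous_map X Th (\<lambda>x. \<theta> (f x))" "\<And>x. x \<in> topspace X \<Longrightarrow> f x \<in> carrier G" for X :: "'z topology" and f
    unfolding S0_def
    by (rule continuous_map_pullback') (use that in \<open>auto simp: o_def\<close>)
  have grp: "topological_group G S0"
  proof unfold_locales
    show "topspace S0 = carrier G" by (rule top)
    have "continuous_map (prod_topology S0 S0) Th (\<lambda>z. \<theta> (fst z) \<otimes>\<^bsub>Gh\<^esub> \<theta> (snd z))"
      by (intro cod.continuous_map_mult continuous_map_compose[OF continuous_map_fst c\<theta>, unfolded o_def]
          continuous_map_compose[OF continuous_map_snd c\<theta>, unfolded o_def])
    then have "continuous_map (prod_topology S0 S0) Th (\<lambda>z. \<theta> (case z of (x, y) \<Rightarrow> x \<otimes>\<^bsub>G\<^esub> y))"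
      by (rule continuous_map_eq) (auto simp: top)
    then show "continuous_map (prod_topology S0 S0) S0 (\<lambda>(x, y). x \<otimes>\<^bsub>G\<^esub> y)"
      by (rule into) (auto simp: top)
    have "continuous_map S0 Th (\<lambda>x. inv\<^bsub>Gh\<^esub> \<theta> x)" by (rule cod.continuous_map_inverse[OF c\<theta>])
    then have "continuous_map S0 Th (\<lambda>x. \<theta> (inv\<^bsub>G\<^esub> x))"
      by (rule continuous_map_eq) (auto simp: top)
    then show "continuous_map S0 S0 (\<lambda>x. inv\<^bsub>G\<^esub> x)" by (rule into) (auto simp: top)
  qed
  have "openin S0 {g \<in> topspace S0. \<theta> g \<in> tld K}"
    by (rule openin_continuous_map_preimage[OF c\<theta> open_closure])
  then have op: "openin S0 K"
    using vimage_tld[OF dom.finite_index_refl[OF K] K_closed] by (simp add: top)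
  have "continuous_map (subtopology T K) S0 id"
    by (rule into) (use cont K_subset in auto)
  then have 1: "continuous_map (subtopology T K) (subtopology S0 K) id"
    by (simp add: continuous_map_in_subtopology)
  have "continuous_map S0 T (\<lambda>x. ?i (\<theta> x))"
    using continuous_map_compose[OF c\<theta> continuous_inverse] by (simp add: o_def)
  then have "continuous_map S0 T id"
    by (rule continuous_map_eq) (use bij in \<open>auto simp: top bij_betw_def inv_into_f_f\<close>)
  then have 2: "continuous_map (subtopology S0 K) (subtopology T K) id"
    by (simp add: continuous_map_in_subtopology continuous_map_from_subtopology)
  have "homeomorphic_map (subtopology T K) (subtopology S0 K) id"
    using 1 2 by (auto simp: homeomorphic_map_maps homeomorphic_maps_def intro!: exI[of _ id])
  then have sub: "subtopology S0 K = subtopology T K" by simp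
  have "S = S0"
    unfolding S_def
  proof (rule the_equality)
    show "topological_group G S0 \<and> openin S0 K \<and> subtopology S0 K = subtopology T K"
      using grp op sub by blast
    show "S' = S0" if "topological_group G S' \<and> openin S' K \<and> subtopology S' K = subtopology T K" for S'
      using group_topology_eq_if_open_subgroup[OF _ grp K _ op] that sub by simp
  qed
  have "continuous_map Th S0 ?i"
  proof (rule into)
    show "continuous_map Th Th (\<lambda>x. \<theta> (?i x))"
      by (rule continuous_map_eq[OF continuous_map_id])
        (use bij in \<open>auto simp: bij_betw_def f_inv_into_f\<close>)
    show "?i x \<in> carrier G" if "x \<in> topspace Th" for x
      using that bij_betw_inv_into[OF bij] by (auto simp: bij_betw_def)
  qed
  then have "homeomorphic_maps S0 Th \<theta> ?i"
    using c\<theta> bij by (auto simp: homeomorphic_maps_def top bij_betw_def inv_into_f_f f_inv_into_f)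
  then have "homeomorphic_map S0 Th \<theta>" using homeomorphic_map_maps by blast
  then show ?thesis using iso_if_profinite \<open>S = S0\<close> by (simp add: topological_group_iso_def)
qed

theorem topological_iso_if_open:
  assumes "openin T K"
  shows "topological_group_iso G T Gh Th \<theta>"
proof -
  have bij: "bij_betw \<theta> (carrier G) (carrier Gh)" using iso_if_profinite by (simp add: iso_def)
  have "homeomorphic_maps T Th \<theta> (inv_into (carrier G) \<theta>)"
    using continuous_iff_open assms continuous_inverse bij
    by (auto simp: homeomorphic_maps_def bij_betw_def inv_into_f_f f_inv_into_f)
  then have "homeomorphic_map T Th \<theta>" using homeomorphic_map_maps by blast
  then show ?thesis using iso_if_profinite by (simp add: topological_group_iso_def)
qed

end

section \<open>The quotient map onto the closure of the coset action\<close>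

text \<open>The map \<open>\<eta>\<close> is the extension of the action on \<open>G/K\<close>.  The closure \<open>P\<close> of the image of \<open>K\<close> is the
stabiliser of the coset \<open>K\<close>, hence open, and \<open>\<eta>\<close> maps the compact group \<open>tld K\<close> onto \<open>P\<close>.  An open
subgroup of \<open>tld K\<close> has finite index, so its image is compact and of finite index in \<open>P\<close>, hence open;
thus \<open>\<eta>\<close> is open.  Its image is an open subgroup, hence closed, and it is dense.  Finally
\<open>\<eta>\<^sup>-\<^sup>1(P) = tld K\<close>, so that the kernel, which consists of the elements that fix all cosets \<open>a K\<close>, is
the intersection of the conjugates of \<open>tld K\<close>.\<close>

theorem quotient_onto_coset_closure:
  obtains \<eta> where "\<eta> \<in> hom Gh (coset_closure G K)"
    "continuous_map Th (coset_closure_topology G K) \<eta>"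
    "open_map Th (coset_closure_topology G K) \<eta>"
    "\<eta> ` carrier Gh = carrier (coset_closure G K)"
    "kernel Gh (coset_closure G K) \<eta> = (\<Inter>x \<in> carrier Gh. conjugate Gh x (tld K))"
    "\<And>g. g \<in> carrier G \<Longrightarrow> coset_action G K g = \<eta> (\<theta> g)"
proof -
  let ?X = "lcosets\<^bsub>G\<^esub> K"
  let ?S0 = "pointwise_topology ?X" and ?B = "BijGroup ?X"
  let ?\<tau> = "coset_action G K"
  define A where "A = ?S0 closure_of (?\<tau> ` carrier G)"
  define R where "R = coset_closure G K"
  define S where "S = coset_closure_topology G K"
  interpret B: topological_group ?B ?S0 by (rule topological_group_BijGroup)
  have \<tau>B: "?\<tau> \<in> hom G ?B" by (rule dom.coset_action_hom[OF K_subset])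
  interpret \<tau>B: group_hom G ?B ?\<tau> using \<tau>B by unfold_locales
  have As: "subgroup A ?B" unfolding A_def by (intro B.subgroup_closure_of \<tau>B.img_is_subgroup)
  have R_eq: "R = ?B\<lparr>carrier := A\<rparr>" by (simp add: R_def coset_closure_def A_def)
  have S_eq: "S = subtopology ?S0 A" by (simp add: S_def coset_closure_topology_def coset_closure_def A_def)
  have R: "topological_group R S" unfolding R_eq S_eq by (rule B.topological_group_subgroup[OF As])
  interpret R: topological_group R S by (rule R)
  have cR: "carrier R = A" by (simp add: R_eq)
  have AB: "A \<subseteq> Bij ?X" using subgroup.subset[OF As] by simp
  have \<tau>A: "?\<tau> ` carrier G \<subseteq> A" unfolding A_def
    by (rule closure_of_subset) (use hom_in_carrier[OF \<tau>B] in auto)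
  have \<tau>: "?\<tau> \<in> hom G R"
    using \<tau>A \<tau>B.hom_mult by (intro homI) (auto simp: R_eq)
  interpret \<tau>: group_hom G R ?\<tau> using \<tau> by unfold_locales
  have fi: "finite_index G K K" by (rule dom.finite_index_refl[OF K])
  have \<tau>_cont: "continuous_map (subtopology T K) S ?\<tau>"
    unfolding S_eq
    using dom.coset_action_continuous[OF K K_closed commensurated fi K_closed] \<tau>A K_subset
    by (auto simp: continuous_map_in_subtopology)
  define P where "P = ?S0 closure_of (?\<tau> ` K)"
  have PA: "P \<subseteq> A" unfolding P_def A_def using K_subset by (intro closure_of_mono image_mono)
  have "?\<tau> ` K \<subseteq> A" using \<tau>A K_subset by blast
  then have P_eq: "S closure_of (?\<tau> ` K) = P"
    using PA unfolding S_eq P_def by (simp add: closure_of_subtopology Int_absorb1)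
  have Ps: "subgroup P R" unfolding P_eq[symmetric] by (intro R.subgroup_closure_of \<tau>.subgroup_img_is_subgroup K)
  have RP: "R\<lparr>carrier := P\<rparr> = ?B\<lparr>carrier := P\<rparr>" by (simp add: R_eq)
  have SP: "subtopology S P = subtopology ?S0 P"
    using PA by (simp add: S_eq subtopology_subtopology Int_absorb1)
  have prof: "profinite_group (R\<lparr>carrier := S closure_of (?\<tau> ` K)\<rparr>) (subtopology S (S closure_of (?\<tau> ` K)))"
    unfolding P_eq RP SP unfolding P_def
    by (rule dom.coset_action_closure_profinite[OF K commensurated fi])
  obtain \<eta> where \<eta>: "\<eta> \<in> hom Gh R" "continuous_map Th S \<eta>" "\<And>g. g \<in> carrier G \<Longrightarrow> ?\<tau> g = \<eta> (\<theta> g)"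
    using extension_exists(2)[OF R \<tau> \<tau>_cont prof] by blast
  have hausS: "Hausdorff_space S" by (rule extension_exists(1)[OF R \<tau> \<tau>_cont prof])
  interpret \<eta>: group_hom Gh R \<eta> using \<eta>(1) by unfold_locales

  have KX: "K \<in> ?X" using dom.l_coset_in_lcosets[OF dom.one_closed, of K] dom.lcos_mult_one[OF K_subset] by simp
  have fixes_K: "?\<tau> g K = K \<longleftrightarrow> g \<in> K" if "g \<in> carrier G" for g
    using dom.coset_action_fixes_iff[OF K that dom.one_closed] dom.lcos_mult_one[OF K_subset]
      dom.conjugate_one[OF K_subset] by simp
  have stab: "P = {f \<in> A. f K = K}"
  proof
    have "?\<tau> ` K \<subseteq> {f \<in> Bij ?X. f K = K}"
      using fixes_K hom_in_carrier[OF \<tau>B] subsetD[OF K_subset] by (simp add: image_subset_iff)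
    then have "P \<subseteq> {f \<in> Bij ?X. f K = K}"
      unfolding P_def by (rule closure_of_minimal[OF _ closedin_pointwise_eval[OF KX]])
    then show "P \<subseteq> {f \<in> A. f K = K}" using PA by blast
    show "{f \<in> A. f K = K} \<subseteq> P"
    proof clarify
      fix f assume f: "f \<in> A" "f K = K"
      show "f \<in> P"
        unfolding P_def in_closure_of
      proof (intro conjI allI impI)
        show "f \<in> topspace ?S0" using f AB by auto
        fix W assume W: "f \<in> W \<and> openin ?S0 W"
        (* Members of tau(G) near f stabilise K as f does, and those in tau(G) that stabilise K lie in tau(K). *)
        have "openin ?S0 (W \<inter> {f \<in> Bij ?X. f K = K})"
          using W by (intro openin_Int openin_pointwise_eval KX) auto
        moreover have "f \<in> W \<inter> {f \<in> Bij ?X. f K = K}" using W f AB by auto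
        ultimately obtain h where "h \<in> ?\<tau> ` carrier G" "h \<in> W \<inter> {f \<in> Bij ?X. f K = K}"
          using f(1) unfolding A_def in_closure_of by meson
        then show "\<exists>h. h \<in> ?\<tau> ` K \<and> h \<in> W" using fixes_K by blast
      qed
    qed
  qed
  have "openin S (A \<inter> {f \<in> Bij ?X. f K = K})"
    unfolding S_eq by (rule openin_subtopology_Int2[OF openin_pointwise_eval[OF KX]])
  moreover have "A \<inter> {f \<in> Bij ?X. f K = K} = P" using stab AB by auto
  ultimately have Pop: "openin S P" by simp

  have \<eta>K: "\<eta> ` tld K = P"
  proof
    have "\<eta> ` tld K \<subseteq> S closure_of (\<eta> ` \<theta> ` K)" by (rule continuous_map_image_closure_subset[OF \<eta>(2)])
    also have "\<eta> ` \<theta> ` K = ?\<tau> ` K" unfolding image_image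
      by (rule image_cong) (simp_all add: \<eta>(3)[symmetric] subsetD[OF K_subset])
    finally show "\<eta> ` tld K \<subseteq> P" using P_eq by simp
    have "compactin S (\<eta> ` tld K)" by (rule image_compactin[OF compactin_tld_K \<eta>(2)])
    then have "closedin S (\<eta> ` tld K)" by (rule compactin_imp_closedin[OF hausS])
    moreover have "?\<tau> ` K \<subseteq> \<eta> ` tld K" using \<eta>(3) image_subset_tld[OF K_subset] K_subset by blast
    ultimately show "P \<subseteq> \<eta> ` tld K" unfolding P_eq[symmetric] by (simp add: closure_of_minimal)
  qed
  have open_image: "openin S (\<eta> ` V)"
    if V: "subgroup V Gh" "openin Th V" "V \<subseteq> tld K" "finite_index Gh V (tld K)" for V
  proof -
    have "finite_index R (\<eta> ` V) P"
      unfolding \<eta>K[symmetric]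
      by (rule finite_index_image[OF cod.is_group R.is_group \<eta>(1) subgroup_tld[OF K] V(4)])
    moreover have "compactin Th V"
      by (rule closed_compactin[OF compactin_tld_K V(3) cod.open_subgroup_closed[OF V(1,2)]])
    then have "closedin S (\<eta> ` V)"
      by (rule compactin_imp_closedin[OF hausS image_compactin[OF _ \<eta>(2)]])
    ultimately have "openin (subtopology S P) (\<eta> ` V)"
      by (rule R.finite_index_closed_imp_open[OF Ps])
    then show ?thesis using Pop openin_trans_full by blast
  qed
  have open_map: "open_map Th S \<eta>"
    unfolding open_map_def
  proof (intro allI impI)
    fix W assume W: "openin Th W"
    note WG = cod.openin_carrier_subset[OF W]
    show "openin S (\<eta> ` W)"
    proof (subst openin_subopen, intro ballI)
      fix y assume "y \<in> \<eta> ` W"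
      then obtain x where x: "x \<in> W" "y = \<eta> x" by blast
      then have xc: "x \<in> carrier Gh" using WG by blast
      have "openin Th (inv\<^bsub>Gh\<^esub> x <#\<^bsub>Gh\<^esub> W)" by (rule cod.openin_l_coset[OF cod.inv_closed[OF xc] W])
      moreover have "\<one>\<^bsub>Gh\<^esub> \<in> inv\<^bsub>Gh\<^esub> x <#\<^bsub>Gh\<^esub> W"
        using cod.mem_l_coset_iff[OF cod.inv_closed[OF xc] WG] x xc by simp
      ultimately obtain V where V: "subgroup V Gh" "openin Th V" "V \<subseteq> inv\<^bsub>Gh\<^esub> x <#\<^bsub>Gh\<^esub> W"
          "V \<subseteq> tld K" "finite_index Gh V (tld K)"
        using open_subgroup_base by metis
      have "openin S (y <#\<^bsub>R\<^esub> \<eta> ` V)"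
        using R.openin_l_coset open_image[OF V(1,2,4,5)] x xc by simp
      moreover have "y \<in> y <#\<^bsub>R\<^esub> \<eta> ` V"
        using R.lcos_self[OF _ \<eta>.subgroup_img_is_subgroup[OF V(1)]] x xc by simp
      moreover have "y <#\<^bsub>R\<^esub> \<eta> ` V \<subseteq> \<eta> ` W"
      proof
        fix z assume "z \<in> y <#\<^bsub>R\<^esub> \<eta> ` V"
        then obtain v where v: "v \<in> V" "z = \<eta> x \<otimes>\<^bsub>R\<^esub> \<eta> v" using x by (auto simp: l_coset_def)
        have vc: "v \<in> carrier Gh" using v(1) subgroup.subset[OF V(1)] by blast
        have "v \<in> inv\<^bsub>Gh\<^esub> x <#\<^bsub>Gh\<^esub> W" using v(1) V(3) by blast
        then have "x \<otimes>\<^bsub>Gh\<^esub> v \<in> W" using cod.mem_l_coset_iff[OF cod.inv_closed[OF xc] WG] xc by simp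
        moreover have "z = \<eta> (x \<otimes>\<^bsub>Gh\<^esub> v)" using v xc vc by simp
        ultimately show "z \<in> \<eta> ` W" by blast
      qed
      ultimately show "\<exists>Z. openin S Z \<and> y \<in> Z \<and> Z \<subseteq> \<eta> ` W" by blast
    qed
  qed
  have surj: "\<eta> ` carrier Gh = A"
  proof
    show "\<eta> ` carrier Gh \<subseteq> A" using \<eta>.hom_closed cR by blast
    have "P \<subseteq> \<eta> ` carrier Gh" unfolding \<eta>K[symmetric] using tld_subset by (rule image_mono)
    then have "openin S (\<eta> ` carrier Gh)"
      by (rule R.openin_if_contains_open_subgroup[OF \<eta>.img_is_subgroup Ps Pop])
    then have "closedin S (\<eta> ` carrier Gh)" by (rule R.open_subgroup_closed[OF \<eta>.img_is_subgroup])
    moreover have "?\<tau> ` carrier G \<subseteq> \<eta> ` carrier Gh" using \<eta>(3) hom_closed by blast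
    moreover have "S closure_of (?\<tau> ` carrier G) = A"
      using \<tau>A unfolding S_eq by (simp add: closure_of_subtopology Int_absorb1 A_def)
    ultimately show "A \<subseteq> \<eta> ` carrier Gh" by (metis closure_of_minimal)
  qed
  have vimage_P: "x \<in> tld K" if x: "x \<in> carrier Gh" "\<eta> x \<in> P" for x
  proof -
    obtain g v where gv: "g \<in> carrier G" "v \<in> tld K" "x = \<theta> g \<otimes>\<^bsub>Gh\<^esub> v"
      using dense_decomposition[OF subgroup_tld[OF K] open_closure x(1)] by metis
    have vc: "v \<in> carrier Gh" using gv(2) tld_subset by blast
    have "\<eta> x \<otimes>\<^bsub>R\<^esub> inv\<^bsub>R\<^esub> \<eta> v \<in> P"
      using x(2) gv(2) \<eta>K subgroup.m_closed[OF Ps] subgroup.m_inv_closed[OF Ps] by blast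
    moreover have "\<eta> x \<otimes>\<^bsub>R\<^esub> inv\<^bsub>R\<^esub> \<eta> v = ?\<tau> g"
      using gv vc \<eta>(3) by (simp add: R.m_assoc)
    ultimately have "?\<tau> g K = K" using stab by auto
    then have "\<theta> g \<in> tld K" using fixes_K[OF gv(1)] image_subset_tld[OF K_subset] by blast
    then show ?thesis using gv subgroup.m_closed[OF subgroup_tld[OF K]] by blast
  qed
  have ker: "kernel Gh R \<eta> = (\<Inter>x \<in> carrier Gh. conjugate Gh x (tld K))"
  proof
    show "kernel Gh R \<eta> \<subseteq> (\<Inter>x \<in> carrier Gh. conjugate Gh x (tld K))"
    proof clarify
      fix z x assume z: "z \<in> kernel Gh R \<eta>" and x: "x \<in> carrier Gh"
      have zc: "z \<in> carrier Gh" "\<eta> z = \<one>\<^bsub>R\<^esub>" using z by (auto simp: kernel_def)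
      have "\<eta> (inv\<^bsub>Gh\<^esub> x \<otimes>\<^bsub>Gh\<^esub> z \<otimes>\<^bsub>Gh\<^esub> x) = \<one>\<^bsub>R\<^esub>" using zc x by simp
      then have "inv\<^bsub>Gh\<^esub> x \<otimes>\<^bsub>Gh\<^esub> z \<otimes>\<^bsub>Gh\<^esub> x \<in> tld K"
        using vimage_P subgroup.one_closed[OF Ps] zc x by simp
      then show "z \<in> conjugate Gh x (tld K)" using cod.mem_conjugate_iff[OF x tld_subset] zc by simp
    qed
    show "(\<Inter>x \<in> carrier Gh. conjugate Gh x (tld K)) \<subseteq> kernel Gh R \<eta>"
    proof
      fix z assume z: "z \<in> (\<Inter>x \<in> carrier Gh. conjugate Gh x (tld K))"
      then have zx: "z \<in> carrier Gh" "\<And>x. x \<in> carrier Gh \<Longrightarrow> inv\<^bsub>Gh\<^esub> x \<otimes>\<^bsub>Gh\<^esub> z \<otimes>\<^bsub>Gh\<^esub> x \<in> tld K"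
        using cod.mem_conjugate_iff[OF _ tld_subset] cod.one_closed by blast+
      have \<eta>z: "\<eta> z \<in> A" using zx(1) \<eta>.hom_closed cR by blast
      have "\<eta> z = \<one>\<^bsub>R\<^esub>"
      proof (rule extensionalityI[where A = ?X])
        show "\<eta> z \<in> extensional ?X" using \<eta>z AB Bij_imp_extensional[of "\<eta> z" ?X] by blast
        show "\<one>\<^bsub>R\<^esub> \<in> extensional ?X" by (simp add: R_eq one_BijGroup)
        fix C assume C: "C \<in> ?X"
        then obtain a where a: "a \<in> carrier G" "C = a <#\<^bsub>G\<^esub> K" by (rule dom.lcosetsE)
        define h where "h = inv\<^bsub>Gh\<^esub> \<theta> a \<otimes>\<^bsub>Gh\<^esub> z \<otimes>\<^bsub>Gh\<^esub> \<theta> a"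
        have hc: "h \<in> carrier Gh" using zx a by (simp add: h_def)
        have "h \<in> tld K" using zx(2)[of "\<theta> a"] a by (simp add: h_def)
        then have "\<eta> h \<in> P" using \<eta>K by blast
        then have hK: "\<eta> h K = K" using stab by blast
        have "\<eta> z \<otimes>\<^bsub>R\<^esub> ?\<tau> a = ?\<tau> a \<otimes>\<^bsub>R\<^esub> \<eta> h"
        proof -
          have "z \<otimes>\<^bsub>Gh\<^esub> \<theta> a = \<theta> a \<otimes>\<^bsub>Gh\<^esub> h" using zx a by (simp add: h_def cod.group_normalise)
          then have "\<eta> (z \<otimes>\<^bsub>Gh\<^esub> \<theta> a) = \<eta> (\<theta> a \<otimes>\<^bsub>Gh\<^esub> h)" by simp
          then show ?thesis using zx a hc \<eta>(3) by simp
        qed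
        then have "compose ?X (\<eta> z) (?\<tau> a) K = compose ?X (?\<tau> a) (\<eta> h) K"
          using AB \<eta>z \<eta>.hom_closed[OF hc] \<tau>A a(1) cR by (simp add: R_eq mult_BijGroup subset_iff image_subset_iff)
        then have "\<eta> z (?\<tau> a K) = ?\<tau> a K" using KX hK by (simp add: compose_eq)
        moreover have "?\<tau> a K = C"
          using a KX by (simp add: coset_action_def)
        ultimately show "\<eta> z C = \<one>\<^bsub>R\<^esub> C" using C by (simp add: R_eq one_BijGroup)
      qed
      then show "z \<in> kernel Gh R \<eta>" using zx(1) by (simp add: kernel_def)
    qed
  qed
  show ?thesis
    by (rule that[of \<eta>, folded R_def S_def])
      (use \<eta> open_map surj cR ker in auto)
qed

end

section \<open>The profinite completion as an inverse limit\<close>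

lemma topological_group_discrete:
  assumes "group H"
  shows "topological_group H (discrete_topology (carrier H))"
proof -
  interpret group H by fact
  show ?thesis
    by unfold_locales (auto simp: prod_topology_discrete_topology[symmetric])
qed

lemma topological_group_product_group:
  assumes H: "\<And>i. i \<in> I \<Longrightarrow> topological_group (H i) (X i)"
  shows "topological_group (product_group I H) (product_topology X I)"
proof -
  have grp: "group (H i)" if "i \<in> I" for i using H[OF that] by (simp add: topological_group_def)
  interpret P: group "product_group I H" using grp by simp
  let ?Q = "product_topology X I"
  have proj: "continuous_map ?Q (X i) (\<lambda>x. x i)" if "i \<in> I" for i
    by (rule continuous_map_product_projection[OF that])
  show ?thesis
  proof unfold_locales
    have "topspace (X i) = carrier (H i)" if "i \<in> I" for i
      by (rule topological_group.topspace_eq_carrier[OF H[OF that]])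
    then show top: "topspace ?Q = carrier (product_group I H)"
      by (auto intro!: PiE_cong)
    have "continuous_map (prod_topology ?Q ?Q) (X i) (\<lambda>z. fst z i \<otimes>\<^bsub>H i\<^esub> snd z i)" if "i \<in> I" for i
      by (intro topological_group.continuous_map_mult[OF H[OF that]]
          continuous_map_compose[OF continuous_map_fst proj[OF that], unfolded o_def]
          continuous_map_compose[OF continuous_map_snd proj[OF that], unfolded o_def])
    then have "continuous_map (prod_topology ?Q ?Q) ?Q (\<lambda>z. \<lambda>i\<in>I. fst z i \<otimes>\<^bsub>H i\<^esub> snd z i)"
      by (simp add: continuous_map_componentwise image_subset_iff)
    then show "continuous_map (prod_topology ?Q ?Q) ?Q (\<lambda>(x, y). x \<otimes>\<^bsub>product_group I H\<^esub> y)"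
      by (simp add: case_prod_unfold)
    have "continuous_map ?Q (X i) (\<lambda>x. inv\<^bsub>H i\<^esub> x i)" if "i \<in> I" for i
      by (rule topological_group.continuous_map_inverse[OF H[OF that] proj[OF that]])
    then have "continuous_map ?Q ?Q (\<lambda>x. \<lambda>i\<in>I. inv\<^bsub>H i\<^esub> x i)"
      by (simp add: continuous_map_componentwise image_subset_iff)
    then show "continuous_map ?Q ?Q (\<lambda>x. inv\<^bsub>product_group I H\<^esub> x)"
      by (rule continuous_map_eq) (use top grp in \<open>simp add: inv_product_group\<close>)
  qed
qed

context topological_group
begin

abbreviation (input) "\<N> \<equiv> closed_finite_index_normals G T"

lemma closed_finite_index_normalsD:
  assumes "N \<in> \<N>"
  shows "N \<lhd> G" "closedin T N" "finite_index G N (carrier G)" "subgroup N G" "N \<subseteq> carrier G"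
  using assms normal_imp_subgroup subgroup.subset
  by (auto simp: closed_finite_index_normals_def closedin_carrier_subset)

lemma carrier_in_normals: "carrier G \<in> \<N>"
proof -
  have "carrier G \<lhd> G" by (simp add: normal_inv_iff subgroup_self)
  then show ?thesis
    using finite_index_refl[OF subgroup_self] closedin_topspace[of T]
    by (simp add: closed_finite_index_normals_def)
qed

lemma Int_in_normals:
  assumes "M \<in> \<N>" "N \<in> \<N>"
  shows "M \<inter> N \<in> \<N>"
  using closed_finite_index_normalsD[OF assms(1)] closed_finite_index_normalsD[OF assms(2)]
  by (simp add: closed_finite_index_normals_def normal_subgroup_intersect closedin_Int
      finite_index_Int2[OF subgroup_self])

lemma finite_Inter_in_normals:
  assumes "finite E" "E \<subseteq> \<N>"
  shows "\<exists>M\<in>\<N>. \<forall>N\<in>E. M \<subseteq> N"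
  using assms
proof (induction E)
  case empty
  then show ?case using carrier_in_normals by blast
next
  case (insert N E)
  then obtain M where "M \<in> \<N>" "\<forall>N\<in>E. M \<subseteq> N" by blast
  then show ?case using Int_in_normals[of N M] insert.prems by blast
qed

text \<open>The normal core: a subgroup of finite index has only finitely many conjugates.\<close>

lemma normal_core_in_normals:
  assumes N: "finite_index G N (carrier G)" "closedin T N"
  obtains M where "M \<in> \<N>" "M \<subseteq> N"
proof -
  have Ns: "subgroup N G" by (rule finite_index_subgroup[OF subgroup_self N(1)])
  note NG = subgroup.subset[OF Ns]
  define M where "M = (\<Inter>a\<in>carrier G. conjugate G a N)"
  obtain F where F: "finite F" "F \<subseteq> carrier G" "\<And>h. h \<in> carrier G \<Longrightarrow> \<exists>f\<in>F. \<exists>n\<in>N. h = f \<otimes> n"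
    using finite_index_coset_reps[OF subgroup_self N(1)] by metis
  have conj_cN: "conjugate G (f \<otimes> n) N = conjugate G f N" if "f \<in> F" "n \<in> N" for f n
    using conjugate_conjugate[of f n N] conjugate_by_member[OF Ns that(2)] that F(2) NG by auto
  have M_F: "M = (\<Inter>f\<in>F. conjugate G f N)"
  proof
    show "M \<subseteq> (\<Inter>f\<in>F. conjugate G f N)" unfolding M_def using F(2) by blast
    show "(\<Inter>f\<in>F. conjugate G f N) \<subseteq> M"
    proof
      fix x assume x: "x \<in> (\<Inter>f\<in>F. conjugate G f N)"
      have "x \<in> conjugate G a N" if a: "a \<in> carrier G" for a
      proof -
        obtain f n where "f \<in> F" "n \<in> N" "a = f \<otimes> n" using F(3)[OF a] by blast
        then show ?thesis using conj_cN x by auto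
      qed
      then show "x \<in> M" by (simp add: M_def)
    qed
  qed
  have "F \<noteq> {}" using F(3)[OF one_closed] by blast
  have conj_fi: "finite_index G (conjugate G a N) (carrier G)" if "a \<in> carrier G" for a
    using finite_index_conjugate[OF that subgroup_self N(1)] conjugate_by_member[OF subgroup_self that] by simp
  have "finite_index G (\<Inter>f\<in>E. conjugate G f N) (carrier G)"
    if "finite E" "E \<noteq> {}" "E \<subseteq> carrier G" for E
    using that
    by (induction E rule: finite_ne_induct) (simp_all add: conj_fi finite_index_Int2[OF subgroup_self])
  then have Mfi: "finite_index G M (carrier G)" unfolding M_F using F \<open>F \<noteq> {}\<close> by blast
  have Ms: "subgroup M G" by (rule finite_index_subgroup[OF subgroup_self Mfi])
  have mem_M: "x \<in> M \<longleftrightarrow> x \<in> carrier G \<and> (\<forall>a\<in>carrier G. inv a \<otimes> x \<otimes> a \<in> N)" for x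
    using mem_conjugate_iff[OF _ NG] one_closed unfolding M_def by blast
  have "M \<lhd> G"
    unfolding normal_inv_iff
  proof (intro conjI ballI)
    show "subgroup M G" by (rule Ms)
    fix g x assume g: "g \<in> carrier G" and x: "x \<in> M"
    have xc: "x \<in> carrier G" using x mem_M by blast
    have "inv a \<otimes> (g \<otimes> x \<otimes> inv g) \<otimes> a \<in> N" if a: "a \<in> carrier G" for a
    proof -
      have "inv (inv g \<otimes> a) \<otimes> x \<otimes> (inv g \<otimes> a) \<in> N" using x mem_M g a by simp
      then show ?thesis using g a xc by (simp add: group_normalise)
    qed
    then show "g \<otimes> x \<otimes> inv g \<in> M" using mem_M g xc by simp
  qed
  moreover have "closedin T M"
    unfolding M_def using closedin_conjugate[OF _ N(2)] one_closed by (intro closedin_INT) auto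
  moreover have "M \<subseteq> N" unfolding M_def using conjugate_one[OF NG] one_closed by blast
  ultimately show ?thesis using that Mfi by (simp add: closed_finite_index_normals_def)
qed

lemma finite_carrier_Mod:
  assumes "N \<in> \<N>"
  shows "finite (carrier (G Mod N))"
  using closed_finite_index_normalsD(3)[OF assms]
  by (simp add: finite_index_def FactGroup_def RCOSETS_def r_coset_def)

abbreviation (input) "\<iota> \<equiv> profinite_completion_map G T"

abbreviation (input) "inverse_limit \<equiv> carrier (profinite_completion G T)"

text \<open>The inverse limit is studied as a closed subgroup of the product of the finite quotients.\<close>

abbreviation (input) "quotients_topology \<equiv> product_topology (\<lambda>N. discrete_topology (carrier (G Mod N))) \<N>"

lemma inverse_limit_eq:
  "inverse_limit = {x \<in> \<Pi>\<^sub>E N\<in>\<N>. carrier (G Mod N). \<forall>M\<in>\<N>. \<forall>N\<in>\<N>. M \<subseteq> N \<longrightarrow> x M \<subseteq> x N}"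
  by (simp add: profinite_completion_def Let_def)

lemma profinite_completion_eq:
  "profinite_completion G T = (product_group \<N> (\<lambda>N. G Mod N))\<lparr>carrier := inverse_limit\<rparr>"
  by (simp add: profinite_completion_def Let_def)

lemma topological_group_quotients:
  "topological_group (product_group \<N> (\<lambda>N. G Mod N)) quotients_topology"
  using closed_finite_index_normalsD(1) normal.factorgroup_is_group
  by (intro topological_group_product_group topological_group_discrete) blast

lemma subgroup_inverse_limit: "subgroup inverse_limit (product_group \<N> (\<lambda>N. G Mod N))"
proof -
  have grp: "group (G Mod N)" if "N \<in> \<N>" for N
    using closed_finite_index_normalsD(1)[OF that] by (rule normal.factorgroup_is_group)
  interpret P: group "product_group \<N> (\<lambda>N. G Mod N)" using grp by simp
  show ?thesis
  proof (rule P.subgroupI)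
    show "inverse_limit \<subseteq> carrier (product_group \<N> (\<lambda>N. G Mod N))" by (auto simp: inverse_limit_eq)
    have "(\<lambda>N\<in>\<N>. N) \<in> inverse_limit"
      using group.is_monoid[OF grp, THEN monoid.one_closed] by (auto simp: inverse_limit_eq)
    then show "inverse_limit \<noteq> {}" by blast
    fix x assume x: "x \<in> inverse_limit"
    then have xP: "x \<in> carrier (product_group \<N> (\<lambda>N. G Mod N))"
      and xm: "\<And>M N. M \<in> \<N> \<Longrightarrow> N \<in> \<N> \<Longrightarrow> M \<subseteq> N \<Longrightarrow> x M \<subseteq> x N" by (auto simp: inverse_limit_eq)
    have inv_eq: "inv\<^bsub>product_group \<N> (\<lambda>N. G Mod N)\<^esub> x = (\<lambda>N\<in>\<N>. set_inv (x N))"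
    proof -
      have "inv\<^bsub>G Mod N\<^esub> x N = set_inv (x N)" if "N \<in> \<N>" for N
        using normal.inv_FactGroup[OF closed_finite_index_normalsD(1)[OF that]] xP that by auto
      then show ?thesis using inv_product_group[OF xP[unfolded carrier_product_group] grp] by (auto intro!: restrict_ext)
    qed
    show "inv\<^bsub>product_group \<N> (\<lambda>N. G Mod N)\<^esub> x \<in> inverse_limit"
      using P.inv_closed[OF xP] xm unfolding inv_eq inverse_limit_eq by (force simp: SET_INV_def)
    fix y assume y: "y \<in> inverse_limit"
    then have yP: "y \<in> carrier (product_group \<N> (\<lambda>N. G Mod N))"
      and ym: "\<And>M N. M \<in> \<N> \<Longrightarrow> N \<in> \<N> \<Longrightarrow> M \<subseteq> N \<Longrightarrow> y M \<subseteq> y N" by (auto simp: inverse_limit_eq)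
    show "x \<otimes>\<^bsub>product_group \<N> (\<lambda>N. G Mod N)\<^esub> y \<in> inverse_limit"
    proof -
      have "x M <#> y M \<subseteq> x N <#> y N" if "M \<in> \<N>" "N \<in> \<N>" "M \<subseteq> N" for M N
        by (rule mono_set_mult[OF xm[OF that] ym[OF that]])
      then show ?thesis using P.m_closed[OF xP yP] unfolding inverse_limit_eq by simp
    qed
  qed
qed

lemma topological_group_profinite_completion:
  "topological_group (profinite_completion G T) (profinite_completion_topology G T)"
  unfolding profinite_completion_topology_def
  by (subst profinite_completion_eq)
    (rule topological_group.topological_group_subgroup[OF topological_group_quotients subgroup_inverse_limit])

lemma closedin_inverse_limit: "closedin quotients_topology inverse_limit"
proof -
  let ?Q = quotients_topology
  have "closedin ?Q {x \<in> topspace ?Q. M \<subseteq> N \<longrightarrow> x M \<subseteq> x N}" if MN: "M \<in> \<N>" "N \<in> \<N>" for M N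
  proof -
    let ?D = "prod_topology (discrete_topology (carrier (G Mod M))) (discrete_topology (carrier (G Mod N)))"
    have "continuous_map ?Q (discrete_topology (carrier (G Mod A))) (\<lambda>x. x A)" if "A \<in> \<N>" for A
      by (rule continuous_map_product_projection[OF that])
    then have "continuous_map ?Q ?D (\<lambda>x. (x M, x N))" using MN by (simp add: continuous_map_paired)
    then have "closedin ?Q {x \<in> topspace ?Q. (x M, x N)
        \<in> {(a, b) \<in> carrier (G Mod M) \<times> carrier (G Mod N). M \<subseteq> N \<longrightarrow> a \<subseteq> b}}"
      by (rule closedin_continuous_map_preimage)
        (auto simp: prod_topology_discrete_topology[symmetric])
    moreover have "{x \<in> topspace ?Q. (x M, x N)
        \<in> {(a, b) \<in> carrier (G Mod M) \<times> carrier (G Mod N). M \<subseteq> N \<longrightarrow> a \<subseteq> b}}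
        = {x \<in> topspace ?Q. M \<subseteq> N \<longrightarrow> x M \<subseteq> x N}"
      using MN by auto
    ultimately show ?thesis by simp
  qed
  then have "closedin ?Q (\<Inter>M\<in>\<N>. \<Inter>N\<in>\<N>. {x \<in> topspace ?Q. M \<subseteq> N \<longrightarrow> x M \<subseteq> x N})"
    using carrier_in_normals by (intro closedin_INT) auto
  moreover have "(\<Inter>M\<in>\<N>. \<Inter>N\<in>\<N>. {x \<in> topspace ?Q. M \<subseteq> N \<longrightarrow> x M \<subseteq> x N}) = inverse_limit"
    unfolding inverse_limit_eq topspace_product_topology o_def topspace_discrete_topology
    using carrier_in_normals by blast
  ultimately show ?thesis by simp
qed

lemma topspace_profinite_completion [simp]:
  "topspace (profinite_completion_topology G T) = inverse_limit"
  using topological_group.topspace_eq_carrier[OF topological_group_profinite_completion] .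

lemma profinite_completion_profinite:
  "profinite_group (profinite_completion G T) (profinite_completion_topology G T)"
proof -
  let ?Q = quotients_topology
  have "compact_space ?Q"
    by (simp add: compact_space_product_topology compact_space_discrete_topology finite_carrier_Mod)
  then have "compact_space (profinite_completion_topology G T)"
    unfolding profinite_completion_topology_def
    by (intro compact_space_subtopology closedin_compact_space closedin_inverse_limit)
  then show ?thesis
    unfolding profinite_group_def
    using topological_group_profinite_completion
    by (auto simp: profinite_completion_topology_def Hausdorff_space_subtopology
        Hausdorff_space_product_topology totally_disconnected_space_subtopology
        totally_disconnected_space_product totally_disconnected_space_discrete)
qed

lemma profinite_completion_map_mem: "g \<in> carrier G \<Longrightarrow> \<iota> g \<in> inverse_limit"
  by (auto simp: inverse_limit_eq profinite_completion_map_def carrier_FactGroup r_coset_def)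

lemma profinite_completion_map_hom:
  "\<iota> \<in> hom G (profinite_completion G T)"
proof (rule homI)
  fix g h assume gh: "g \<in> carrier G" "h \<in> carrier G"
  show "\<iota> (g \<otimes> h)
      = \<iota> g \<otimes>\<^bsub>profinite_completion G T\<^esub> \<iota> h"
    using gh normal.rcos_sum[OF closed_finite_index_normalsD(1)]
    by (auto simp: profinite_completion_def Let_def profinite_completion_map_def intro!: restrict_ext)
qed (rule profinite_completion_map_mem)

lemma profinite_completion_map_continuous:
  "continuous_map T (profinite_completion_topology G T) \<iota>"
proof -
  have "continuous_map T (discrete_topology (carrier (G Mod N))) (\<lambda>g. \<iota> g N)"
    if N: "N \<in> \<N>" for N
  proof (rule continuous_map_into_discreteI)
    note ND = closed_finite_index_normalsD[OF N]
    have eval: "\<iota> b N = N #> b" for b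
      using N by (simp add: profinite_completion_map_def)
    fix g assume "g \<in> topspace T"
    then have g: "g \<in> carrier G" by simp
    then show "\<iota> g N \<in> carrier (G Mod N)"
      using N by (auto simp: profinite_completion_map_def carrier_FactGroup)
    have "N #> g = g <# N" using normal.coset_eq[OF ND(1)] g by blast
    then have "openin T (N #> g)"
      using openin_l_coset[OF g closed_finite_index_open[OF ND(3,2)]] by simp
    moreover have "g \<in> N #> g" by (rule rcos_self[OF g ND(4)])
    moreover have "N #> b = N #> g" if b: "b \<in> N #> g" for b
      using repr_independence[OF b g ND(4)] by simp
    ultimately show "\<exists>W. openin T W \<and> g \<in> W \<and>
        (\<forall>b\<in>W. \<iota> b N = \<iota> g N)"
      unfolding eval by blast
  qed
  moreover have "\<iota> g \<in> extensional \<N>" for g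
    by (simp add: profinite_completion_map_def)
  ultimately show ?thesis
    unfolding profinite_completion_topology_def
    using profinite_completion_map_mem
    by (auto simp: continuous_map_in_subtopology continuous_map_componentwise)
qed

text \<open>A basic neighbourhood of \<open>x\<close> constrains finitely many coordinates; a representative of the
  coordinate of \<open>x\<close> at a common refinement agrees with \<open>x\<close> in all of them.\<close>

lemma profinite_completion_map_dense:
  "profinite_completion_topology G T closure_of (\<iota> ` carrier G) = inverse_limit"
proof
  let ?Q = quotients_topology
  show "profinite_completion_topology G T closure_of (\<iota> ` carrier G) \<subseteq> inverse_limit"
    using closure_of_subset_topspace[of "profinite_completion_topology G T"] by simp
  show "inverse_limit \<subseteq> profinite_completion_topology G T closure_of (\<iota> ` carrier G)"
  proof
    fix x assume x: "x \<in> inverse_limit"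
    then have xP: "x \<in> (\<Pi>\<^sub>E N\<in>\<N>. carrier (G Mod N))"
      and xm: "\<And>M N. M \<in> \<N> \<Longrightarrow> N \<in> \<N> \<Longrightarrow> M \<subseteq> N \<Longrightarrow> x M \<subseteq> x N" by (auto simp: inverse_limit_eq)
    show "x \<in> profinite_completion_topology G T closure_of (\<iota> ` carrier G)"
      unfolding in_closure_of
    proof (intro conjI allI impI)
      show "x \<in> topspace (profinite_completion_topology G T)" using x by simp
      fix U assume U: "x \<in> U \<and> openin (profinite_completion_topology G T) U"
      then obtain W where W: "openin ?Q W" "U = W \<inter> inverse_limit"
        by (auto simp: profinite_completion_topology_def openin_subtopology)
      then obtain V where V: "finite {N \<in> \<N>. V N \<noteq> topspace (discrete_topology (carrier (G Mod N)))}"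
          "x \<in> PiE \<N> V" "PiE \<N> V \<subseteq> W"
        using bspec[OF W(1)[unfolded openin_product_topology_alt], of x] U by auto
      define E where "E = {N \<in> \<N>. V N \<noteq> carrier (G Mod N)}"
      have "finite E" "E \<subseteq> \<N>" using V(1) by (auto simp: E_def)
      then obtain M where M: "M \<in> \<N>" "\<forall>N\<in>E. M \<subseteq> N" using finite_Inter_in_normals by blast
      have "x M \<in> carrier (G Mod M)" using xP M(1) by (auto simp: PiE_iff)
      then obtain g where g: "g \<in> carrier G" "x M = M #> g" by (auto simp: carrier_FactGroup)
      have gM: "g \<in> x M" using rcos_self[OF g(1)] closed_finite_index_normalsD(4)[OF M(1)] g(2) by simp
      have agree: "N #> g = x N" if N: "N \<in> E" for N
      proof -
        have NN: "N \<in> \<N>" using N by (simp add: E_def)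
        have "x N \<in> carrier (G Mod N)" using xP NN by (auto simp: PiE_iff)
        then obtain h where h: "h \<in> carrier G" "x N = N #> h" by (auto simp: carrier_FactGroup)
        have "g \<in> N #> h" using gM xm[OF M(1) NN] M(2) N h(2) by blast
        then show ?thesis using repr_independence[OF _ h(1)] closed_finite_index_normalsD(4)[OF NN] h(2) by metis
      qed
      have gm: "\<iota> g \<in> inverse_limit" by (rule profinite_completion_map_mem[OF g(1)])
      have "\<iota> g N \<in> V N" if N: "N \<in> \<N>" for N
      proof (cases "N \<in> E")
        case True
        then show ?thesis using agree V(2) N by (auto simp: profinite_completion_map_def PiE_iff)
      next
        case False
        then show ?thesis using gm N by (auto simp: E_def inverse_limit_eq PiE_iff)
      qed
      moreover have "\<iota> g \<in> extensional \<N>"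
        by (simp add: profinite_completion_map_def)
      ultimately have "\<iota> g \<in> PiE \<N> V" by (simp add: PiE_iff)
      then have "\<iota> g \<in> U" using W(2) V(3) gm by blast
      then show "\<exists>y. y \<in> \<iota> ` carrier G \<and> y \<in> U" using g(1) by blast
    qed
  qed
qed

text \<open>A closed subgroup \<open>N\<close> of finite index contains a closed normal subgroup \<open>M\<close> of finite index.  The
coordinate at \<open>M\<close> is locally constant, so a limit of images of elements of \<open>N\<close> has the coset of an
element of \<open>N\<close> there.\<close>

theorem profinite_completion_separating:
  "separating_completion G T (carrier G) (profinite_completion G T) (profinite_completion_topology G T)
    \<iota>"
proof (rule separating_completion.intro[OF topological_group_axioms topological_group_profinite_completion],
    rule separating_completion_axioms.intro)
  let ?P = "profinite_completion_topology G T"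
  show "subgroup (carrier G) G" by (rule subgroup_self)
  show "closedin T (carrier G)" using closedin_topspace[of T] by simp
  show "commensurator G (carrier G) = carrier G"
    using commensurator_subset subset_commensurator[OF subgroup_self] by blast
  show "\<iota> \<in> hom G (profinite_completion G T)"
    by (rule profinite_completion_map_hom)
  show "?P closure_of (\<iota> ` carrier G) = inverse_limit"
    by (rule profinite_completion_map_dense)
  show "continuous_map (subtopology T (carrier G)) ?P \<iota>"
    by (intro continuous_map_from_subtopology profinite_completion_map_continuous)
  show "openin ?P (?P closure_of (\<iota> ` carrier G))"
    unfolding profinite_completion_map_dense using openin_topspace[of ?P] by simp
  have "subtopology ?P inverse_limit = ?P" using subtopology_topspace[of ?P] by simp
  then show "profinite_group (profinite_completion G T\<lparr>carrier := ?P closure_of (\<iota> ` carrier G)\<rparr>)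
      (subtopology ?P (?P closure_of (\<iota> ` carrier G)))"
    unfolding profinite_completion_map_dense using profinite_completion_profinite by simp
  fix N g
  assume N: "finite_index G N (carrier G)" "closedin T N" and g: "g \<in> carrier G"
    "\<iota> g \<in> ?P closure_of (\<iota> ` N)"
  have Ns: "subgroup N G" by (rule finite_index_subgroup[OF subgroup_self N(1)])
  note NG = subgroup.subset[OF Ns]
  obtain M where M: "M \<in> \<N>" "M \<subseteq> N" using normal_core_in_normals[OF N] .
  note MD = closed_finite_index_normalsD[OF M(1)]
  have cont: "continuous_map ?P (discrete_topology (carrier (G Mod M))) (\<lambda>x. x M)"
    unfolding profinite_completion_topology_def
    by (intro continuous_map_from_subtopology continuous_map_product_projection M(1))
  have "(\<lambda>x. x M) ` (?P closure_of (\<iota> ` N))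
      \<subseteq> discrete_topology (carrier (G Mod M)) closure_of ((\<lambda>x. x M) ` \<iota> ` N)"
    by (rule continuous_map_image_closure_subset[OF cont])
  then have "\<iota> g M \<in> (\<lambda>x. x M) ` \<iota> ` N"
    using g(2) by (auto simp: discrete_topology_closure_of)
  then obtain n where n: "n \<in> N" "M #> g = M #> n" using M(1) by (auto simp: profinite_completion_map_def)
  then have "g \<in> M #> n" using rcos_self[OF g(1) MD(4)] by simp
  then obtain m where "m \<in> M" "g = m \<otimes> n" by (auto simp: r_coset_def)
  then show "g \<in> N" using M(2) n(1) subgroup.m_closed[OF Ns] by blast
qed

end

section \<open>Properties of the localised profinite completion\<close>

theorem corollary3:
  fixes G :: "'a monoid" and T :: "'a topology" and K :: "'a set"
    and Gh :: "'h monoid" and Th :: "'h topology" and \<theta> :: "'a \<Rightarrow> 'h"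
  assumes "topological_group G T" and "subgroup K G" and "closedin T K"
    and "localised_completion TYPE('a set \<Rightarrow> 'a set) G T K Gh Th \<theta>"
  shows
    "\<comment> \<open>(i)\<close>
    (\<forall>(R :: 'r monoid) S \<phi> U.
       T = discrete_topology (carrier G) \<and> tdlc_group R S \<and> \<phi> \<in> hom G R \<and>
       subgroup U R \<and> openin S U \<and> compactin S U \<longrightarrow>
       (let K' = {g \<in> carrier G. \<phi> g \<in> U} in
         commensurator G K' = carrier G \<and>
         (\<forall>(Gh' :: 'h monoid) Th' \<theta>'.
            localised_completion TYPE('a set \<Rightarrow> 'a set) G T K' Gh' Th' \<theta>' \<longrightarrow>
            (\<exists>!\<psi>. \<psi> \<in> extensional (carrier Gh') \<and> \<psi> \<in> hom Gh' R \<and> continuous_map Th' S \<psi> \<and>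
               (\<forall>g \<in> carrier G. \<phi> g = \<psi> (\<theta>' g)))))) \<and>
    \<comment> \<open>(ii)\<close>
    (\<forall>H. subgroup H G \<and> H \<subseteq> commensurator G K \<and> K \<subseteq> H \<longrightarrow>
       localised_completion TYPE('r) (G\<lparr>carrier := H\<rparr>) (subtopology T H) K
         (Gh\<lparr>carrier := Th closure_of (\<theta> ` H)\<rparr>) (subtopology Th (Th closure_of (\<theta> ` H))) \<theta>) \<and>
    \<comment> \<open>(iii)\<close>
    (\<exists>\<beta>. topological_group_iso
            (profinite_completion (G\<lparr>carrier := K\<rparr>) (subtopology T K))
            (profinite_completion_topology (G\<lparr>carrier := K\<rparr>) (subtopology T K))
            (Gh\<lparr>carrier := Th closure_of (\<theta> ` K)\<rparr>) (subtopology Th (Th closure_of (\<theta> ` K))) \<beta> \<and>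
          (\<forall>k \<in> K. \<theta> k = \<beta> (profinite_completion_map (G\<lparr>carrier := K\<rparr>) (subtopology T K) k))) \<and>
    (localised_completion TYPE('r) (G\<lparr>carrier := K\<rparr>) (subtopology T K) K
       (profinite_completion (G\<lparr>carrier := K\<rparr>) (subtopology T K))
       (profinite_completion_topology (G\<lparr>carrier := K\<rparr>) (subtopology T K))
       (profinite_completion_map (G\<lparr>carrier := K\<rparr>) (subtopology T K))) \<and>
    \<comment> \<open>(iv)\<close>
    (kernel (G\<lparr>carrier := commensurator G K\<rparr>) Gh \<theta> =
       \<Inter> {N. finite_index G N K \<and> closedin (subtopology T K) N}) \<and>
    (\<forall>N. finite_index G N K \<and> closedin (subtopology T K) N \<longrightarrow>
       {g \<in> commensurator G K. \<theta> g \<in> Th closure_of (\<theta> ` N)} = N) \<and>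
    \<comment> \<open>(v)\<close>
    (\<forall>L. subgroup L G \<and> closedin T L \<and> commensurate G K L \<longrightarrow>
       commensurator G K = commensurator G L \<and>
       localised_completion TYPE('r) G T L Gh Th \<theta>) \<and>
    \<comment> \<open>(vi)\<close>
    (continuous_map (subtopology T (commensurator G K)) Th \<theta> \<longleftrightarrow>
       openin (subtopology T (commensurator G K)) K) \<and>
    (openin T (commensurator G K) \<longrightarrow>
       (continuous_map (subtopology T (commensurator G K)) Th \<theta> \<longleftrightarrow> openin T K)) \<and>
    \<comment> \<open>(vii)\<close>
    (T = discrete_topology (carrier G) \<and> commensurator G K = carrier G \<longrightarrow>
       (\<exists>\<eta>. \<eta> \<in> hom Gh (coset_closure G K) \<and>
          continuous_map Th (coset_closure_topology G K) \<eta> \<and>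
          open_map Th (coset_closure_topology G K) \<eta> \<and>
          \<eta> ` carrier Gh = carrier (coset_closure G K) \<and>
          kernel Gh (coset_closure G K) \<eta> =
            (\<Inter>x \<in> carrier Gh. conjugate Gh x (Th closure_of (\<theta> ` K))) \<and>
          (\<forall>g \<in> carrier G. coset_action G K g = \<eta> (\<theta> g)))) \<and>
    \<comment> \<open>(viii)\<close>
    (tdlc_group G T \<and> profinite_group (G\<lparr>carrier := K\<rparr>) (subtopology T K) \<longrightarrow>
       closedin Th (\<theta> ` K) \<and>
       \<theta> \<in> iso (G\<lparr>carrier := commensurator G K\<rparr>) Gh \<and>
       continuous_map Th (subtopology T (commensurator G K))
         (inv_into (commensurator G K) \<theta>) \<and>
       topological_group_iso (G\<lparr>carrier := commensurator G K\<rparr>) (localisation_topology G T K)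
         Gh Th \<theta> \<and>
       (openin T K \<longrightarrow>
          commensurator G K = carrier G \<and> topological_group_iso G T Gh Th \<theta>))"
proof -
  interpret G: topological_group G T by (rule assms(1))
  note K = assms(2) and Kcl = assms(3)
  define C where "C = commensurator G K"
  have Cs: "subgroup C G" unfolding C_def by (rule G.subgroup_commensurator[OF K])
  note CG = subgroup.subset[OF Cs] and KG = subgroup.subset[OF K]
  have KC: "K \<subseteq> C" unfolding C_def by (rule G.subset_commensurator[OF K])
  have sep: "separating_completion (G\<lparr>carrier := C\<rparr>) (subtopology T C) K Gh Th \<theta>"
    unfolding C_def by (rule localised_completion_separating[OF assms(4)])
  interpret L: separating_completion "G\<lparr>carrier := C\<rparr>" "subtopology T C" K Gh Th \<theta> by (rule sep)
  have sub_sub: "subtopology (subtopology T C) H = subtopology T H" if "H \<subseteq> C" for H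
    using that by (simp add: subtopology_subtopology Int_absorb1)
  have whole: "G\<lparr>carrier := C\<rparr> = G" "subtopology T C = T" if "C = carrier G"
    using that subtopology_topspace[of T] by simp_all

  have restricted: "separating_completion (G\<lparr>carrier := H\<rparr>) (subtopology T H) K
      (Gh\<lparr>carrier := Th closure_of (\<theta> ` H)\<rparr>) (subtopology Th (Th closure_of (\<theta> ` H))) \<theta>"
    if H: "subgroup H G" "H \<subseteq> C" "K \<subseteq> H" for H
    using L.restrict_to_subgroup[OF G.subgroup_incl[OF H(1) Cs H(2)] H(3)] sub_sub[OF H(2)] by simp
  have completion_of_K: "separating_completion (G\<lparr>carrier := K\<rparr>) (subtopology T K) K
      (profinite_completion (G\<lparr>carrier := K\<rparr>) (subtopology T K))
      (profinite_completion_topology (G\<lparr>carrier := K\<rparr>) (subtopology T K))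
      (profinite_completion_map (G\<lparr>carrier := K\<rparr>) (subtopology T K))"
    using topological_group.profinite_completion_separating[OF G.topological_group_subgroup[OF K]] by simp
  have iii: "\<exists>\<beta>. topological_group_iso
            (profinite_completion (G\<lparr>carrier := K\<rparr>) (subtopology T K))
            (profinite_completion_topology (G\<lparr>carrier := K\<rparr>) (subtopology T K))
            (Gh\<lparr>carrier := Th closure_of (\<theta> ` K)\<rparr>) (subtopology Th (Th closure_of (\<theta> ` K))) \<beta> \<and>
          (\<forall>k \<in> K. \<theta> k = \<beta> (profinite_completion_map (G\<lparr>carrier := K\<rparr>) (subtopology T K) k))"
    by (rule separating_completion_unique[OF restricted[OF K KC subset_refl] completion_of_K]) auto

  have closed_iff: "closedin (subtopology T C) N \<longleftrightarrow> closedin (subtopology T K) N" if "N \<subseteq> K" for N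
  proof
    assume "closedin (subtopology T C) N"
    then show "closedin (subtopology T K) N"
      using closedin_subset_topspace[of "subtopology T C" N K] that sub_sub[OF KC] by simp
  next
    assume "closedin (subtopology T K) N"
    then have "closedin T N" using Kcl by (rule closedin_trans_full)
    then show "closedin (subtopology T C) N" using that KC by (intro closedin_subset_topspace) auto
  qed
  (* K is closed, so a subset of K is closed in the commensurator iff it is closed in K. *)
  have fi_closed_iff: "finite_index G N K \<and> closedin (subtopology T C) N
      \<longleftrightarrow> finite_index G N K \<and> closedin (subtopology T K) N" for N
    using closed_iff[of N] G.finite_index_subset[OF K, of N] by blast
  have iv_kernel: "kernel (G\<lparr>carrier := C\<rparr>) Gh \<theta> =
      \<Inter> {N. finite_index G N K \<and> closedin (subtopology T K) N}"
    using L.kernel_eq_Inter by (simp add: fi_closed_iff)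
  have iv_vimage: "{g \<in> C. \<theta> g \<in> Th closure_of (\<theta> ` N)} = N"
    if "finite_index G N K \<and> closedin (subtopology T K) N" for N
    using L.vimage_tld[of N] that fi_closed_iff[of N] by simp

  have v: "C = commensurator G L \<and> localised_completion TYPE('r) G T L Gh Th \<theta>"
    if L: "subgroup L G" "closedin T L" "commensurate G K L" for L
  proof -
    have eq: "commensurator G L = C"
      unfolding C_def using G.commensurator_commensurate_eq[OF K L(1,3)] by simp
    have LC: "L \<subseteq> C" using G.subset_commensurator[OF L(1)] eq by simp
    have "separating_completion (G\<lparr>carrier := C\<rparr>) (subtopology T C) L Gh Th \<theta>"
      using L LC
      by (intro L.completion_at_commensurate_subgroup G.subgroup_incl Cs closedin_subset_topspace) auto
    then show ?thesis using localised_completionI[OF assms(1) L(1,2)] eq by simp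
  qed

  have vi: "continuous_map (subtopology T C) Th \<theta> \<longleftrightarrow> openin (subtopology T C) K"
    by (rule L.continuous_iff_open)
  have vi': "continuous_map (subtopology T C) Th \<theta> \<longleftrightarrow> openin T K" if "openin T C"
    using vi openin_open_subtopology[OF that] KC by simp

  have vii: "\<exists>\<eta>. \<eta> \<in> hom Gh (coset_closure G K) \<and>
          continuous_map Th (coset_closure_topology G K) \<eta> \<and>
          open_map Th (coset_closure_topology G K) \<eta> \<and>
          \<eta> ` carrier Gh = carrier (coset_closure G K) \<and>
          kernel Gh (coset_closure G K) \<eta> =
            (\<Inter>x \<in> carrier Gh. conjugate Gh x (Th closure_of (\<theta> ` K))) \<and>
          (\<forall>g \<in> carrier G. coset_action G K g = \<eta> (\<theta> g))"
    if "C = carrier G"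
  proof -
    interpret M: separating_completion G T K Gh Th \<theta> using sep unfolding whole[OF that] .
    show ?thesis by (rule M.quotient_onto_coset_closure) blast
  qed

  have viii: "closedin Th (\<theta> ` K) \<and>
       \<theta> \<in> iso (G\<lparr>carrier := C\<rparr>) Gh \<and>
       continuous_map Th (subtopology T C) (inv_into C \<theta>) \<and>
       topological_group_iso (G\<lparr>carrier := C\<rparr>) (localisation_topology G T K) Gh Th \<theta> \<and>
       (openin T K \<longrightarrow> C = carrier G \<and> topological_group_iso G T Gh Th \<theta>)"
    if prof: "profinite_group (G\<lparr>carrier := K\<rparr>) (subtopology T K)"
  proof (intro conjI impI)
    have pK: "profinite_group (G\<lparr>carrier := C\<rparr>\<lparr>carrier := K\<rparr>) (subtopology (subtopology T C) K)"
      using prof sub_sub[OF KC] by simp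
    show "closedin Th (\<theta> ` K)"
      using L.tld_K_eq[OF pK] closedin_closure_of[of Th "\<theta> ` K"] by simp
    show "\<theta> \<in> iso (G\<lparr>carrier := C\<rparr>) Gh" by (rule L.iso_if_profinite[OF pK])
    show "continuous_map Th (subtopology T C) (inv_into C \<theta>)"
      using L.continuous_inverse[OF pK] by simp
    show "topological_group_iso (G\<lparr>carrier := C\<rparr>) (localisation_topology G T K) Gh Th \<theta>"
      using L.localised_topology_via_completion[OF pK] sub_sub[OF KC]
      by (simp add: localisation_topology_def C_def)
    assume op: "openin T K"
    have "compactin T K" using prof KG by (simp add: profinite_group_def compactin_subspace)
    then show eq: "C = carrier G"
      unfolding C_def by (rule G.compact_open_subgroup_commensurated[OF K op])
    show "topological_group_iso G T Gh Th \<theta>"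
      using L.topological_iso_if_open[OF pK] op unfolding whole[OF eq] .
  qed

  have i: "commensurator G K' = carrier G \<and>
      (\<forall>(Gh' :: 'h monoid) Th' \<theta>'.
        localised_completion TYPE('a set \<Rightarrow> 'a set) G T K' Gh' Th' \<theta>' \<longrightarrow>
        (\<exists>!\<psi>. \<psi> \<in> extensional (carrier Gh') \<and> \<psi> \<in> hom Gh' R \<and> continuous_map Th' S \<psi> \<and>
           (\<forall>g \<in> carrier G. \<phi> g = \<psi> (\<theta>' g))))"
    if T: "T = discrete_topology (carrier G)" and R: "tdlc_group R S" and \<phi>: "\<phi> \<in> hom G R"
      and U: "subgroup U R" "openin S U" "compactin S U" and K': "K' = {g \<in> carrier G. \<phi> g \<in> U}"
    for R :: "'r monoid" and S \<phi> U K'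
  proof -
    interpret R: topological_group R S using R by (simp add: tdlc_group_def)
    have comm: "commensurator G K' = carrier G"
      unfolding K'
      by (rule commensurator_vimage[OF G.is_group R.is_group \<phi> U(1) R.compact_open_subgroup_commensurated[OF U]])
    moreover have "\<exists>!\<psi>. \<psi> \<in> extensional (carrier Gh') \<and> \<psi> \<in> hom Gh' R \<and> continuous_map Th' S \<psi> \<and>
           (\<forall>g \<in> carrier G. \<phi> g = \<psi> (\<theta>' g))"
      if loc: "localised_completion TYPE('a set \<Rightarrow> 'a set) G T K' Gh' Th' \<theta>'"
      for Gh' :: "'h monoid" and Th' \<theta>'
    proof -
      have "G\<lparr>carrier := commensurator G K'\<rparr> = G" "subtopology T (commensurator G K') = T"
        using comm subtopology_topspace[of T] by simp_all
      then interpret M: separating_completion G T K' Gh' Th' \<theta>'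
        using localised_completion_separating[OF loc] by simp
      have "continuous_map (subtopology T K') S \<phi>"
        unfolding T by (rule continuous_map_from_subtopology) (use hom_in_carrier[OF \<phi>] in auto)
      then show ?thesis
        by (intro M.factors_through_completion[OF R \<phi> U(1,3)]) (auto simp: K')
    qed
    ultimately show ?thesis by blast
  qed
  show ?thesis
    unfolding Let_def C_def[symmetric]
    by (intro conjI; (intro allI impI)?; (elim conjE)?)
      (rule i localised_completionI_commensurated[OF restricted] iii iv_kernel iv_vimage v vi vi' vii viii
        localised_completionI_commensurated[OF completion_of_K] conjI; (assumption | rule refl)?)+
qed

end
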